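(* Let $z_{i,j}$ ($i=1,\dots,m$, $j=1,\dots,n$) be i.i.d. samples in $\mathcal Z$, let $f_i(w)=\frac1n\sum_{j=1}^n\phi(w,z_{i,j})+\frac\lambda2\|w\|_2^2$ and $f=\frac1m\sum_{i=1}^mf_i$ on $\mathbb R^d$ with $\lambda>0$, where $\phi(\cdot,z)$ is convex for every $z\in\mathcal Z$. Assume there are finite constants $(V_0,G,L,M)$ such that for any $z\in\mathcal Z$: (i) $\phi(w,z)\ge0$ for all $w\in\mathbb R^d$ and $\phi(0,z)\le V_0$; (ii) $\|\phi'(w,z)\|_2\le G$ for any $\|w\|_2\le\sqrt{2V_0/\lambda}$; (iii) $\|\phi''(w,z)\|_2\le L-\lambda$ for any $w\in\mathbb R^d$; (iv) $\|\phi''(u,z)-\phi''(w,z)\|_2\le M\|u-w\|_2$ for any $u,w\in\mathbb R^d$. Assume that $f$ is standard self-concordant and that its minimizer $w_\star$ satisfies $\mathbb E[\|w_\star\|_2^2]\le D^2$ for some constant $D>0$. Let the input parameters to the DiSCO algorithm (see context) be $\rho=\frac{\sqrt6\,G}{\sqrt n\,D}$ and $\mu=\mu_{r,\delta}$, where $$\mu_{r,\delta}=\min\left\{L,\ \sqrt{\frac{32L^2d}{n}}\cdot\sqrt{\log\Bigl(1+\frac{rM\sqrt{2n}}{L}\Bigr)+\frac{\log(md/\delta)}{d}}\right\},$$ $$r=\left(\frac{2V_0}{\lambda}+\frac{2G}{\lambda}\sqrt{\frac{2V_0}{\lambda}}\right)^{1/2},\qquad \delta=\frac{GD}{\sqrt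 n}\cdot\frac{\sqrt{\lambda/(4L)}}{4V_0+2G^2/\lambda}$$ (with $\delta\in(0,1)$ understood). Then for any $\epsilon>0$, the total number of communication rounds $T$ required to reach $f(\widehat w)-f(w_\star)\le\epsilon$ satisfies $$\mathbb E[T]\le1+\left(C_1+\frac{6}{\omega(1/6)}\cdot\frac{GD}{\sqrt n}\right)\left(2+C_2\left(1+2\sqrt{\frac{32L^2d\,C_3}{\lambda^2n}}\right)^{1/2}\right),$$ where $\omega(t)=t-\log(1+t)$, $\beta=1/20$, $\lceil\cdot\rceil$ denotes the smallest nonnegative integer larger than or equal to its argument, and $$C_1=\left(1+\left\lceil\log_2\Bigl(\frac{2\omega(1/6)}{\epsilon}\Bigr)\right\rceil\right)\left(1+\frac1{\sqrt n}\cdot\frac{GD}{4V_0+2G^2/\lambda}\right),\quad C_2=\log\Bigl(\frac{2L}{\beta\lambda}\Bigr),\quad C_3=\log\Bigl(1+\frac{rM\sqrt{2n}}{L}\Bigr)+\frac{\log(dm/\delta)}{d}.$$ In particular, ignoring numerical constants and logarithmic terms, $$\mathbb E[T]=\widetilde{\mathcal O}\left(\Bigl(\log(1/\epsilon)+\frac{GD}{n^{1/2}}\Bigr)\Bigl(1+\frac{L^{1/2}d^{1/4}}{\lambda^{1/2}n^{1/4}}\Bigr)\right),$$ where $\widetilde{\mathcal O}$ hides universal constants, the quantities $C_2$, $C_3$ and the factor $1+\frac1{\sqrt n}\frac{GD}{4V_0+2G^2/\lambda}$. The expectation is with respect to the randomness in generating the i.i.d. data $\{z_{i,j}\}$.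
   Context: Primes on $\phi$ denote derivatives in $w$; matrix norms are spectral norms. A convex function $f:\mathbb R^d\to\mathbb R$ with continuous third derivatives is standard self-concordant if $|u^T(f'''(w)[u])u|\le 2(u^Tf''(w)u)^{3/2}$ for all $w,u\in\mathbb R^d$, where $f'''(w)[u]=\lim_{t\to0}\frac1t(f''(w+tu)-f''(w))$. Setting: there are $m$ machines; machine $i$ holds $f_i$; machine 1 is the master. In one round of communication the master broadcasts a message of $O(d)$ size to all machines and aggregates (sums or averages) messages of $O(d)$ size returned by the machines. DiSCO, inputs $\rho,\mu\ge0$. Initialization (one round): $w_0=\frac1m\sum_{i=1}^m\widehat w_i$ with $\widehat w_i=\arg\min_w\{f_i(w)+\frac\rho2\|w\|_2^2\}$. For $k=0,1,2,\dots$: compute $v_k$ by distributed PCG at $w_k$ (below), set $\delta_k=\sqrt{v_k^Tf''(w_k)v_k}$ and $w_{k+1}=w_k-\frac1{1+\delta_k}v_k$. Distributed PCG at $w_k$: let $H=f''(w_k)$, $P=f_1''(w_k)+\mu I$, $\epsilon_k=\beta(\lambda/L)^{1/2}\|f'(w_k)\|_2$ with $\beta=1/20$. One round forms $f'(w_k)$. Set $v^{(0)}=0$, $r^{(0)}=f'(w_k)$, $s^{(0)}=P^{-1}r^{(0)}$, $u^{(0)}=s^{(0)}$ (if $f'(w_k)=0$, return $v_k=0$). For $t=0,1,\dots$, each iteration using one round (to form $Hu^{(t)},Hv^{(t)}$): $\alpha_t=\frac{\langle r^{(t)},s^{(t)}\rangle}{\langle u^{(t)},Hu^{(t)}\rangle}$,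 $v^{(t+1)}=v^{(t)}+\alpha_tu^{(t)}$, $r^{(t+1)}=r^{(t)}-\alpha_tHu^{(t)}$, $s^{(t+1)}=P^{-1}r^{(t+1)}$, $\beta_t=\frac{\langle r^{(t+1)},s^{(t+1)}\rangle}{\langle r^{(t)},s^{(t)}\rangle}$, $u^{(t+1)}=s^{(t+1)}+\beta_tu^{(t)}$; stop as soon as $\|r^{(t+1)}\|_2\le\epsilon_k$ and return $v_k=v^{(t+1)}$. $T$ is the total number of rounds used (initialization plus all PCG calls) until the first iterate $\widehat w=w_k$ with the required accuracy is available. *)

theory Defs
  imports "HOL-Probability.Probability"
begin

definition grad :: "(real ^ 'd \<Rightarrow> real) \<Rightarrow> real ^ 'd \<Rightarrow> real ^ 'd"
  where "grad f w = (THE g. GDERIV f w :> g)"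

definition hess :: "(real ^ 'd \<Rightarrow> real) \<Rightarrow> real ^ 'd \<Rightarrow> real ^ 'd ^ 'd"
  where "hess f w = jacobian (grad f) (at w)"

definition third_deriv :: "(real ^ 'd \<Rightarrow> real) \<Rightarrow> real ^ 'd \<Rightarrow> real ^ 'd \<Rightarrow> real ^ 'd ^ 'd"
  where "third_deriv f w u = Lim (at 0) (\<lambda>t::real. (1 / t) *\<^sub>R (hess f (w + t *\<^sub>R u) - hess f w))"

definition twice_differentiable :: "(real ^ 'd \<Rightarrow> real) \<Rightarrow> bool"
  where "twice_differentiable f \<longleftrightarrow> (\<forall>w. f differentiable (at w)) \<and> (\<forall>w. grad f differentiable (at w))"

text \<open>In finite dimension, differentiability of the Hessian together with continuity of all the
  maps \<open>w \<mapsto> f'''(w)[u]\<close> is continuity of the third derivative.\<close>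

definition standard_self_concordant :: "(real ^ 'd \<Rightarrow> real) \<Rightarrow> bool"
  where "standard_self_concordant f \<longleftrightarrow>
    convex_on UNIV f \<and>
    twice_differentiable f \<and>
    (\<forall>w. hess f differentiable (at w)) \<and>
    (\<forall>u. continuous_on UNIV (\<lambda>w. third_deriv f w u)) \<and>
    (\<forall>w u. \<bar>u \<bullet> (third_deriv f w u *v u)\<bar> \<le> 2 * (u \<bullet> (hess f w *v u)) powr (3 / 2))"

definition spectral_norm :: "real ^ 'd ^ 'd \<Rightarrow> real"
  where "spectral_norm A = onorm (\<lambda>x. A *v x)"

definition omega :: "real \<Rightarrow> real"
  where "omega t = t - ln (1 + t)"

definition local_loss ::
    "(real ^ 'd \<Rightarrow> 'z \<Rightarrow> real) \<Rightarrow> real \<Rightarrow> nat \<Rightarrow> (nat \<Rightarrow> nat \<Rightarrow> 'z) \<Rightarrow> nat \<Rightarrow> real ^ 'd \<Rightarrow> real"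
  where "local_loss \<phi> lam n z i w = (1 / real n) * (\<Sum>j=1..n. \<phi> w (z i j)) + lam / 2 * (norm w)\<^sup>2"

definition average_loss :: "nat \<Rightarrow> (nat \<Rightarrow> real ^ 'd \<Rightarrow> real) \<Rightarrow> real ^ 'd \<Rightarrow> real"
  where "average_loss m F w = (1 / real m) * (\<Sum>i=1..m. F i w)"

definition minimizer :: "(real ^ 'd \<Rightarrow> real) \<Rightarrow> real ^ 'd"
  where "minimizer f = arg_min f (\<lambda>_. True)"

text \<open>The state after \<open>t\<close> iterations is the tuple \<open>(v, r, s, u)\<close>; the iteration is continued here
  regardless of the stopping criterion, which enters through \<open>pcg_iterations\<close> only.\<close>

primrec pcg :: "real ^ 'd ^ 'd \<Rightarrow> real ^ 'd ^ 'd \<Rightarrow> real ^ 'd \<Rightarrow> nat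
    \<Rightarrow> (real ^ 'd) \<times> (real ^ 'd) \<times> (real ^ 'd) \<times> (real ^ 'd)"
  where
    "pcg H P g 0 = (0, g, matrix_inv P *v g, matrix_inv P *v g)"
  | "pcg H P g (Suc t) =
      (let (v, r, s, u) = pcg H P g t;
           a = (r \<bullet> s) / (u \<bullet> (H *v u));
           v' = v + a *\<^sub>R u;
           r' = r - a *\<^sub>R (H *v u);
           s' = matrix_inv P *v r';
           b = (r' \<bullet> s') / (r \<bullet> s);
           u' = s' + b *\<^sub>R u
       in (v', r', s', u'))"

definition pcg_solution :: "real ^ 'd ^ 'd \<Rightarrow> real ^ 'd ^ 'd \<Rightarrow> real ^ 'd \<Rightarrow> nat \<Rightarrow> real ^ 'd"
  where "pcg_solution H P g t = fst (pcg H P g t)"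

definition pcg_residual :: "real ^ 'd ^ 'd \<Rightarrow> real ^ 'd ^ 'd \<Rightarrow> real ^ 'd \<Rightarrow> nat \<Rightarrow> real ^ 'd"
  where "pcg_residual H P g t = fst (snd (pcg H P g t))"

text \<open>The infimum is \<open>\<infinity>\<close> if the residual never becomes small enough.\<close>

definition pcg_iterations :: "real ^ 'd ^ 'd \<Rightarrow> real ^ 'd ^ 'd \<Rightarrow> real ^ 'd \<Rightarrow> real \<Rightarrow> enat"
  where "pcg_iterations H P g \<epsilon> =
    (if g = 0 then 0 else (INF t \<in> {t. norm (pcg_residual H P g (Suc t)) \<le> \<epsilon>}. enat (Suc t)))"

text \<open>Meaningful only if the method stops; otherwise \<open>disco_rounds_until\<close> below is infinite for all
  subsequent iterates. For \<open>g = 0\<close> the value is the initial vector \<open>0\<close>.\<close>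

definition pcg_output :: "real ^ 'd ^ 'd \<Rightarrow> real ^ 'd ^ 'd \<Rightarrow> real ^ 'd \<Rightarrow> real \<Rightarrow> real ^ 'd"
  where "pcg_output H P g \<epsilon> = pcg_solution H P g (the_enat (pcg_iterations H P g \<epsilon>))"

text \<open>Throughout, \<open>F i\<close> is the loss held by machine \<open>i \<in> {1..m}\<close>, and machine 1 is the master.\<close>

definition pcg_beta :: real
  where "pcg_beta = 1 / 20"

definition disco_tolerance ::
    "real \<Rightarrow> real \<Rightarrow> nat \<Rightarrow> (nat \<Rightarrow> real ^ 'd \<Rightarrow> real) \<Rightarrow> real ^ 'd \<Rightarrow> real"
  where "disco_tolerance lam L m F w = pcg_beta * sqrt (lam / L) * norm (grad (average_loss m F) w)"

definition disco_preconditioner ::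
    "real \<Rightarrow> (nat \<Rightarrow> real ^ 'd \<Rightarrow> real) \<Rightarrow> real ^ 'd \<Rightarrow> real ^ 'd ^ 'd"
  where "disco_preconditioner \<mu> F w = hess (F 1) w + \<mu> *\<^sub>R mat 1"

definition disco_pcg_iterations ::
    "real \<Rightarrow> real \<Rightarrow> real \<Rightarrow> nat \<Rightarrow> (nat \<Rightarrow> real ^ 'd \<Rightarrow> real) \<Rightarrow> real ^ 'd \<Rightarrow> enat"
  where "disco_pcg_iterations lam L \<mu> m F w =
    pcg_iterations (hess (average_loss m F) w) (disco_preconditioner \<mu> F w)
      (grad (average_loss m F) w) (disco_tolerance lam L m F w)"

definition disco_direction ::
    "real \<Rightarrow> real \<Rightarrow> real \<Rightarrow> nat \<Rightarrow> (nat \<Rightarrow> real ^ 'd \<Rightarrow> real) \<Rightarrow> real ^ 'd \<Rightarrow> real ^ 'd"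
  where "disco_direction lam L \<mu> m F w =
    pcg_output (hess (average_loss m F) w) (disco_preconditioner \<mu> F w)
      (grad (average_loss m F) w) (disco_tolerance lam L m F w)"

definition disco_init :: "real \<Rightarrow> nat \<Rightarrow> (nat \<Rightarrow> real ^ 'd \<Rightarrow> real) \<Rightarrow> real ^ 'd"
  where "disco_init \<rho> m F =
    (1 / real m) *\<^sub>R (\<Sum>i=1..m. minimizer (\<lambda>w. F i w + \<rho> / 2 * (norm w)\<^sup>2))"

primrec disco_iterate ::
    "real \<Rightarrow> real \<Rightarrow> real \<Rightarrow> real \<Rightarrow> nat \<Rightarrow> (nat \<Rightarrow> real ^ 'd \<Rightarrow> real) \<Rightarrow> nat \<Rightarrow> real ^ 'd"
  where
    "disco_iterate lam L \<rho> \<mu> m F 0 = disco_init \<rho> m F"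
  | "disco_iterate lam L \<rho> \<mu> m F (Suc k) =
      (let w = disco_iterate lam L \<rho> \<mu> m F k;
           v = disco_direction lam L \<mu> m F w;
           \<delta> = sqrt (v \<bullet> (hess (average_loss m F) w *v v))
       in w - (1 / (1 + \<delta>)) *\<^sub>R v)"

text \<open>Rounds used until the \<open>k\<close>-th iterate is available: one for the initialization, and for each
  of the preceding inner solves one for the gradient plus one per iteration.\<close>

definition disco_rounds_until ::
    "real \<Rightarrow> real \<Rightarrow> real \<Rightarrow> real \<Rightarrow> nat \<Rightarrow> (nat \<Rightarrow> real ^ 'd \<Rightarrow> real) \<Rightarrow> nat \<Rightarrow> enat"
  where "disco_rounds_until lam L \<rho> \<mu> m F k =
    1 + (\<Sum>j<k. 1 + disco_pcg_iterations lam L \<mu> m F (disco_iterate lam L \<rho> \<mu> m F j))"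

definition disco_accurate ::
    "real \<Rightarrow> real \<Rightarrow> real \<Rightarrow> real \<Rightarrow> nat \<Rightarrow> (nat \<Rightarrow> real ^ 'd \<Rightarrow> real) \<Rightarrow> real \<Rightarrow> nat \<Rightarrow> bool"
  where "disco_accurate lam L \<rho> \<mu> m F \<epsilon> k \<longleftrightarrow>
    average_loss m F (disco_iterate lam L \<rho> \<mu> m F k)
      - average_loss m F (minimizer (average_loss m F)) \<le> \<epsilon>"

definition disco_rounds ::
    "real \<Rightarrow> real \<Rightarrow> real \<Rightarrow> real \<Rightarrow> nat \<Rightarrow> (nat \<Rightarrow> real ^ 'd \<Rightarrow> real) \<Rightarrow> real \<Rightarrow> enat"
  where "disco_rounds lam L \<rho> \<mu> m F \<epsilon> =
    (if \<exists>k. disco_accurate lam L \<rho> \<mu> m F \<epsilon> k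
     then disco_rounds_until lam L \<rho> \<mu> m F (LEAST k. disco_accurate lam L \<rho> \<mu> m F \<epsilon> k)
     else \<infinity>)"

end

theory Submission
  imports Defs
begin

text \<open>Three facts carry the proof. (1) Along a segment, self-concordance bounds the objective from
  both sides, so an inexact damped Newton step decreases it by at least \<open>3/4 \<omega>(\<eta>)\<close>, \<open>\<eta>\<close> being the
  Newton decrement, while the gap is at most \<open>3/2 \<omega>(\<eta>)\<close> once \<open>\<eta> \<le> 1/6\<close>; hence a phase of constant
  decrease is followed by halving of the gap. (2) If the preconditioned spectrum lies in \<open>[a, b]\<close>,
  conjugate gradients reach the tolerance after \<open>\<surd>(b/a) ln (2L/(\<beta>\<lambda>))\<close> steps, by comparison with
  Chebyshev polynomials. (3) The samples are exchangeable. Exchanging single samples between machines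
  yields the stability bound on the expected initial gap; exchanging blocks of samples turns
  differences of local Hessians into Rademacher sums, whose trace moments and a net of the ball
  control the deviation of the preconditioner.

  The prescribed regularization \<open>\<mu>\<close> may be far smaller than the deviation on an exceptional event.
  Therefore not the probability of that event but the expectation of a random variable \<open>Y\<close> is
  bounded, where the deviation is at most \<open>\<mu> max 1 Y\<close> and \<open>b/a\<close> at most \<open>2LY/\<lambda>\<close> if \<open>Y > 1\<close>.\<close>

section \<open>Gradients and Hessians\<close>

text \<open>The shape of \<delta> is dictated by dependence: the initial gap and the deviation
  variable \<open>Y\<close> share the data, so the expectation of their product does not factorize.
  In that product the gap is replaced by its deterministic bound \<open>V\<^sub>0 + G * R\<close>,
  at most half of W = 4 \<open>V\<^sub>0\<close> + 2 G^2 / lam, and E[Y] <= \<delta> then pays both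
  for W and for the factor sqrt (2 L / lam) of the slow regime. The constant 6 is a budget: \<rho>
  balances regularization against stability and yields an expected gap of at most 41/20 X, where X =
  G D / sqrt n; the outer count doubles this to 41/10, and the slow regime costs 1 more.

  The tolerance factor sqrt (lam / L) translates a Euclidean residual into a relative error 1/20 in
  the norm of the Hessian, whence the 3/4.

  Spectral facts appear only as inequalities between quadratic forms: Cauchy-Schwarz for
  semidefinite forms and log-convexity of norms of powers take the place of diagonalization.
  Measurability is a separate task, since random functions are evaluated at random iterates and the
  round count may be infinite.\<close>

lemma grad_eqI: "GDERIV f w :> g \<Longrightarrow> grad f w = g"
  unfolding grad_def
proof (rule the_equality)
  fix g' assume "GDERIV f w :> g" "GDERIV f w :> g'"
  then have "(\<lambda>h. h \<bullet> g) = (\<lambda>h. h \<bullet> g')"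
    unfolding gderiv_def by (rule has_derivative_unique)
  then have "(g' - g) \<bullet> g = (g' - g) \<bullet> g'" by (rule fun_cong)
  then have "(g' - g) \<bullet> (g' - g) = 0" by (simp add: inner_diff_right)
  then show "g' = g" by simp
qed

lemma GDERIV_grad:
  assumes "f differentiable (at w)"
  shows "GDERIV f w :> grad f w"
proof -
  obtain f' where f': "(f has_derivative f') (at w)" using assms by (auto simp: differentiable_def)
  interpret f': bounded_linear f' using f' by (rule has_derivative_bounded_linear)
  have "f' h = h \<bullet> (\<chi> i. f' (axis i 1))" for h
  proof -
    have "f' h = f' (\<Sum>i\<in>UNIV. (h $ i) *\<^sub>R axis i 1)"
      using basis_expansion[of h] by (simp add: scalar_mult_eq_scaleR)
    also have "\<dots> = h \<bullet> (\<chi> i. f' (axis i 1))" by (simp add: f'.sum f'.scaleR inner_vec_def)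
    finally show ?thesis .
  qed
  then have "f' = (\<lambda>h. h \<bullet> (\<chi> i. f' (axis i 1)))" by (rule ext)
  then have "GDERIV f w :> (\<chi> i. f' (axis i 1))" using f' unfolding gderiv_def by simp
  then show ?thesis using grad_eqI by metis
qed

lemma hess_derivative:
  "grad f differentiable (at w) \<Longrightarrow> (grad f has_derivative (\<lambda>h. hess f w *v h)) (at w)"
  unfolding hess_def by (simp add: jacobian_works)

lemma hess_eqI:
  assumes "\<And>w. GDERIV f w :> g w" "(g has_derivative (\<lambda>h. A *v h)) (at w)"
  shows "hess f w = A"
proof -
  have "grad f = g" using grad_eqI[OF assms(1)] by blast
  with assms(2) have A: "(grad f has_derivative (\<lambda>h. A *v h)) (at w)" by simp
  then have "grad f differentiable (at w)" by (auto simp: differentiable_def)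
  from has_derivative_unique[OF hess_derivative[OF this] A]
  have "hess f w *v x = A *v x" for x by metis
  then show ?thesis by (simp add: matrix_eq)
qed

lemma twice_differentiableI:
  assumes "\<And>w. GDERIV f w :> g w" "\<And>w. (g has_derivative g' w) (at w)"
  shows "twice_differentiable f"
proof -
  have "grad f = g" using grad_eqI[OF assms(1)] by blast
  then show ?thesis using assms
    unfolding twice_differentiable_def gderiv_def differentiable_def by metis
qed

lemma twice_differentiableD:
  assumes "twice_differentiable f"
  shows "GDERIV f w :> grad f w" "(grad f has_derivative (\<lambda>h. hess f w *v h)) (at w)"
    "continuous_on UNIV f" "continuous_on UNIV (grad f)"
proof -
  have d: "f differentiable (at w)" "grad f differentiable (at w)" for w
    using assms by (auto simp: twice_differentiable_def)
  show "GDERIV f w :> grad f w" "(grad f has_derivative (\<lambda>h. hess f w *v h)) (at w)"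
    using d by (simp_all add: GDERIV_grad hess_derivative)
  show "continuous_on UNIV f" "continuous_on UNIV (grad f)"
    using d by (simp_all add: continuous_on_eq_continuous_at differentiable_imp_continuous_within)
qed

lemma line_derivative:
  assumes "twice_differentiable f"
  shows "((\<lambda>t. f (w + t *\<^sub>R u)) has_real_derivative grad f (w + t *\<^sub>R u) \<bullet> u) (at t)"
    "((\<lambda>t. grad f (w + t *\<^sub>R u) \<bullet> x) has_real_derivative x \<bullet> (hess f (w + t *\<^sub>R u) *v u)) (at t)"
proof -
  have l: "((\<lambda>t. w + t *\<^sub>R u) has_derivative (\<lambda>s. s *\<^sub>R u)) (at t)" for t
    by (auto intro!: derivative_eq_intros)
  have "((\<lambda>t. f (w + t *\<^sub>R u)) has_derivative (\<lambda>s. (s *\<^sub>R u) \<bullet> grad f (w + t *\<^sub>R u))) (at t)"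
    using has_derivative_compose[OF l twice_differentiableD(1)[OF assms, unfolded gderiv_def]] .
  then show "((\<lambda>t. f (w + t *\<^sub>R u)) has_real_derivative grad f (w + t *\<^sub>R u) \<bullet> u) (at t)"
    unfolding has_field_derivative_def by (simp add: inner_commute mult_commute_abs)
  have "((\<lambda>t. grad f (w + t *\<^sub>R u) \<bullet> x) has_derivative (\<lambda>s. (hess f (w + t *\<^sub>R u) *v (s *\<^sub>R u)) \<bullet> x)) (at t)"
    by (rule has_derivative_inner_left[OF has_derivative_compose[OF l twice_differentiableD(2)[OF assms]]])
  moreover have "(\<lambda>s. (hess f (w + t *\<^sub>R u) *v (s *\<^sub>R u)) \<bullet> x) = (*) (x \<bullet> (hess f (w + t *\<^sub>R u) *v u))"
    by (rule ext) (simp add: matrix_vector_mult_scaleR inner_commute mult.commute)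
  ultimately show "((\<lambda>t. grad f (w + t *\<^sub>R u) \<bullet> x) has_real_derivative x \<bullet> (hess f (w + t *\<^sub>R u) *v u)) (at t)"
    unfolding has_field_derivative_def by simp
qed

lemma spectral_norm_bounds:
  "norm (A *v x) \<le> spectral_norm A * norm x" "0 \<le> spectral_norm (A :: real ^ 'n ^ 'n)"
  unfolding spectral_norm_def
  using onorm[OF matrix_vector_mul_bounded_linear] onorm_pos_le[OF matrix_vector_mul_bounded_linear]
  by blast+

text \<open>\<open>hess\<close> is the Jacobian of the gradient, so symmetry has to be proved. The
  mixed second difference \<open>\<psi>\<close> is symmetric in x and y; two applications of the
  mean value theorem express it as t^2 times the Hessian form at a nearby point, and the Lipschitz
  bound at w makes the error of order t^3.\<close>

lemma hess_symmetric:
  fixes f :: "real ^ 'n \<Rightarrow> real"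
  assumes f: "twice_differentiable f"
    and lip: "\<And>u. spectral_norm (hess f u - hess f w) \<le> M * norm (u - w)"
  shows "x \<bullet> (hess f w *v y) = y \<bullet> (hess f w *v x)"
proof -
  define \<psi> where "\<psi> x y t = f (w + t *\<^sub>R x + t *\<^sub>R y) - f (w + t *\<^sub>R x) - f (w + t *\<^sub>R y) + f w" for x y :: "real ^ 'n" and t
  define C where "C x y = \<bar>M\<bar> * (norm x + norm y) * norm x * norm y" for x y :: "real ^ 'n"
  have near: "\<bar>\<psi> x y t - t\<^sup>2 * (x \<bullet> (hess f w *v y))\<bar> \<le> t\<^sup>2 * (t * C x y)" if t: "t > 0" for x y t
  proof -
    define u where "u s = f ((w + t *\<^sub>R y) + s *\<^sub>R x) - f (w + s *\<^sub>R x)" for s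
    have "(u has_real_derivative (grad f ((w + t *\<^sub>R y) + s *\<^sub>R x) \<bullet> x - grad f (w + s *\<^sub>R x) \<bullet> x)) (at s)" for s
      unfolding u_def by (intro DERIV_diff line_derivative f)
    then obtain \<xi> where \<xi>: "0 < \<xi>" "\<xi> < t"
      "u t - u 0 = t * (grad f ((w + t *\<^sub>R y) + \<xi> *\<^sub>R x) \<bullet> x - grad f (w + \<xi> *\<^sub>R x) \<bullet> x)"
      using MVT2[OF t, of u "\<lambda>s. grad f ((w + t *\<^sub>R y) + s *\<^sub>R x) \<bullet> x - grad f (w + s *\<^sub>R x) \<bullet> x"] by auto
    obtain \<zeta> where \<zeta>: "0 < \<zeta>" "\<zeta> < t"
      "grad f ((w + \<xi> *\<^sub>R x) + t *\<^sub>R y) \<bullet> x - grad f ((w + \<xi> *\<^sub>R x) + 0 *\<^sub>R y) \<bullet> x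
        = t * (x \<bullet> (hess f ((w + \<xi> *\<^sub>R x) + \<zeta> *\<^sub>R y) *v y))"
      using MVT2[OF t line_derivative(2)[OF f, of "w + \<xi> *\<^sub>R x" y x]] by auto
    let ?p = "(w + \<xi> *\<^sub>R x) + \<zeta> *\<^sub>R y"
    have "\<psi> x y t = u t - u 0" by (simp add: \<psi>_def u_def add_ac)
    also have "\<dots> = t * (t * (x \<bullet> (hess f ?p *v y)))"
      using \<xi>(3) \<zeta>(3) by (simp add: add_ac)
    finally have "\<psi> x y t - t\<^sup>2 * (x \<bullet> (hess f w *v y)) = t\<^sup>2 * (x \<bullet> ((hess f ?p - hess f w) *v y))"
      by (simp add: power2_eq_square matrix_vector_mult_diff_rdistrib inner_diff_right right_diff_distrib mult.assoc)
    moreover have "\<bar>x \<bullet> ((hess f ?p - hess f w) *v y)\<bar> \<le> t * C x y"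
    proof -
      have "\<bar>x \<bullet> ((hess f ?p - hess f w) *v y)\<bar> \<le> norm x * norm ((hess f ?p - hess f w) *v y)"
        by (rule Cauchy_Schwarz_ineq2)
      also have "\<dots> \<le> norm x * (spectral_norm (hess f ?p - hess f w) * norm y)"
        by (intro mult_left_mono spectral_norm_bounds) simp
      also have "\<dots> \<le> norm x * ((\<bar>M\<bar> * (t * (norm x + norm y))) * norm y)"
      proof (intro mult_left_mono mult_right_mono)
        have "norm (?p - w) \<le> norm (\<xi> *\<^sub>R x) + norm (\<zeta> *\<^sub>R y)"
          using norm_triangle_ineq[of "\<xi> *\<^sub>R x" "\<zeta> *\<^sub>R y"] by (simp add: algebra_simps)
        also have "\<dots> \<le> t * norm x + t * norm y"
          using \<xi> \<zeta> by (intro add_mono) (auto intro!: mult_right_mono)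
        finally have "norm (?p - w) \<le> t * (norm x + norm y)" by (simp add: algebra_simps)
        then have "\<bar>M\<bar> * norm (?p - w) \<le> \<bar>M\<bar> * (t * (norm x + norm y))" by (intro mult_left_mono) auto
        moreover have "M * norm (?p - w) \<le> \<bar>M\<bar> * norm (?p - w)" by (intro mult_right_mono) auto
        ultimately show "spectral_norm (hess f ?p - hess f w) \<le> \<bar>M\<bar> * (t * (norm x + norm y))"
          using lip[of ?p] by linarith
      qed auto
      finally show ?thesis by (simp add: C_def mult_ac)
    qed
    ultimately show ?thesis by (simp add: abs_mult mult_left_mono)
  qed
  have sym: "\<psi> x y t = \<psi> y x t" for t by (simp add: \<psi>_def add_ac)
  have le: "\<bar>x \<bullet> (hess f w *v y) - y \<bullet> (hess f w *v x)\<bar> \<le> t * (C x y + C y x)" if t: "t > 0" for t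
  proof -
    have "t\<^sup>2 * \<bar>x \<bullet> (hess f w *v y) - y \<bullet> (hess f w *v x)\<bar>
       = \<bar>(\<psi> y x t - t\<^sup>2 * (y \<bullet> (hess f w *v x))) - (\<psi> x y t - t\<^sup>2 * (x \<bullet> (hess f w *v y)))\<bar>"
      by (simp add: sym[symmetric] right_diff_distrib[symmetric] abs_mult)
    also have "\<dots> \<le> t\<^sup>2 * (t * C y x) + t\<^sup>2 * (t * C x y)"
      using near[OF t, of x y] near[OF t, of y x] by linarith
    also have "\<dots> = t\<^sup>2 * (t * (C x y + C y x))" by (simp add: algebra_simps)
    finally show ?thesis using t by simp
  qed
  have "((\<lambda>t. t * (C x y + C y x)) \<longlongrightarrow> 0 * (C x y + C y x)) (at_right 0)"
    by (intro tendsto_intros)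
  then have "((\<lambda>t. t * (C x y + C y x)) \<longlongrightarrow> 0) (at_right 0)" by simp
  then have "\<bar>x \<bullet> (hess f w *v y) - y \<bullet> (hess f w *v x)\<bar> \<le> 0"
    by (rule tendsto_lowerbound) (auto simp: eventually_at_right_less intro!: eventually_mono[OF eventually_at_right_less] le)
  then show ?thesis by simp
qed

text \<open>On the segment, f minus its linear interpolant cannot exceed its initial value by
  convexity; a tangent steeper than the chord would make it increase at first.\<close>

lemma convex_ge_tangent:
  assumes f: "twice_differentiable f" and "convex_on UNIV f"
  shows "f x + grad f x \<bullet> (y - x) \<le> f y"
proof (rule ccontr)
  assume "\<not> ?thesis"
  then have pos: "grad f x \<bullet> (y - x) - (f y - f x) > 0" by simp
  define h where "h t = f (x + t *\<^sub>R (y - x)) - t * (f y - f x)" for t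
  have "(h has_real_derivative grad f (x + 0 *\<^sub>R (y - x)) \<bullet> (y - x) - 1 * (f y - f x)) (at 0)"
    unfolding h_def by (intro DERIV_diff line_derivative f DERIV_cmult_right DERIV_ident)
  from DERIV_pos_inc_right[OF this] pos
  obtain d where d: "d > 0" "\<And>t. 0 < t \<Longrightarrow> t < d \<Longrightarrow> h 0 < h (0 + t)"
    by auto
  define t where "t = min 1 (d / 2)"
  have t: "0 < t" "t < d" "t \<le> 1" using d(1) by (auto simp: t_def min_def)
  have "f ((1 - t) *\<^sub>R x + t *\<^sub>R y) \<le> (1 - t) * f x + t * f y"
    using assms(2) t by (auto simp: convex_on_def)
  moreover have "x + t *\<^sub>R (y - x) = (1 - t) *\<^sub>R x + t *\<^sub>R y" by (simp add: algebra_simps)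
  ultimately have "h t \<le> h 0" by (simp add: h_def algebra_simps)
  then show False using d(2)[OF t(1,2)] by simp
qed

text \<open>Adding the tangent inequalities at two points gives monotonicity of the gradient along
  u, whereas a negative second derivative would make it decrease immediately to the right.\<close>

lemma convex_hess_nonneg:
  assumes f: "twice_differentiable f" and "convex_on UNIV f"
  shows "0 \<le> u \<bullet> (hess f w *v u)"
proof (rule ccontr)
  assume "\<not> ?thesis"
  then have neg: "u \<bullet> (hess f (w + 0 *\<^sub>R u) *v u) < 0" by simp
  obtain d where d: "d > 0"
    "\<And>t. 0 < t \<Longrightarrow> t < d \<Longrightarrow> grad f (w + (0 + t) *\<^sub>R u) \<bullet> u < grad f (w + 0 *\<^sub>R u) \<bullet> u"
    using DERIV_neg_dec_right[OF line_derivative(2)[OF f] neg] by auto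
  define t where "t = d / 2"
  have t: "0 < t" "t < d" using d(1) by (auto simp: t_def)
  let ?y = "w + t *\<^sub>R u"
  have "f w + grad f w \<bullet> (?y - w) \<le> f ?y" "f ?y + grad f ?y \<bullet> (w - ?y) \<le> f w"
    using convex_ge_tangent[OF assms] by blast+
  then have "0 \<le> t * (grad f ?y \<bullet> u - grad f w \<bullet> u)" by (simp add: algebra_simps)
  then show False using d(2)[OF t] t by (simp add: zero_le_mult_iff)
qed

section \<open>Strongly convex functions and their minimizers\<close>

text \<open>\<open>minimizer\<close> picks by choice among all minimizers, so attainment at a single
  point \<open>x\<close> suffices.\<close>

lemma minimizer_le:
  assumes "\<And>y. g x \<le> g y"
  shows "g (minimizer g) \<le> g y"
proof -
  have "is_arg_min g (\<lambda>_. True) x" using assms by (auto simp: is_arg_min_linorder)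
  then have "is_arg_min g (\<lambda>_. True) (minimizer g)"
    unfolding minimizer_def arg_min_def by (rule someI)
  then show ?thesis by (simp add: is_arg_min_linorder)
qed

lemma coercive_minimizer:
  fixes g :: "real ^ 'd \<Rightarrow> real"
  assumes g: "continuous_on UNIV g" and c: "c > 0" and ge: "\<And>w. c / 2 * (norm w)\<^sup>2 \<le> g w"
  shows "g (minimizer g) \<le> g y"
proof -
  \<comment> \<open>Outside the ball of this radius the quadratic lower bound exceeds
    \<open>g 0\<close>, so the minimum over the compact ball is global.\<close>
  define R where "R = sqrt (2 * g 0 / c)"
  have g0: "0 \<le> g 0" using ge[of 0] by simp
  have "continuous_on (cball 0 R) g" using g continuous_on_subset by blast
  moreover have "0 \<in> cball (0 :: real ^ 'd) R" using g0 c by (simp add: R_def)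
  ultimately obtain x where x: "x \<in> cball 0 R" "\<And>y. y \<in> cball 0 R \<Longrightarrow> g x \<le> g y"
    using continuous_attains_inf[of "cball 0 R" g] by (metis compact_cball empty_iff)
  have "g x \<le> g y" for y
  proof (cases "y \<in> cball 0 R")
    case False
    then have "R < norm y" by simp
    moreover have "0 \<le> R" using g0 c by (simp add: R_def)
    ultimately have "R\<^sup>2 < (norm y)\<^sup>2" by (simp add: power_strict_mono)
    then have "g 0 < c / 2 * (norm y)\<^sup>2" using g0 c by (simp add: R_def field_simps)
    then have "g 0 < g y" using ge[of y] by simp
    moreover have "g x \<le> g 0" using x(2) \<open>0 \<in> cball 0 R\<close> by blast
    ultimately show ?thesis by simp
  qed (use x in blast)
  then show ?thesis by (rule minimizer_le)
qed

text \<open>Comparing x with (1 - t) x + t y, the identity for the squared norm leaves the surplus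
  c/2 t (1 - t) |y - x|^2; division by t and t -> 0 give the full modulus c/2.\<close>

lemma strongly_convex_growth:
  fixes h :: "real ^ 'd \<Rightarrow> real"
  assumes h: "convex_on UNIV h" and min: "\<And>y. h x + c / 2 * (norm x)\<^sup>2 \<le> h y + c / 2 * (norm y)\<^sup>2"
  shows "h x + c / 2 * (norm x)\<^sup>2 + c / 2 * (norm (y - x))\<^sup>2 \<le> h y + c / 2 * (norm y)\<^sup>2"
proof -
  let ?g = "\<lambda>w. h w + c / 2 * (norm w)\<^sup>2"
  have "c / 2 * (norm (y - x))\<^sup>2 * (1 - t) \<le> ?g y - ?g x" if t: "0 < t" "t < 1" for t
  proof -
    let ?z = "(1 - t) *\<^sub>R x + t *\<^sub>R y"
    have "h ?z \<le> (1 - t) * h x + t * h y" using h t by (auto simp: convex_on_def)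
    moreover have "(norm ?z)\<^sup>2 = (1 - t) * (norm x)\<^sup>2 + t * (norm y)\<^sup>2 - t * (1 - t) * (norm (y - x))\<^sup>2"
      by (simp add: power2_norm_eq_inner inner_add_left inner_add_right inner_diff_left inner_diff_right
          inner_commute[of y x] algebra_simps)
    then have "c / 2 * (norm ?z)\<^sup>2 = c / 2 * ((1 - t) * (norm x)\<^sup>2 + t * (norm y)\<^sup>2 - t * (1 - t) * (norm (y - x))\<^sup>2)"
      by simp
    ultimately have "?g x \<le> (1 - t) * h x + t * h y
        + c / 2 * ((1 - t) * (norm x)\<^sup>2 + t * (norm y)\<^sup>2 - t * (1 - t) * (norm (y - x))\<^sup>2)"
      using min[of ?z] by linarith
    then have "t * (c / 2 * (norm (y - x))\<^sup>2 * (1 - t)) \<le> t * (?g y - ?g x)" by (simp add: field_simps)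
    then show ?thesis using t by simp
  qed
  then have "\<forall>\<^sub>F t in at_right 0. c / 2 * (norm (y - x))\<^sup>2 * (1 - t) \<le> ?g y - ?g x"
    by (auto simp: eventually_at_right[of 0 1] intro!: exI[of _ 1])
  moreover have "((\<lambda>t. c / 2 * (norm (y - x))\<^sup>2 * (1 - t)) \<longlongrightarrow> c / 2 * (norm (y - x))\<^sup>2 * (1 - 0)) (at_right 0)"
    by (intro tendsto_intros)
  ultimately have "c / 2 * (norm (y - x))\<^sup>2 * (1 - 0) \<le> ?g y - ?g x"
    by (intro tendsto_upperbound) auto
  then show ?thesis by simp
qed

section \<open>Inexact damped Newton steps for self-concordant functions\<close>

lemma DERIV_mono_on:
  fixes g :: "real \<Rightarrow> real"
  assumes "a \<le> b" "\<And>x. a \<le> x \<Longrightarrow> x \<le> b \<Longrightarrow> (g has_real_derivative g' x) (at x)"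
    "\<And>x. a \<le> x \<Longrightarrow> x \<le> b \<Longrightarrow> 0 \<le> g' x"
  shows "g a \<le> g b"
  by (rule DERIV_nonneg_imp_nondecreasing[OF assms(1)]) (use assms in blast)

lemma omega_derivative: "t > -1 \<Longrightarrow> (omega has_real_derivative t / (1 + t)) (at t)"
  unfolding omega_def by (auto intro!: derivative_eq_intros simp: field_simps)

lemma omega_0 [simp]: "omega 0 = 0"
  by (simp add: omega_def)

lemma omega_mono: "0 \<le> s \<Longrightarrow> s \<le> t \<Longrightarrow> omega s \<le> omega t"
  by (rule DERIV_mono_on[where g' = "\<lambda>t. t / (1 + t)"]) (auto intro!: omega_derivative)

lemma omega_nonneg: "0 \<le> t \<Longrightarrow> 0 \<le> omega t"
  using omega_mono[of 0 t] by simp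

lemma omega_strict_mono:
  assumes "0 \<le> s" "s < t" shows "omega s < omega t"
proof (rule DERIV_pos_imp_increasing_open[OF assms(2)])
  fix x assume "s < x" "x < t"
  then show "\<exists>y. (omega has_real_derivative y) (at x) \<and> 0 < y"
    using assms by (intro exI[of _ "x / (1 + x)"] conjI omega_derivative) auto
next
  show "continuous_on {s..t} omega"
    using assms by (intro continuous_at_imp_continuous_on ballI DERIV_isCont[OF omega_derivative]) auto
qed

text \<open>Both sides vanish at 0 and their difference has derivative t^2 / (1 + t)^2. The
  inequality turns the inexactness term of the Newton decrease into a fraction of
  \<open>omega\<close>.\<close>

lemma omega_ge:
  assumes "0 \<le> t" shows "t\<^sup>2 / (1 + t) \<le> 2 * omega t"
proof -
  have "2 * omega 0 - 0\<^sup>2 / (1 + 0) \<le> 2 * omega t - t\<^sup>2 / (1 + t)"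
  proof (rule DERIV_mono_on[OF assms, where g = "\<lambda>t. 2 * omega t - t\<^sup>2 / (1 + t)"
        and g' = "\<lambda>t. 2 * (t / (1 + t)) - (2 * t * (1 + t) - t\<^sup>2) / (1 + t)\<^sup>2"])
    fix x :: real assume x: "0 \<le> x"
    show "((\<lambda>t. 2 * omega t - t\<^sup>2 / (1 + t)) has_real_derivative
        2 * (x / (1 + x)) - (2 * x * (1 + x) - x\<^sup>2) / (1 + x)\<^sup>2) (at x)"
    proof (intro DERIV_diff DERIV_cmult omega_derivative)
      show "((\<lambda>t. t\<^sup>2 / (1 + t)) has_real_derivative (2 * x * (1 + x) - x\<^sup>2) / (1 + x)\<^sup>2) (at x)"
        by (rule derivative_eq_intros refl | use x in \<open>simp add: power2_eq_square\<close>)+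
    qed (use x in simp)
    have "2 * (x / (1 + x)) - (2 * x * (1 + x) - x\<^sup>2) / (1 + x)\<^sup>2 = x\<^sup>2 / (1 + x)\<^sup>2"
    proof -
      have "2 * (x / (1 + x)) = 2 * x * (1 + x) / (1 + x)\<^sup>2" using x by (simp add: power2_eq_square)
      then show ?thesis by (simp add: diff_divide_distrib)
    qed
    then show "0 \<le> 2 * (x / (1 + x)) - (2 * x * (1 + x) - x\<^sup>2) / (1 + x)\<^sup>2" by simp
  qed
  then show ?thesis by simp
qed

text \<open>The ratio 19/20 is the guaranteed size of the computed decrement relative to the exact
  one. On derivatives, the factor (19/20)^2 = 361/400 still exceeds 9/10.\<close>

lemma omega_scale:
  assumes "0 \<le> t" shows "9 / 10 * omega t \<le> omega (19 / 20 * t)"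
proof -
  have "omega (19 / 20 * 0) - 9 / 10 * omega 0 \<le> omega (19 / 20 * t) - 9 / 10 * omega t"
  proof (rule DERIV_mono_on[OF assms, where g = "\<lambda>t. omega (19 / 20 * t) - 9 / 10 * omega t"
        and g' = "\<lambda>t. (19 / 20 * t) / (1 + 19 / 20 * t) * (19 / 20) - 9 / 10 * (t / (1 + t))"])
    fix x :: real assume x: "0 \<le> x"
    have "((\<lambda>t. omega (19 / 20 * t)) has_real_derivative (19 / 20 * x) / (1 + 19 / 20 * x) * (19 / 20)) (at x)"
      using x by (intro DERIV_chain2[OF omega_derivative]) (auto intro!: derivative_eq_intros)
    then show "((\<lambda>t. omega (19 / 20 * t) - 9 / 10 * omega t) has_real_derivative
        (19 / 20 * x) / (1 + 19 / 20 * x) * (19 / 20) - 9 / 10 * (x / (1 + x))) (at x)"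
      using x by (intro DERIV_diff DERIV_cmult omega_derivative) auto
    show "0 \<le> (19 / 20 * x) / (1 + 19 / 20 * x) * (19 / 20) - 9 / 10 * (x / (1 + x))"
    proof -
      have "x / (1 + x) \<le> x / (1 + 19 / 20 * x)" using x by (intro frac_le) auto
      moreover have "0 \<le> x / (1 + x)" using x by simp
      moreover have "(19 / 20 * x) / (1 + 19 / 20 * x) * (19 / 20) = 361 / 400 * (x / (1 + 19 / 20 * x))" by simp
      moreover have "0 \<le> c - 9 / 10 * a" if "a \<le> b" "0 \<le> a" "c = 361 / 400 * b" for a b c :: real
        using that by simp
      ultimately show ?thesis by blast
    qed
  qed
  then show ?thesis by simp
qed

text \<open>The left side is the convex conjugate of \<open>omega\<close>. The derivative of the
  difference has the sign of 1/2 - 5/2 x, so any threshold up to 1/5 would do.\<close>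

lemma omega_conjugate_le:
  assumes "0 \<le> t" "t \<le> 1 / 6" shows "- t - ln (1 - t) \<le> 3 / 2 * omega t"
proof -
  have "3 / 2 * omega 0 + 0 + ln (1 - 0) \<le> 3 / 2 * omega t + t + ln (1 - t)"
  proof (rule DERIV_mono_on[OF assms(1), where g = "\<lambda>t. 3 / 2 * omega t + t + ln (1 - t)"
        and g' = "\<lambda>t. 3 / 2 * (t / (1 + t)) + 1 - 1 / (1 - t)"])
    fix x :: real assume x: "0 \<le> x" "x \<le> t"
    show "((\<lambda>t. 3 / 2 * omega t + t + ln (1 - t)) has_real_derivative 3 / 2 * (x / (1 + x)) + 1 - 1 / (1 - x)) (at x)"
    proof -
      have "((\<lambda>t. ln (1 - t)) has_real_derivative - (1 / (1 - x))) (at x)"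
        using x assms by (auto intro!: derivative_eq_intros)
      from DERIV_add[OF DERIV_add[OF DERIV_cmult[OF omega_derivative, of x "3 / 2"] DERIV_ident] this]
      show ?thesis using x by simp
    qed
    have "3 / 2 * (x / (1 + x)) + 1 - 1 / (1 - x) = x * (1 / 2 - 5 / 2 * x) / ((1 + x) * (1 - x))"
      using x assms by (simp add: divide_simps) (simp add: algebra_simps)
    then show "0 \<le> 3 / 2 * (x / (1 + x)) + 1 - 1 / (1 - x)" using x assms by simp
  qed
  then show ?thesis by simp
qed

text \<open>The derivative of q^(-1/2) is -q' / (2 q^(3/2)), which self-concordance bounds by 1 in
  modulus.\<close>

lemma self_concordant_profile:
  fixes q :: "real \<Rightarrow> real"
  assumes q: "\<And>t. (q has_real_derivative q' t) (at t)" "\<And>t. q t > 0"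
    and q': "\<And>t. \<bar>q' t\<bar> \<le> 2 * q t powr (3 / 2)" and t: "0 \<le> t"
  shows "1 / sqrt (q 0) - t \<le> 1 / sqrt (q t)" "1 / sqrt (q t) \<le> 1 / sqrt (q 0) + t"
proof -
  define d where "d t = - q' t / (2 * (q t * sqrt (q t)))" for t
  have D: "((\<lambda>t. 1 / sqrt (q t)) has_real_derivative d t) (at t)" for t
    using q(2)[of t] unfolding d_def
    by (auto intro!: derivative_eq_intros q(1) simp: field_simps)
  have "q t powr (3 / 2) = q t * sqrt (q t)" for t
    using q(2)[of t] powr_add[of "q t" 1 "1 / 2"] by (simp add: powr_half_sqrt)
  then have "\<bar>d t\<bar> \<le> 1" for t
    using q'[of t] q(2)[of t] by (simp add: d_def abs_mult divide_simps)
  then have d: "0 \<le> d t + 1" "0 \<le> 1 - d t" for t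
    unfolding abs_le_iff by (smt (verit))+
  have "1 / sqrt (q 0) + 0 \<le> 1 / sqrt (q t) + t"
    by (rule DERIV_mono_on[OF t, where g' = "\<lambda>x. d x + 1"])
      (use d(1) in \<open>auto intro!: DERIV_add D DERIV_ident\<close>)
  then show "1 / sqrt (q 0) - t \<le> 1 / sqrt (q t)" by simp
  have "0 - 1 / sqrt (q 0) \<le> t - 1 / sqrt (q t)"
    by (rule DERIV_mono_on[OF t, where g' = "\<lambda>x. 1 - d x"])
      (use d(2) in \<open>auto intro!: DERIV_diff D DERIV_ident\<close>)
  then show "1 / sqrt (q t) \<le> 1 / sqrt (q 0) + t" by simp
qed

text \<open>With q the second derivative along the segment, the bounds on q^(-1/2) give s^2 / (1 + t
  s)^2 <= q(t) <= s^2 / (1 - t s)^2; integrating twice yields both claims. Each integration is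
  carried out as monotonicity of an explicit auxiliary function.\<close>

lemma self_concordant_line:
  assumes sc: "standard_self_concordant f"
    and pos: "\<And>w u. u \<noteq> 0 \<Longrightarrow> 0 < u \<bullet> (hess f w *v u)"
  shows "sqrt (h \<bullet> (hess f w *v h)) < 1 \<Longrightarrow>
      f (w + h) \<le> f w + grad f w \<bullet> h - sqrt (h \<bullet> (hess f w *v h)) - ln (1 - sqrt (h \<bullet> (hess f w *v h)))"
    "f w + grad f w \<bullet> h + omega (sqrt (h \<bullet> (hess f w *v h))) \<le> f (w + h)"
proof -
  have f: "twice_differentiable f" and hd: "\<And>w. hess f differentiable (at w)"
    and sc': "\<And>w u. \<bar>u \<bullet> (third_deriv f w u *v u)\<bar> \<le> 2 * (u \<bullet> (hess f w *v u)) powr (3 / 2)"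
    using sc unfolding standard_self_concordant_def by auto
  define q where "q t = h \<bullet> (hess f (w + t *\<^sub>R h) *v h)" for t
  define \<psi> where "\<psi> t = f (w + t *\<^sub>R h)" for t
  define \<psi>' where "\<psi>' t = grad f (w + t *\<^sub>R h) \<bullet> h" for t
  define s where "s = sqrt (q 0)"
  have \<psi>: "(\<psi> has_real_derivative \<psi>' t) (at t)" and \<psi>': "(\<psi>' has_real_derivative q t) (at t)" for t
    unfolding \<psi>_def \<psi>'_def q_def using line_derivative[OF f] by blast+
  have "(sqrt (h \<bullet> (hess f w *v h)) < 1 \<longrightarrow> \<psi> 1 \<le> \<psi> 0 + \<psi>' 0 - s - ln (1 - s)) \<and> \<psi> 0 + \<psi>' 0 + omega s \<le> \<psi> 1"
  proof (cases "h = 0")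
    case True
    then show ?thesis by (simp add: \<psi>_def \<psi>'_def s_def q_def)
  next
    case False
    have qpos: "q t > 0" for t unfolding q_def using pos[OF False] .
    have s: "s > 0" using qpos by (simp add: s_def)
    have ss: "s * s = q 0" using qpos[of 0] by (simp add: s_def)
    define q' where "q' t = h \<bullet> (third_deriv f (w + t *\<^sub>R h) h *v h)" for t
    \<comment> \<open>\<open>third_deriv\<close> is a bare \<open>Lim\<close>; differentiability of
      the Hessian map supplies the convergence that identifies it with the directional
      derivative.\<close>
    have third: "((\<lambda>r. (1 / r) *\<^sub>R (hess f (p + r *\<^sub>R h) - hess f p)) \<longlongrightarrow> third_deriv f p h) (at 0)" for p
    proof -
      obtain D where D: "(hess f has_derivative D) (at p)" using hd[of p] by (auto simp: differentiable_def)
      have l: "((\<lambda>r. p + r *\<^sub>R h) has_vector_derivative h) (at 0)"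
        by (auto intro!: derivative_eq_intros)
      have "((\<lambda>r. hess f (p + r *\<^sub>R h)) has_derivative (\<lambda>r. D (r *\<^sub>R h))) (at 0)"
        using has_derivative_compose[OF l[unfolded has_vector_derivative_def], of "hess f" D] D by simp
      moreover have "D (r *\<^sub>R h) = r *\<^sub>R D h" for r
        using has_derivative_bounded_linear[OF D] by (simp add: linear_simps)
      ultimately have "((\<lambda>r. hess f (p + r *\<^sub>R h)) has_vector_derivative D h) (at 0)"
        by (simp add: has_vector_derivative_def)
      then have "((\<lambda>r. norm ((hess f (p + r *\<^sub>R h) - hess f p - r *\<^sub>R D h) /\<^sub>R \<bar>r\<bar>)) \<longlongrightarrow> 0) (at 0)"
        by (intro tendsto_norm_zero) (simp add: has_vector_derivative_def has_derivative_def)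
      then have "((\<lambda>r. norm ((1 / r) *\<^sub>R (hess f (p + r *\<^sub>R h) - hess f p) - D h)) \<longlongrightarrow> 0) (at 0)"
      proof (rule Lim_transform_eventually)
        show "\<forall>\<^sub>F r in at 0. norm ((hess f (p + r *\<^sub>R h) - hess f p - r *\<^sub>R D h) /\<^sub>R \<bar>r\<bar>)
            = norm ((1 / r) *\<^sub>R (hess f (p + r *\<^sub>R h) - hess f p) - D h)"
          unfolding eventually_at_filter
        proof (intro always_eventually allI impI)
          fix r :: real assume r: "r \<noteq> 0"
          have "(1 / r) *\<^sub>R (hess f (p + r *\<^sub>R h) - hess f p) - D h
              = (1 / r) *\<^sub>R (hess f (p + r *\<^sub>R h) - hess f p - r *\<^sub>R D h)"
            using r by (simp add: scaleR_diff_right)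
          then show "norm ((hess f (p + r *\<^sub>R h) - hess f p - r *\<^sub>R D h) /\<^sub>R \<bar>r\<bar>)
              = norm ((1 / r) *\<^sub>R (hess f (p + r *\<^sub>R h) - hess f p) - D h)"
            by (simp only: norm_scaleR) (simp add: divide_inverse)
        qed
      qed
      then have L: "((\<lambda>r. (1 / r) *\<^sub>R (hess f (p + r *\<^sub>R h) - hess f p)) \<longlongrightarrow> D h) (at 0)"
        by (simp only: tendsto_norm_zero_iff LIM_zero_iff)
      have "third_deriv f p h = D h"
        unfolding third_deriv_def by (rule tendsto_Lim[OF _ L]) simp
      then show ?thesis using L by simp
    qed
    have q: "(q has_real_derivative q' t) (at t)" for t
    proof -
      let ?p = "w + t *\<^sub>R h"
      have lin: "bounded_linear (\<lambda>A :: real ^ 'a ^ 'a. h \<bullet> (A *v h))"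
        by (intro linear_conv_bounded_linear[THEN iffD1] linearI)
          (simp_all add: matrix_vector_mult_add_rdistrib inner_add_right scaleR_matrix_vector_assoc[symmetric])
      have "((\<lambda>r. h \<bullet> (((1 / r) *\<^sub>R (hess f (?p + r *\<^sub>R h) - hess f ?p)) *v h)) \<longlongrightarrow> q' t) (at 0)"
        unfolding q'_def by (rule bounded_linear.tendsto[OF lin third])
      moreover have "h \<bullet> (((1 / r) *\<^sub>R (hess f (?p + r *\<^sub>R h) - hess f ?p)) *v h) = (q (t + r) - q t) / r" for r
        by (simp add: q_def scaleR_matrix_vector_assoc[symmetric] matrix_vector_mult_diff_rdistrib
            inner_diff_right scaleR_add_left add.assoc)
      ultimately show ?thesis by (simp add: DERIV_def)
    qed
    have q'_le: "\<bar>q' t\<bar> \<le> 2 * q t powr (3 / 2)" for t unfolding q'_def q_def by (rule sc')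
    note profile = self_concordant_profile[OF q qpos q'_le]
    have "\<psi> 1 \<le> \<psi> 0 + \<psi>' 0 - s - ln (1 - s)" if s1: "s < 1"
    proof -
      have upper: "q t \<le> s\<^sup>2 / (1 - t * s)\<^sup>2" if t: "0 \<le> t" "t \<le> 1" for t
      proof -
        have ts: "t * s < 1" using t s s1 by (metis mult_left_le_one_le less_imp_le order_le_less_trans)
        have "(1 - t * s) / s \<le> 1 / sqrt (q t)"
          using profile(1)[OF t(1)] s by (simp add: s_def[symmetric] diff_divide_distrib)
        then have "sqrt (q t) \<le> s / (1 - t * s)" using s ts qpos[of t] by (simp add: field_simps)
        then have "(sqrt (q t))\<^sup>2 \<le> (s / (1 - t * s))\<^sup>2" using qpos[of t] by (intro power_mono) auto
        then show ?thesis using qpos[of t] by (simp add: power_divide)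
      qed
      have *: "1 - t * s > 0" if "0 \<le> t" "t \<le> 1" for t
        using that s s1 by (metis diff_gt_0_iff_gt mult_left_le_one_le less_imp_le order_le_less_trans)
      have \<psi>'_le: "\<psi>' t \<le> \<psi>' 0 + s / (1 - t * s) - s" if t: "0 \<le> t" "t \<le> 1" for t
      proof -
        have "s / (1 - 0 * s) - \<psi>' 0 \<le> s / (1 - t * s) - \<psi>' t"
        proof (rule DERIV_mono_on[OF t(1), where g = "\<lambda>t. s / (1 - t * s) - \<psi>' t"
              and g' = "\<lambda>t. s\<^sup>2 / (1 - t * s)\<^sup>2 - q t"])
          fix x assume x: "0 \<le> x" "x \<le> t"
          then have "1 - x * s \<noteq> 0" using *[of x] t by simp
          then show "((\<lambda>t. s / (1 - t * s) - \<psi>' t) has_real_derivative s\<^sup>2 / (1 - x * s)\<^sup>2 - q x) (at x)"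
            by (auto intro!: derivative_eq_intros \<psi>' simp: power2_eq_square)
          show "0 \<le> s\<^sup>2 / (1 - x * s)\<^sup>2 - q x" using upper[of x] x t by simp
        qed
        then show ?thesis by simp
      qed
      have "- ln (1 - 0 * s) - s * 0 + \<psi>' 0 * 0 - \<psi> 0 \<le> - ln (1 - 1 * s) - s * 1 + \<psi>' 0 * 1 - \<psi> 1"
      proof (rule DERIV_mono_on[where g = "\<lambda>t. - ln (1 - t * s) - s * t + \<psi>' 0 * t - \<psi> t"
            and g' = "\<lambda>t. s / (1 - t * s) - s + \<psi>' 0 - \<psi>' t"])
        fix x :: real assume x: "0 \<le> x" "x \<le> 1"
        show "((\<lambda>t. - ln (1 - t * s) - s * t + \<psi>' 0 * t - \<psi> t) has_real_derivative
            s / (1 - x * s) - s + \<psi>' 0 - \<psi>' x) (at x)"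
          using *[OF x] by (auto intro!: derivative_eq_intros \<psi>)
        show "0 \<le> s / (1 - x * s) - s + \<psi>' 0 - \<psi>' x" using \<psi>'_le[OF x] by simp
      qed simp
      then show ?thesis by simp
    qed
    moreover have "\<psi> 0 + \<psi>' 0 + omega s \<le> \<psi> 1"
    proof -
      have lower: "s\<^sup>2 / (1 + t * s)\<^sup>2 \<le> q t" if t: "0 \<le> t" for t
      proof -
        have ts: "0 < 1 + t * s" using t s by (simp add: add_pos_nonneg)
        have "1 / sqrt (q t) \<le> (1 + t * s) / s"
          using profile(2)[OF t(1)] s by (simp add: s_def[symmetric] add_divide_distrib)
        then have "s / (1 + t * s) \<le> sqrt (q t)" using s ts qpos[of t] by (simp add: field_simps)
        then have "(s / (1 + t * s))\<^sup>2 \<le> (sqrt (q t))\<^sup>2" using s ts by (intro power_mono) auto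
        then show ?thesis using qpos[of t] by (simp add: power_divide)
      qed
      have *: "1 + t * s > 0" if "0 \<le> t" for t using that s by (simp add: add_pos_nonneg)
      have \<psi>'_ge: "\<psi>' 0 + s - s / (1 + t * s) \<le> \<psi>' t" if t: "0 \<le> t" for t
      proof -
        have "s / (1 + 0 * s) + \<psi>' 0 \<le> s / (1 + t * s) + \<psi>' t"
        proof (rule DERIV_mono_on[OF t, where g = "\<lambda>t. s / (1 + t * s) + \<psi>' t"
              and g' = "\<lambda>t. - s\<^sup>2 / (1 + t * s)\<^sup>2 + q t"])
          fix x assume x: "0 \<le> x" "x \<le> t"
          have "1 + x * s \<noteq> 0" using *[of x] x by simp
          then show "((\<lambda>t. s / (1 + t * s) + \<psi>' t) has_real_derivative - s\<^sup>2 / (1 + x * s)\<^sup>2 + q x) (at x)"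
            by (auto intro!: derivative_eq_intros \<psi>' simp: power2_eq_square)
          show "0 \<le> - s\<^sup>2 / (1 + x * s)\<^sup>2 + q x" using lower[of x] x by simp
        qed
        then show ?thesis by simp
      qed
      have "\<psi> 0 - \<psi>' 0 * 0 - s * 0 + ln (1 + 0 * s) \<le> \<psi> 1 - \<psi>' 0 * 1 - s * 1 + ln (1 + 1 * s)"
      proof (rule DERIV_mono_on[where g = "\<lambda>t. \<psi> t - \<psi>' 0 * t - s * t + ln (1 + t * s)"
            and g' = "\<lambda>t. \<psi>' t - \<psi>' 0 - s + s / (1 + t * s)"])
        fix x :: real assume x: "0 \<le> x" "x \<le> 1"
        show "((\<lambda>t. \<psi> t - \<psi>' 0 * t - s * t + ln (1 + t * s)) has_real_derivative
            \<psi>' x - \<psi>' 0 - s + s / (1 + x * s)) (at x)"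
          using *[of x] x by (auto intro!: derivative_eq_intros \<psi>)
        show "0 \<le> \<psi>' x - \<psi>' 0 - s + s / (1 + x * s)" using \<psi>'_ge[of x] x by simp
      qed simp
      then show ?thesis by (simp add: omega_def)
    qed
    ultimately show ?thesis by (simp add: s_def q_def)
  qed
  then show "sqrt (h \<bullet> (hess f w *v h)) < 1 \<Longrightarrow>
      f (w + h) \<le> f w + grad f w \<bullet> h - sqrt (h \<bullet> (hess f w *v h)) - ln (1 - sqrt (h \<bullet> (hess f w *v h)))"
    "f w + grad f w \<bullet> h + omega (sqrt (h \<bullet> (hess f w *v h))) \<le> f (w + h)"
    by (simp_all add: \<psi>_def \<psi>'_def s_def q_def)
qed


section \<open>Preconditioned conjugate gradients\<close>

lemma posdef_invertible:
  fixes A :: "real ^ 'd ^ 'd"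
  assumes "\<And>x. x \<noteq> 0 \<Longrightarrow> 0 < x \<bullet> (A *v x)"
  shows "invertible A"
proof -
  have "x = 0" if "A *v x = 0" for x
    using assms[of x] that by force
  then show ?thesis
    by (metis invertible_left_inverse matrix_left_invertible_ker)
qed

lemma matrix_inv_vector:
  fixes A :: "real ^ 'd ^ 'd"
  assumes "invertible A"
  shows "A *v (matrix_inv A *v x) = x" "matrix_inv A *v (A *v x) = x"
  using someI_ex[OF assms[unfolded invertible_def]]
  by (simp_all add: matrix_vector_mul_assoc matrix_inv_def)

lemma enat_INF_attained:
  assumes "A \<noteq> {}"
  obtains t where "t \<in> A" "(INF t\<in>A. f t) = (f t :: enat)"
proof -
  obtain a where "a \<in> A" using assms by blast
  then have "(INF t\<in>A. f t) \<in> f ` A" by (intro wellorder_InfI[of "f a"]) simp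
  then show ?thesis using that by blast
qed

section \<open>Krylov spaces and energy optimality of the conjugate gradient iterates\<close>

locale pcg_problem =
  fixes H P :: "real ^ 'd ^ 'd" and g :: "real ^ 'd"
  assumes H_sym: "\<And>x y. (H *v x) \<bullet> y = x \<bullet> (H *v y)"
    and P_sym: "\<And>x y. (P *v x) \<bullet> y = x \<bullet> (P *v y)"
    and H_pos: "\<And>x. x \<noteq> 0 \<Longrightarrow> 0 < x \<bullet> (H *v x)"
    and P_pos: "\<And>x. x \<noteq> 0 \<Longrightarrow> 0 < x \<bullet> (P *v x)"
begin

abbreviation Q where "Q \<equiv> matrix_inv P"
definition v where "v t = fst (pcg H P g t)"
definition r where "r t = fst (snd (pcg H P g t))"
definition s where "s t = fst (snd (snd (pcg H P g t)))"
definition u where "u t = snd (snd (snd (pcg H P g t)))"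
definition \<alpha> where "\<alpha> t = (r t \<bullet> s t) / (u t \<bullet> (H *v u t))"
definition \<beta> where "\<beta> t = (r (Suc t) \<bullet> s (Suc t)) / (r t \<bullet> s t)"

lemma v_0 [simp]: "v 0 = 0" and r_0 [simp]: "r 0 = g" and u_0 [simp]: "u 0 = s 0"
  by (simp_all add: v_def r_def s_def u_def)

lemma v_Suc: "v (Suc t) = v t + \<alpha> t *\<^sub>R u t"
  and r_Suc: "r (Suc t) = r t - \<alpha> t *\<^sub>R (H *v u t)"
  and u_Suc: "u (Suc t) = s (Suc t) + \<beta> t *\<^sub>R u t"
  by (simp_all add: \<alpha>_def \<beta>_def v_def r_def s_def u_def Let_def split: prod.split)

lemma s_eq: "s t = Q *v r t"
  by (cases t) (simp_all add: r_def s_def Let_def split: prod.split)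

lemmas Q_inverse = matrix_inv_vector[OF posdef_invertible[OF P_pos]]
lemmas H_inverse = matrix_inv_vector[OF posdef_invertible[OF H_pos]]

lemma Q_sym: "(Q *v x) \<bullet> y = x \<bullet> (Q *v y)"
  by (metis Q_inverse(1) P_sym)

lemma Q_pos: "x \<noteq> 0 \<Longrightarrow> 0 < x \<bullet> (Q *v x)"
  by (metis Q_inverse(1) P_pos inner_commute matrix_vector_mult_0_right)

lemma r_eq: "r t = g - H *v v t"
proof (induction t)
  case (Suc t)
  show ?case
    unfolding r_Suc v_Suc Suc
    by (simp add: matrix_vector_right_distrib vector_scaleR_matrix_ac matrix_vector_mult_scaleR)
qed simp

text \<open>The preconditioned operator: in general not symmetric for the Euclidean inner product,
  but self-adjoint for \<open>ip\<close>, the inner product of H.\<close>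

definition "G x = Q *v (H *v x)" for x

text \<open>This plays the role of the Krylov space; spanning it by the search directions makes
  conjugacy directly usable.\<close>

definition "K t = span (u ` {..<t})" for t

lemma K_Suc: "x \<in> K (Suc t) \<longleftrightarrow> (\<exists>k\<in>K t. \<exists>c. x = k + c *\<^sub>R u t)"
proof -
  have "u ` {..<Suc t} = insert (u t) (u ` {..<t})"
    by (auto simp: lessThan_Suc)
  then have "x \<in> K (Suc t) \<longleftrightarrow> (\<exists>c. x - c *\<^sub>R u t \<in> K t)"
    by (simp add: K_def span_insert)
  also have "\<dots> \<longleftrightarrow> (\<exists>k\<in>K t. \<exists>c. x = k + c *\<^sub>R u t)"
  proof safe
    fix c assume "x - c *\<^sub>R u t \<in> K t"
    then show "\<exists>k\<in>K t. \<exists>c. x = k + c *\<^sub>R u t"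
      by (intro bexI[of _ "x - c *\<^sub>R u t"] exI[of _ c]) auto
  next
    fix k c assume "k \<in> K t"
    then show "\<exists>ca. k + c *\<^sub>R u t - ca *\<^sub>R u t \<in> K t"
      by (intro exI[of _ c]) simp
  qed
  finally show ?thesis .
qed

lemma K_mono: "x \<in> K i \<Longrightarrow> i \<le> j \<Longrightarrow> x \<in> K j"
  unfolding K_def by (meson image_mono lessThan_subset_iff span_mono subsetD)

lemma K_u: "i < t \<Longrightarrow> u i \<in> K t"
  unfolding K_def by (auto intro: span_base)

lemma K_linear:
  "x \<in> K t \<Longrightarrow> y \<in> K t \<Longrightarrow> x + y \<in> K t" "x \<in> K t \<Longrightarrow> y \<in> K t \<Longrightarrow> x - y \<in> K t"
  "x \<in> K t \<Longrightarrow> c *\<^sub>R x \<in> K t" "0 \<in> K t"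
  unfolding K_def by (auto intro: span_add span_diff span_scale span_zero)

lemma G_add: "G (x + y) = G x + G y" and G_diff: "G (x - y) = G x - G y"
  and G_scale: "G (c *\<^sub>R x) = c *\<^sub>R G x"
  by (simp_all add: G_def matrix_vector_right_distrib matrix_vector_mult_diff_distrib
      matrix_vector_mult_scaleR)

text \<open>The five statements need one another: orthogonality of the new residual uses conjugacy,
  conjugacy of the new direction uses that \<open>G\<close> raises the index of \<open>K\<close> by
  one, and this inclusion comes from solving the recurrences for \<open>G (u t)\<close>. Nonzero
  residuals keep the quotients \<open>\<alpha>\<close> and \<open>\<beta>\<close>
  meaningful.\<close>

lemma invariant:
  assumes "\<And>i. i < t \<Longrightarrow> r i \<noteq> 0"
  shows "(\<forall>x\<in>K t. r t \<bullet> x = 0) \<and> (\<forall>x\<in>K t. u t \<bullet> (H *v x) = 0) \<and> u t - s t \<in> K t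
    \<and> (\<forall>x\<in>K t. G x \<in> K (Suc t)) \<and> v t \<in> K t"
  using assms
proof (induction t)
  case 0
  show ?case by (simp add: K_def G_def span_zero)
next
  case (Suc t)
  then have I: "\<And>x. x \<in> K t \<Longrightarrow> r t \<bullet> x = 0" "\<And>x. x \<in> K t \<Longrightarrow> u t \<bullet> (H *v x) = 0"
      "u t - s t \<in> K t" "\<And>x. x \<in> K t \<Longrightarrow> G x \<in> K (Suc t)" "v t \<in> K t"
    by auto
  have rt: "r t \<noteq> 0" using Suc by simp
  have rs: "0 < r t \<bullet> s t" using Q_pos[OF rt] by (simp add: s_eq)
  have ru: "r t \<bullet> u t = r t \<bullet> s t" using I(1)[OF I(3)] by (simp add: inner_diff_right)
  have "u t \<noteq> 0" using ru rs by auto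
  then have uHu: "0 < u t \<bullet> (H *v u t)" by (rule H_pos)
  have \<alpha>: "\<alpha> t > 0" using rs uHu by (simp add: \<alpha>_def)
  have \<alpha>u: "\<alpha> t * (u t \<bullet> (H *v u t)) = r t \<bullet> s t" using uHu by (simp add: \<alpha>_def)
  have i: "r (Suc t) \<bullet> x = 0" if x: "x \<in> K (Suc t)" for x
  proof -
    obtain k c where k: "k \<in> K t" "x = k + c *\<^sub>R u t" using x unfolding K_Suc by blast
    have "(H *v u t) \<bullet> k = 0" using I(2)[OF k(1)] by (simp add: H_sym)
    then show ?thesis using I(1)[OF k(1)] ru \<alpha>u H_sym[of "u t" "u t"]
      by (simp add: k(2) r_Suc inner_add_right inner_diff_left algebra_simps)
  qed
  have s_in: "s t \<in> K (Suc t)"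
    using K_linear(2)[OF K_u[of t "Suc t"] K_mono[OF I(3), of "Suc t"]] by simp
  have s_Suc_in: "s (Suc t) \<in> K (Suc (Suc t))"
    using K_linear(2)[OF K_u[of "Suc t" "Suc (Suc t)"] K_linear(3)[OF K_u[of t "Suc (Suc t)"], of "\<beta> t"]]
    by (simp add: u_Suc)
  have Hu: "H *v u t = (1 / \<alpha> t) *\<^sub>R (r t - r (Suc t))" using \<alpha> by (simp add: r_Suc)
  have Gu: "G (u t) = (1 / \<alpha> t) *\<^sub>R (s t - s (Suc t))"
    by (simp add: G_def Hu s_eq matrix_vector_mult_diff_distrib matrix_vector_mult_scaleR)
  have iv: "G x \<in> K (Suc (Suc t))" if x: "x \<in> K (Suc t)" for x
  proof -
    obtain k c where k: "k \<in> K t" "x = k + c *\<^sub>R u t" using x unfolding K_Suc by blast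
    have "G k \<in> K (Suc (Suc t))" using K_mono[OF I(4)[OF k(1)], of "Suc (Suc t)"] by simp
    moreover have "G (u t) \<in> K (Suc (Suc t))"
      unfolding Gu using K_mono[OF s_in, of "Suc (Suc t)"] s_Suc_in by (intro K_linear) auto
    ultimately show ?thesis unfolding k(2) G_add G_scale by (intro K_linear)
  qed
  \<comment> \<open>Against older directions, conjugacy follows from residual orthogonality, since
    \<open>G\<close> maps them into \<open>K (Suc t)\<close>; against \<open>u t\<close> it is
    exactly what the choice of \<open>\<beta>\<close> achieves.\<close>
  have ii: "u (Suc t) \<bullet> (H *v x) = 0" if x: "x \<in> K (Suc t)" for x
  proof -
    obtain k c where k: "k \<in> K t" "x = k + c *\<^sub>R u t" using x unfolding K_Suc by blast
    have "s (Suc t) \<bullet> (H *v k) = r (Suc t) \<bullet> G k"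
      by (simp add: s_eq G_def Q_sym)
    also have "\<dots> = 0" using i I(4) k(1) by blast
    finally have 1: "s (Suc t) \<bullet> (H *v k) = 0" .
    have "s (Suc t) \<bullet> r t = r (Suc t) \<bullet> s t" by (simp add: s_eq Q_sym)
    then have "s (Suc t) \<bullet> r t = 0" using i[OF s_in] by simp
    then have "s (Suc t) \<bullet> (H *v u t) = - (r (Suc t) \<bullet> s (Suc t)) / \<alpha> t"
      by (simp add: Hu inner_diff_right inner_commute)
    moreover have "\<beta> t * (u t \<bullet> (H *v u t)) = (r (Suc t) \<bullet> s (Suc t)) / \<alpha> t"
      using rs \<alpha> \<alpha>u uHu by (simp add: \<beta>_def field_simps)
    ultimately have 2: "s (Suc t) \<bullet> (H *v u t) + \<beta> t * (u t \<bullet> (H *v u t)) = 0" by simp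
    have "u (Suc t) \<bullet> (H *v x) = s (Suc t) \<bullet> (H *v k) + \<beta> t * (u t \<bullet> (H *v k))
      + c * (s (Suc t) \<bullet> (H *v u t) + \<beta> t * (u t \<bullet> (H *v u t)))"
      by (simp add: k(2) u_Suc inner_add_left matrix_vector_right_distrib inner_add_right
          matrix_vector_mult_scaleR algebra_simps)
    then show ?thesis using 1 2 I(2)[OF k(1)] by simp
  qed
  have "u (Suc t) - s (Suc t) \<in> K (Suc t)"
    unfolding u_Suc using K_linear(3)[OF K_u[of t "Suc t"]] by simp
  moreover have "v (Suc t) \<in> K (Suc t)"
    unfolding v_Suc using K_mono[OF I(5), of "Suc t"] K_u[of t "Suc t"] by (intro K_linear) auto
  ultimately show ?case using i ii iv by blast
qed

definition "ip x y = x \<bullet> (H *v y)" for x y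

lemma ip_commute: "ip x y = ip y x"
  unfolding ip_def by (metis H_sym inner_commute)

lemma ip_linear: "ip (x + y) z = ip x z + ip y z" "ip (x - y) z = ip x z - ip y z"
  "ip (c *\<^sub>R x) z = c * ip x z" "ip z (x + y) = ip z x + ip z y" "ip z (x - y) = ip z x - ip z y"
  "ip z (c *\<^sub>R x) = c * ip z x"
  by (simp_all add: ip_def inner_add_left inner_diff_left matrix_vector_right_distrib
      matrix_vector_mult_diff_distrib matrix_vector_mult_scaleR inner_add_right inner_diff_right)

lemma ip_nonneg: "0 \<le> ip x x"
  using H_pos[of x] by (cases "x = 0") (auto simp: ip_def)

lemma ip_G: "ip (G x) y = ip x (G y)"
proof -
  have "ip (G x) y = (Q *v (H *v x)) \<bullet> (H *v y)" by (simp add: ip_def G_def)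
  also have "\<dots> = (H *v x) \<bullet> G y" by (simp add: Q_sym G_def)
  also have "\<dots> = ip x (G y)" by (simp add: ip_def H_sym)
  finally show ?thesis .
qed

text \<open>The residual is orthogonal to \<open>K t\<close>, so the error is H-orthogonal to that
  space and Pythagoras applies.\<close>

lemma optimality:
  assumes "\<And>i. i < t \<Longrightarrow> r i \<noteq> 0" and x: "H *v x = g" and k: "k \<in> K t"
  shows "ip (x - v t) (x - v t) \<le> ip (x - k) (x - k)"
proof -
  have I: "\<And>x. x \<in> K t \<Longrightarrow> r t \<bullet> x = 0" "v t \<in> K t" using invariant[OF assms(1)] by auto
  have "r t \<bullet> (v t - k) = 0" using I k K_linear(2) by blast
  moreover have "r t = H *v (x - v t)" by (simp add: r_eq x matrix_vector_mult_diff_distrib)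
  ultimately have "ip (x - v t) (v t - k) = 0" by (simp add: ip_def H_sym)
  moreover have "ip (e + d) (e + d) = ip e e + 2 * ip e d + ip d d" for e d
    by (simp add: ip_linear ip_commute[of d e])
  from this[of "x - v t" "v t - k"]
  have "ip (x - k) (x - k) = ip (x - v t) (x - v t) + 2 * ip (x - v t) (v t - k) + ip (v t - k) (v t - k)"
    by simp
  ultimately have "ip (x - k) (x - k) = ip (x - v t) (x - v t) + ip (v t - k) (v t - k)" by simp
  then show ?thesis using ip_nonneg[of "v t - k"] by linarith
qed

end

text \<open>The discriminant argument for a form that is only semidefinite: if y is isotropic, the
  quadratic degenerates to a linear function, whose nonnegativity forces the mixed term to
  vanish.\<close>

lemma semi_Cauchy_Schwarz:
  fixes A :: "real ^ 'd ^ 'd"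
  assumes sym: "\<And>x y. (A *v x) \<bullet> y = x \<bullet> (A *v y)" and pos: "\<And>x. 0 \<le> x \<bullet> (A *v x)"
  shows "(x \<bullet> (A *v y))\<^sup>2 \<le> (x \<bullet> (A *v x)) * (y \<bullet> (A *v y))"
proof -
  let ?b = "x \<bullet> (A *v y)" and ?a = "x \<bullet> (A *v x)" and ?c = "y \<bullet> (A *v y)"
  have *: "0 \<le> s\<^sup>2 * ?a + 2 * s * t * ?b + t\<^sup>2 * ?c" for s t
  proof -
    have "y \<bullet> (A *v x) = ?b" by (metis inner_commute sym)
    then have "(s *\<^sub>R x + t *\<^sub>R y) \<bullet> (A *v (s *\<^sub>R x + t *\<^sub>R y)) = s\<^sup>2 * ?a + 2 * s * t * ?b + t\<^sup>2 * ?c"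
      by (simp add: matrix_vector_right_distrib matrix_vector_mult_scaleR inner_add_left inner_add_right
          power2_eq_square algebra_simps)
    then show ?thesis by (metis pos)
  qed
  show ?thesis
  proof (cases "?c = 0")
    case True
    have "?b = 0"
    proof (rule ccontr)
      assume b: "?b \<noteq> 0"
      have "0 \<le> ?a + 2 * (- (?a + 1) / (2 * ?b)) * ?b"
        using *[of 1 "- (?a + 1) / (2 * ?b)"] True by simp
      then show False using b by (simp add: field_simps)
    qed
    then show ?thesis using True by simp
  next
    case False
    then have c: "?c > 0" using pos[of y] by linarith
    have "0 \<le> ?c * (?c * ?a - ?b\<^sup>2)"
      using *[of "?c" "- ?b"] by (simp add: power2_eq_square algebra_simps)
    then have "0 \<le> ?c * ?a - ?b\<^sup>2" using c by (simp add: zero_le_mult_iff)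
    then show ?thesis by (simp add: mult.commute)
  qed
qed

section \<open>Chebyshev comparison under a spectral enclosure\<close>

context pcg_problem
begin

context
  fixes a b :: real
  assumes a: "0 < a" and ab: "a < b"
    and lower: "\<And>x. a * (x \<bullet> (P *v x)) \<le> x \<bullet> (H *v x)"
    and upper: "\<And>x. x \<bullet> (H *v x) \<le> b * (x \<bullet> (P *v x))"
begin

lemma H_semi: "0 \<le> x \<bullet> (H *v x)" and P_semi: "0 \<le> x \<bullet> (P *v x)"
  using H_pos[of x] P_pos[of x] by (cases "x = 0"; auto)+

text \<open>The enclosure of H between a P and b P passes to the inner product of H by
  Cauchy-Schwarz alone: for s = G x one has P s = H x, so \<open>ip x (G x)\<close> is the P-form of
  s and \<open>ip x x\<close> is the mixed P-form of x and s.\<close>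

lemma G_bounds: "a * ip x x \<le> ip x (G x)" "ip x (G x) \<le> b * ip x x"
proof -
  define s where "s = G x"
  have Ps: "P *v s = H *v x" by (simp add: s_def G_def Q_inverse)
  let ?S = "s \<bullet> (P *v s)"
  have S: "ip x (G x) = ?S"
    by (metis Ps ip_commute ip_def s_def)
  have "?S\<^sup>2 = (s \<bullet> (H *v x))\<^sup>2" by (simp add: Ps)
  also have "\<dots> \<le> (s \<bullet> (H *v s)) * (x \<bullet> (H *v x))"
    by (rule semi_Cauchy_Schwarz[OF H_sym H_semi])
  also have "\<dots> \<le> (b * ?S) * ip x x"
    unfolding ip_def by (intro mult_right_mono upper H_semi)
  finally have 1: "?S * ?S \<le> ?S * (b * ip x x)" by (simp add: power2_eq_square algebra_simps)
  have "0 \<le> b * ip x x" using a ab ip_nonneg by simp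
  then show "ip x (G x) \<le> b * ip x x"
    using 1 P_semi[of s] unfolding S by (cases "?S = 0") auto
  let ?X = "ip x x"
  have "?X\<^sup>2 = (x \<bullet> (P *v s))\<^sup>2" by (simp add: Ps ip_def)
  also have "\<dots> \<le> (x \<bullet> (P *v x)) * ?S" by (rule semi_Cauchy_Schwarz[OF P_sym P_semi])
  finally have "a * ?X\<^sup>2 \<le> (a * (x \<bullet> (P *v x))) * ?S" using a by simp
  also have "\<dots> \<le> ?X * ?S" unfolding ip_def by (intro mult_right_mono lower P_semi)
  finally have "?X * (a * ?X) \<le> ?X * ?S" by (simp add: power2_eq_square algebra_simps)
  then show "a * ip x x \<le> ip x (G x)"
    using ip_nonneg[of x] P_semi[of s] unfolding S by (cases "?X = 0") auto
qed

text \<open>The affine map behind \<open>B\<close> sends the spectral interval [a, b] of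
  \<open>G\<close> onto [-1, 1], reversing orientation, and \<theta> > 1 is the image of 0. Dividing
  a Chebyshev polynomial by its value at \<theta> normalizes it to 1 at the point 0.\<close>

definition "\<theta> = (b + a) / (b - a)"

definition "B x = \<theta> *\<^sub>R x - (2 / (b - a)) *\<^sub>R G x"

lemma B_linear: "B (x + y) = B x + B y" "B (x - y) = B x - B y" "B (c *\<^sub>R x) = c *\<^sub>R B x"
  by (simp_all add: B_def G_add G_diff G_scale algebra_simps)

lemma ip_B: "ip (B x) y = ip x (B y)"
  by (simp add: B_def ip_linear ip_G)

lemma B_bounds: "ip x (B x) \<le> ip x x" "- ip x x \<le> ip x (B x)"
proof -
  have *: "(b - a) * ip x (B x) = (b + a) * ip x x - 2 * ip x (G x)"
  proof -
    have "b - a \<noteq> 0" using ab by simp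
    then have "(b - a) * (y / (b - a)) = y" for y by (metis nonzero_mult_div_cancel_left times_divide_eq_right)
    then have "(b - a) * \<theta> = b + a" "(b - a) * (2 / (b - a)) = 2" unfolding \<theta>_def by blast+
    moreover have "(b - a) * ip x (B x) = ((b - a) * \<theta>) * ip x x - ((b - a) * (2 / (b - a))) * ip x (G x)"
      by (simp only: B_def ip_linear) (simp add: algebra_simps)
    ultimately show ?thesis by simp
  qed
  have "(b - a) * ip x (B x) \<le> (b - a) * ip x x"
    unfolding * using G_bounds(1)[of x] by (simp add: algebra_simps)
  then show "ip x (B x) \<le> ip x x" using ab by simp
  have "(b - a) * (- ip x x) \<le> (b - a) * ip x (B x)"
    unfolding * using G_bounds(2)[of x] by (simp add: algebra_simps)
  then show "- ip x x \<le> ip x (B x)" using ab mult_le_cancel_left_pos[of "b - a" "- ip x x"] by simp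
qed

text \<open>(1 - B)(1 + B)(1 - B) + (1 + B)(1 - B)(1 + B) = 2 (1 - B^2), and both summands are
  nonnegative by \<open>B_bounds\<close>, applied at \<open>x - B x\<close> and
  \<open>x + B x\<close>.\<close>

lemma B_contract: "ip (B x) (B x) \<le> ip x x"
proof -
  let ?m = "x - B x" and ?p = "x + B x"
  have "0 \<le> (ip ?m ?m + ip ?m (B ?m)) + (ip ?p ?p - ip ?p (B ?p))"
    using B_bounds(2)[of ?m] B_bounds(1)[of ?p] by linarith
  also have "\<dots> = 2 * (ip x x - ip (B x) (B x))"
    by (simp add: B_linear ip_linear ip_B ip_commute[of "B x" x])
  finally show ?thesis by simp
qed

text \<open>With \<open>T\<close> and \<open>U\<close> the Chebyshev polynomials of the first and second kind, the \<open>t\<close>-th pair is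
  \<open>(T\<^sub>t(B) x, U\<^sub>t\<^sub>-\<^sub>1(B) x)\<close>; the quantity conserved below is the identity
  \<open>T\<^sub>t\<^sup>2 + (1 - B\<^sup>2) U\<^sub>t\<^sub>-\<^sub>1\<^sup>2 = 1\<close>.\<close>

primrec cheb :: "real ^ 'd \<Rightarrow> nat \<Rightarrow> (real ^ 'd) \<times> (real ^ 'd)" where
  "cheb x 0 = (x, 0)"
| "cheb x (Suc t) = (let (y, z) = cheb x t in (B (B z + y) - z, B z + y))"

text \<open>The same recurrence with \<open>B\<close> replaced by its value \<theta> at 0, that is,
  T_t(\<theta>) and U_{t-1}(\<theta>).\<close>

primrec cheb_scalar :: "nat \<Rightarrow> real \<times> real" where
  "cheb_scalar 0 = (1, 0)"
| "cheb_scalar (Suc t) = (let (y, z) = cheb_scalar t in (\<theta> * (\<theta> * z + y) - z, \<theta> * z + y))"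

lemma cheb_conserved:
  "ip (fst (cheb x t)) (fst (cheb x t)) + ip (snd (cheb x t)) (snd (cheb x t))
     - ip (B (snd (cheb x t))) (B (snd (cheb x t))) = ip x x"
proof (induction t)
  case 0
  have "B 0 = 0" using B_linear(3)[of 0 0] by simp
  then show ?case by (simp add: ip_def)
next
  case (Suc t)
  obtain y z where yz: "cheb x t = (y, z)" by (cases "cheb x t")
  let ?p = "B z + y"
  have "ip (B ?p - z) (B ?p - z) + ip ?p ?p - ip (B ?p) (B ?p) = ip z z + ip ?p ?p - 2 * ip ?p (B z)"
    by (simp only: ip_linear ip_commute[of z "B ?p"] ip_B[of ?p z]) simp
  also have "\<dots> = ip y y + ip z z - ip (B z) (B z)"
    by (simp add: ip_linear ip_commute[of y "B z"])
  finally show ?case using Suc yz by simp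
qed

lemma cheb_le: "ip (fst (cheb x t)) (fst (cheb x t)) \<le> ip x x"
  using cheb_conserved[of x t] B_contract[of "snd (cheb x t)"] by linarith

lemma cheb_scalar_eq:
  assumes c: "c \<noteq> 0" "\<theta> = (c + 1 / c) / 2"
  shows "fst (cheb_scalar t) = (c ^ t + 1 / c ^ t) / 2"
    "(c - 1 / c) * snd (cheb_scalar t) = c ^ t - 1 / c ^ t"
proof (induction t)
  case (Suc t)
  obtain y z where yz: "cheb_scalar t = (y, z)" by (cases "cheb_scalar t")
  from Suc yz have y: "y = (c ^ t + 1 / c ^ t) / 2" and z: "(c - 1 / c) * z = c ^ t - 1 / c ^ t" by auto
  {
    case 1
    have "fst (cheb_scalar (Suc t)) = \<theta> * y + (\<theta>\<^sup>2 - 1) * z"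
      using yz by (simp add: algebra_simps power2_eq_square)
    also have "\<theta>\<^sup>2 - 1 = (c - 1 / c) / 4 * (c - 1 / c)"
      using c(1) unfolding c(2) by (simp add: field_simps power2_eq_square)
    also have "(c - 1 / c) / 4 * (c - 1 / c) * z = (c - 1 / c) / 4 * (c ^ t - 1 / c ^ t)"
      using z by simp
    also have "\<theta> * y + (c - 1 / c) / 4 * (c ^ t - 1 / c ^ t) = (c ^ Suc t + 1 / c ^ Suc t) / 2"
      using c(1) unfolding c(2) y by (simp add: field_simps)
    finally show ?case .
  next
    case 2
    have "(c - 1 / c) * snd (cheb_scalar (Suc t)) = \<theta> * ((c - 1 / c) * z) + (c - 1 / c) * y"
      using yz by (simp add: algebra_simps)
    also have "\<dots> = c ^ Suc t - 1 / c ^ Suc t"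
      using c(1) unfolding c(2) y z by (simp add: field_simps)
    finally show ?case .
  }
qed auto

lemma B_K:
  assumes "\<And>i. i < t \<Longrightarrow> r i \<noteq> 0" "x \<in> K t" shows "B x \<in> K (Suc t)"
proof -
  have "G x \<in> K (Suc t)" using invariant[OF assms(1)] assms(2) by blast
  then show ?thesis unfolding B_def using K_mono[OF assms(2), of "Suc t"] by (intro K_linear) auto
qed

text \<open>The exact solution x need not lie in the Krylov space, but G x = \<open>u 0\<close>
  does. Subtracting the scalar value removes the constant term of the polynomial in
  \<open>G\<close>, so what remains is a polynomial in \<open>G\<close> applied to
  \<open>u 0\<close>. The second component has degree one less, hence the index t - 1.\<close>

lemma cheb_K:
  assumes "\<And>i. i < t \<Longrightarrow> r i \<noteq> 0" "H *v x = g"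
  shows "fst (cheb x t) - fst (cheb_scalar t) *\<^sub>R x \<in> K t"
    "snd (cheb x t) - snd (cheb_scalar t) *\<^sub>R x \<in> K (t - 1)"
  using assms
proof (induction t)
  case 0
  { case 1 show ?case by (simp add: K_linear) next case 2 show ?case by (simp add: K_linear) }
next
  case (Suc t)
  obtain y z where yz: "cheb x t = (y, z)" by (cases "cheb x t")
  obtain \<tau> \<sigma> where ts: "cheb_scalar t = (\<tau>, \<sigma>)" by (cases "cheb_scalar t")
  have nz: "\<And>i. i < t \<Longrightarrow> r i \<noteq> 0" "\<And>i. i < t - 1 \<Longrightarrow> r i \<noteq> 0" if "\<And>i. i < Suc t \<Longrightarrow> r i \<noteq> 0"
    using that by auto
  have Gx: "G x = u 0" if "H *v x = g" using that by (simp add: G_def s_eq)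
  have Bx: "B x - \<theta> *\<^sub>R x = - (2 / (b - a)) *\<^sub>R u 0" if "H *v x = g" by (simp add: B_def Gx that)
  have z': "(B z + y) - (\<theta> * \<sigma> + \<tau>) *\<^sub>R x \<in> K t"
    if A: "\<And>i. i < Suc t \<Longrightarrow> r i \<noteq> 0" "H *v x = g"
  proof -
    have y: "y - \<tau> *\<^sub>R x \<in> K t" and z: "z - \<sigma> *\<^sub>R x \<in> K (t - 1)"
      using Suc(1)[OF nz(1)] Suc(2)[OF nz(1)] A yz ts by auto
    show ?thesis
    proof (cases "t = 0")
      case True
      then show ?thesis using yz ts B_linear(3)[of 0 0] by (auto simp: K_linear)
    next
      case False
      have "B (z - \<sigma> *\<^sub>R x) \<in> K t" using B_K[OF nz(2)[OF A(1)] z] False by simp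
      moreover have "\<sigma> *\<^sub>R (- (2 / (b - a)) *\<^sub>R u 0) \<in> K t" using False K_u[of 0 t] by (intro K_linear) auto
      ultimately have "B (z - \<sigma> *\<^sub>R x) + \<sigma> *\<^sub>R (B x - \<theta> *\<^sub>R x) + (y - \<tau> *\<^sub>R x) \<in> K t"
        unfolding Bx[OF A(2)] using y K_linear(1) by blast
      then show ?thesis by (simp add: B_linear algebra_simps)
    qed
  qed
  {
    case 2
    show ?case using z'[OF 2] yz ts by simp
  next
    case 1
    have z: "z - \<sigma> *\<^sub>R x \<in> K (Suc t)"
      using K_mono[of "z - \<sigma> *\<^sub>R x" "t - 1" "Suc t"] Suc(2)[OF nz(1)] 1 yz ts by auto
    have "B ((B z + y) - (\<theta> * \<sigma> + \<tau>) *\<^sub>R x) \<in> K (Suc t)" using B_K[OF nz(1)[OF 1(1)] z'[OF 1]] .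
    moreover have "(\<theta> * \<sigma> + \<tau>) *\<^sub>R (- (2 / (b - a)) *\<^sub>R u 0) \<in> K (Suc t)"
      using K_u[of 0 "Suc t"] by (intro K_linear) auto
    ultimately have "B ((B z + y) - (\<theta> * \<sigma> + \<tau>) *\<^sub>R x) + (\<theta> * \<sigma> + \<tau>) *\<^sub>R (B x - \<theta> *\<^sub>R x) - (z - \<sigma> *\<^sub>R x) \<in> K (Suc t)"
      unfolding Bx[OF 1(2)] using z K_linear(1,2) by blast
    then show ?case using yz ts by (simp add: B_linear algebra_simps)
  }
qed

text \<open>Energy optimality is applied to the competitor whose error is the normalized Chebyshev
  polynomial in \<open>B\<close> applied to the solution. Passing between the energy norm and
  Euclidean residuals costs the factor sqrt (L / lam).\<close>

lemma residual_bound: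
  assumes nz: "\<And>i. i < t \<Longrightarrow> r i \<noteq> 0" and lam: "0 < lam"
    and H_lam: "\<And>x. lam * (norm x)\<^sup>2 \<le> x \<bullet> (H *v x)"
    and H_L: "\<And>x. x \<bullet> (H *v x) \<le> L * (norm x)\<^sup>2"
  shows "norm (r t) \<le> 2 * sqrt (L / lam) * exp (- real t / sqrt (b / a)) * norm g"
proof -
  define x where "x = matrix_inv H *v g"
  have x: "H *v x = g" by (simp add: x_def H_inverse)
  define q where "q = sqrt (b / a)"
  have q1: "q > 1" unfolding q_def using a ab by simp
  have qq: "q * q = b / a" unfolding q_def using a ab by simp
  \<comment> \<open>This solves \<theta> = (c + 1/c) / 2 for q^2 = b / a; then 1/c = 1 - 2 / (q + 1)
    is at most exp (-1/q).\<close>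
  define c where "c = (q + 1) / (q - 1)"
  have c1: "c > 1" unfolding c_def using q1 by simp
  have "(c + 1 / c) / 2 = (q * q + 1) / (q * q - 1)"
  proof -
    have "c + 1 / c = ((q + 1) * (q + 1) + (q - 1) * (q - 1)) / ((q - 1) * (q + 1))"
      unfolding c_def using q1 by (simp add: add_frac_eq)
    moreover have "(q - 1) * (q + 1) = q * q - 1" "(q + 1) * (q + 1) + (q - 1) * (q - 1) = 2 * (q * q + 1)"
      by (simp_all add: algebra_simps)
    ultimately have "c + 1 / c = 2 * (q * q + 1) / (q * q - 1)" by simp
    then show ?thesis by (metis divide_divide_eq_left mult.commute nonzero_mult_div_cancel_left times_divide_eq_right zero_neq_numeral)
  qed
  also have "\<dots> = \<theta>" unfolding qq \<theta>_def using a ab by (simp add: field_simps)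
  finally have \<theta>: "\<theta> = (c + 1 / c) / 2" by simp
  have inv_c: "1 / c \<le> exp (- 1 / q)"
  proof -
    have "1 / c = 1 + - (2 / (q + 1))" unfolding c_def using q1 by (simp add: field_simps)
    also have "\<dots> \<le> exp (- (2 / (q + 1)))" by (rule exp_ge_add_one_self)
    also have "\<dots> \<le> exp (- 1 / q)" using q1 by (simp add: field_simps)
    finally show ?thesis .
  qed
  define \<tau> where "\<tau> = fst (cheb_scalar t)"
  have \<tau>: "c ^ t / 2 \<le> \<tau>" unfolding \<tau>_def using cheb_scalar_eq(1)[OF _ \<theta>] c1 by simp
  then have \<tau>0: "\<tau> > 0" using c1 by (smt (verit) divide_pos_pos zero_less_power)
  have "1 / \<tau> \<le> 2 / c ^ t" using \<tau> \<tau>0 c1 by (simp add: field_simps)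
  also have "\<dots> = 2 * (1 / c) ^ t" by (simp add: power_divide)
  also have "\<dots> \<le> 2 * exp (- 1 / q) ^ t" using c1 inv_c by (simp add: power_mono)
  also have "exp (- 1 / q) ^ t = exp (- real t / q)" by (simp add: exp_of_nat_mult[symmetric])
  finally have \<tau>_le: "1 / \<tau> \<le> 2 * exp (- real t / q)" .
  define k where "k = x - (1 / \<tau>) *\<^sub>R fst (cheb x t)"
  have "k = (- (1 / \<tau>)) *\<^sub>R (fst (cheb x t) - \<tau> *\<^sub>R x)"
    using \<tau>0 by (simp add: k_def scaleR_diff_right)
  then have k: "k \<in> K t" using cheb_K(1)[OF nz x] K_linear(3) unfolding \<tau>_def by metis
  let ?e = "x - v t"
  have "ip ?e ?e \<le> ip (x - k) (x - k)" by (rule optimality[OF nz x k])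
  also have "\<dots> = (1 / \<tau>)\<^sup>2 * ip (fst (cheb x t)) (fst (cheb x t))"
    by (simp add: k_def ip_linear power2_eq_square)
  also have "\<dots> \<le> (1 / \<tau>)\<^sup>2 * ip x x" by (intro mult_left_mono cheb_le) simp
  also have "\<dots> \<le> (1 / \<tau>)\<^sup>2 * ((norm g)\<^sup>2 / lam)"
  proof (intro mult_left_mono)
    have "lam * (norm x)\<^sup>2 \<le> norm x * norm g"
      using H_lam[of x] norm_cauchy_schwarz[of x g] x by simp
    then have "lam * norm x \<le> norm g"
      by (cases "norm x = 0") (auto simp: power2_eq_square)
    then have "norm x \<le> norm g / lam" using lam by (simp add: field_simps)
    then have "norm x * norm g \<le> norm g / lam * norm g" by (intro mult_right_mono) auto
    then show "ip x x \<le> (norm g)\<^sup>2 / lam"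
      using norm_cauchy_schwarz[of x g] by (simp add: ip_def x power2_eq_square)
  qed simp
  finally have e: "ip ?e ?e \<le> (1 / \<tau>)\<^sup>2 * ((norm g)\<^sup>2 / lam)" .
  have rt: "r t = H *v ?e" by (simp add: r_eq x matrix_vector_mult_diff_distrib)
  let ?R = "(norm (r t))\<^sup>2"
  have L0: "L \<ge> 0"
  proof -
    have "lam * (norm (axis undefined (1::real) :: real ^ 'd))\<^sup>2 \<le> L * (norm (axis undefined (1::real) :: real ^ 'd))\<^sup>2"
      using H_lam H_L by (rule order_trans)
    then show ?thesis using lam by simp
  qed
  \<comment> \<open>Cauchy-Schwarz in the form of H, tested with the residual itself, bounds the
    squared norm of H e by L times the energy of e without a square root of H.\<close>
  have "?R\<^sup>2 = (r t \<bullet> (H *v ?e))\<^sup>2" by (simp add: rt power2_norm_eq_inner)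
  also have "\<dots> \<le> (r t \<bullet> (H *v r t)) * ip ?e ?e"
    unfolding ip_def by (rule semi_Cauchy_Schwarz[OF H_sym H_semi])
  also have "\<dots> \<le> (L * ?R) * ip ?e ?e" by (intro mult_right_mono H_L ip_nonneg)
  finally have "?R * ?R \<le> ?R * (L * ip ?e ?e)" by (simp add: power2_eq_square algebra_simps)
  then have "?R \<le> L * ip ?e ?e" using L0 ip_nonneg[of ?e] mult_le_cancel_left_pos[of ?R ?R] by (cases "?R = 0") force+
  also have "\<dots> \<le> L * ((1 / \<tau>)\<^sup>2 * ((norm g)\<^sup>2 / lam))" using e L0 by (intro mult_left_mono)
  also have "\<dots> = (sqrt (L / lam) * (1 / \<tau>) * norm g)\<^sup>2"
    using L0 lam by (simp add: power_mult_distrib power_divide)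
  finally have *: "?R \<le> (sqrt (L / lam) * (1 / \<tau>) * norm g)\<^sup>2" .
  have S0: "0 \<le> sqrt (L / lam)" using L0 lam by simp
  have "norm (r t) \<le> sqrt (L / lam) * (1 / \<tau>) * norm g"
    by (rule power2_le_imp_le[OF *]) (use S0 \<tau>0 in simp)
  also have "\<dots> \<le> sqrt (L / lam) * (2 * exp (- real t / q)) * norm g"
    by (rule mult_right_mono[OF mult_left_mono[OF \<tau>_le S0] norm_ge_zero])
  finally show ?thesis by (simp add: q_def algebra_simps)
qed

end

text \<open>The logarithm measures the reduction from the factor 2 sqrt (L / lam) of the residual
  bound to the tolerance factor \<gamma> sqrt (lam / L). A zero residual before step t is treated
  apart: the method has then stopped already, whereas the continued recursion divides by
  zero.\<close>

theorem pcg_iterations_le: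
  assumes "0 < a" "a < b" and lam: "0 < lam" and \<gamma>: "0 < \<gamma>" and L: "0 < L"
    and "\<And>x. a * (x \<bullet> (P *v x)) \<le> x \<bullet> (H *v x)"
    and "\<And>x. x \<bullet> (H *v x) \<le> b * (x \<bullet> (P *v x))"
    and "\<And>x. lam * (norm x)\<^sup>2 \<le> x \<bullet> (H *v x)"
    and "\<And>x. x \<bullet> (H *v x) \<le> L * (norm x)\<^sup>2"
    and t: "t \<ge> 1" "sqrt (b / a) * ln (2 * L / (\<gamma> * lam)) \<le> real t"
  shows "pcg_iterations H P g (\<gamma> * sqrt (lam / L) * norm g) \<le> enat t"
proof (cases "g = 0")
  case False
  let ?\<epsilon> = "\<gamma> * sqrt (lam / L) * norm g"
  have le: "pcg_iterations H P g ?\<epsilon> \<le> enat i" if "norm (r i) \<le> ?\<epsilon>" "i \<ge> 1" for i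
  proof -
    from that(2) obtain j where j: "i = Suc j" by (cases i) auto
    then have "j \<in> {t. norm (pcg_residual H P g (Suc t)) \<le> ?\<epsilon>}"
      using that(1) unfolding r_def pcg_residual_def by blast
    then have "(INF t \<in> {t. norm (pcg_residual H P g (Suc t)) \<le> ?\<epsilon>}. enat (Suc t)) \<le> enat (Suc j)"
      by (rule INF_lower)
    then show ?thesis using False j unfolding pcg_iterations_def by simp
  qed
  show ?thesis
  proof (cases "\<exists>i<t. r i = 0")
    case True
    then obtain i where i: "i < t" "r i = 0" by blast
    then have "i \<ge> 1" using False by (cases i) auto
    then have "pcg_iterations H P g ?\<epsilon> \<le> enat i" using le[of i] i \<gamma> lam L by simp
    then show ?thesis using i by (meson enat_ord_simps(1) less_imp_le order_trans)
  next
    case nz: False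
    have "sqrt (b / a) > 0" using assms(1,2) by simp
    then have "ln (2 * L / (\<gamma> * lam)) \<le> real t / sqrt (b / a)" using t(2) by (simp add: field_simps)
    then have "exp (- real t / sqrt (b / a)) \<le> exp (- ln (2 * L / (\<gamma> * lam)))" by simp
    also have "\<dots> = \<gamma> * lam / (2 * L)" using L lam \<gamma> by (simp add: exp_minus)
    finally have e: "exp (- real t / sqrt (b / a)) \<le> \<gamma> * lam / (2 * L)" .
    have "norm (r t) \<le> 2 * sqrt (L / lam) * exp (- real t / sqrt (b / a)) * norm g"
      by (rule residual_bound[where lam = lam]) (use assms nz in auto)
    also have "\<dots> \<le> 2 * sqrt (L / lam) * (\<gamma> * lam / (2 * L)) * norm g"
      using e lam L by (intro mult_right_mono mult_left_mono) auto
    also have "2 * sqrt (L / lam) * (\<gamma> * lam / (2 * L)) = \<gamma> * (sqrt (L / lam) * (lam / L))" by simp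
    also have "sqrt (L / lam) * (lam / L) = sqrt (lam / L)"
      using lam L by (simp add: real_sqrt_divide field_simps)
    finally show ?thesis using le[of t] t(1) by simp
  qed
qed (simp add: pcg_iterations_def)

lemma pcg_output_residual:
  assumes "pcg_iterations H P g \<epsilon> \<noteq> \<infinity>" "0 \<le> \<epsilon>"
  shows "norm (g - H *v pcg_output H P g \<epsilon>) \<le> \<epsilon>"
proof (cases "g = 0")
  case True
  then have "pcg_output H P g \<epsilon> = 0"
    by (simp add: pcg_output_def pcg_iterations_def pcg_solution_def zero_enat_def)
  then show ?thesis using True assms(2) by simp
next
  case False
  define A where "A = {t. norm (r (Suc t)) \<le> \<epsilon>}"
  have *: "pcg_iterations H P g \<epsilon> = (INF t \<in> A. enat (Suc t))"
    unfolding A_def r_def pcg_iterations_def pcg_residual_def if_not_P[OF False] ..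
  have "A \<noteq> {}"
  proof
    assume "A = {}"
    then have "(INF t \<in> A. enat (Suc t)) = \<infinity>" by (simp add: Inf_enat_def)
    then show False using assms(1) * by simp
  qed
  then obtain i where i: "i \<in> A" "(INF t \<in> A. enat (Suc t)) = enat (Suc i)"
    by (rule enat_INF_attained)
  have "pcg_output H P g \<epsilon> = v (Suc i)"
    unfolding pcg_output_def pcg_solution_def v_def * i(2) the_enat.simps ..
  moreover have "norm (r (Suc i)) \<le> \<epsilon>" using i(1) by (simp add: A_def)
  ultimately show ?thesis using r_eq[of "Suc i"] by simp
qed

end


section \<open>One outer step and the total count of rounds\<close>

locale self_concordant_problem =
  fixes f :: "real ^ 'd \<Rightarrow> real" and lam L :: real
  assumes sc: "standard_self_concordant f"
    and hess_sym: "\<And>w x y. x \<bullet> (hess f w *v y) = y \<bullet> (hess f w *v x)"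
    and lam_pos: "0 < lam"
    and hess_ge: "\<And>w u. lam * (norm u)\<^sup>2 \<le> u \<bullet> (hess f w *v u)"
    and hess_le: "\<And>w u. u \<bullet> (hess f w *v u) \<le> L * (norm u)\<^sup>2"
begin

lemma hess_pos: "u \<noteq> 0 \<Longrightarrow> 0 < u \<bullet> (hess f w *v u)"
  using hess_ge[of u w] lam_pos by (smt (verit) zero_less_norm_iff mult_pos_pos zero_less_power)

lemma hess_nonneg: "0 \<le> u \<bullet> (hess f w *v u)"
  using hess_pos[of u w] by (cases "u = 0") auto

lemma hess_sym': "(hess f w *v x) \<bullet> y = x \<bullet> (hess f w *v y)"
  by (metis hess_sym inner_commute)

lemma lam_le_L: "lam \<le> L"
  using order_trans[OF hess_ge hess_le, of "axis undefined 1"] by simp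

definition newton :: "real ^ 'd \<Rightarrow> real ^ 'd" where
  "newton w = matrix_inv (hess f w) *v grad f w"

definition decrement :: "real ^ 'd \<Rightarrow> real" where
  "decrement w = sqrt (newton w \<bullet> (hess f w *v newton w))"

lemma hess_newton: "hess f w *v newton w = grad f w"
  unfolding newton_def by (rule matrix_inv_vector(1)[OF posdef_invertible[OF hess_pos]])

lemma decrement_nonneg: "0 \<le> decrement w"
  by (simp add: decrement_def hess_nonneg)

lemma hess_Cauchy_Schwarz:
  "\<bar>x \<bullet> (hess f w *v y)\<bar> \<le> sqrt (x \<bullet> (hess f w *v x)) * sqrt (y \<bullet> (hess f w *v y))"
proof -
  have "sqrt ((x \<bullet> (hess f w *v y))\<^sup>2) \<le> sqrt ((x \<bullet> (hess f w *v x)) * (y \<bullet> (hess f w *v y)))"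
    using semi_Cauchy_Schwarz[of "hess f w", OF hess_sym' hess_nonneg] by (simp del: real_sqrt_abs)
  then show ?thesis by (simp add: real_sqrt_mult)
qed

text \<open>Minimizing the self-concordant lower bound over the local length s of the displacement
  produces the conjugate of \<open>omega\<close> at the decrement; this optimization is a single use
  of ln x <= x - 1.\<close>

lemma gap_le:
  assumes "decrement w \<le> 1 / 6"
  shows "f w - f y \<le> 3 / 2 * omega (decrement w)"
proof -
  let ?h = "y - w" and ?\<eta> = "decrement w"
  define s where "s = sqrt (?h \<bullet> (hess f w *v ?h))"
  have s: "0 \<le> s" by (simp add: s_def hess_nonneg)
  have "f w + grad f w \<bullet> ?h + omega s \<le> f (w + ?h)"
    unfolding s_def by (rule self_concordant_line(2)[OF sc hess_pos])
  moreover have "- (?\<eta> * s) \<le> grad f w \<bullet> ?h"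
    using hess_Cauchy_Schwarz[of "newton w" w ?h]
    by (simp add: hess_newton[symmetric] hess_sym' decrement_def s_def abs_le_iff)
  ultimately have "f w - f y \<le> ?\<eta> * s - s + ln (1 + s)" by (simp add: omega_def)
  also have "\<dots> \<le> - ?\<eta> - ln (1 - ?\<eta>)"
  proof -
    have "ln (1 + s) + ln (1 - ?\<eta>) = ln ((1 + s) * (1 - ?\<eta>))"
      using s assms by (simp add: ln_mult)
    also have "\<dots> \<le> (1 + s) * (1 - ?\<eta>) - 1" using s assms by (intro ln_le_minus_one) simp
    finally show ?thesis by (simp add: algebra_simps)
  qed
  also have "\<dots> \<le> 3 / 2 * omega ?\<eta>" using omega_conjugate_le[OF decrement_nonneg assms] .
  finally show ?thesis .
qed

text \<open>The damped step has local length \<delta> / (1 + \<delta>) < 1, where the upper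
  self-concordance bound is valid. An exact direction would give the decrease omega(\<delta>); the
  relative error 1/20 costs the factors 17/19 and 9/10, whose product exceeds 3/4.\<close>

lemma damped_newton_decrease:
  assumes v: "norm (grad f w - hess f w *v v) \<le> 1 / 20 * sqrt (lam / L) * norm (grad f w)"
    and \<delta>: "\<delta> = sqrt (v \<bullet> (hess f w *v v))"
  shows "f (w - (1 / (1 + \<delta>)) *\<^sub>R v) \<le> f w - 3 / 4 * omega (decrement w)"
proof -
  define H where "H = hess f w"
  define p where "p = newton w"
  define \<eta> where "\<eta> = decrement w"
  define e where "e = p - v"
  have g: "grad f w = H *v p" by (simp add: hess_newton H_def p_def)
  have L: "L > 0" using lam_le_L lam_pos by simp
  have \<eta>: "0 \<le> \<eta>" by (simp add: \<eta>_def decrement_nonneg)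
  have \<eta>2: "\<eta>\<^sup>2 = p \<bullet> (H *v p)" by (simp add: \<eta>_def decrement_def p_def H_def hess_nonneg)
  have \<delta>0: "0 \<le> \<delta>" by (simp add: \<delta> hess_nonneg)
  have \<delta>2: "\<delta>\<^sup>2 = v \<bullet> (H *v v)" by (simp add: \<delta> H_def hess_nonneg)
  have He: "H *v e = grad f w - hess f w *v v" by (simp add: e_def g H_def matrix_vector_mult_diff_distrib)
  \<comment> \<open>The residual is H e. Since |H p|^2 <= L \<eta>^2 and the energy of e is at most
    |H e|^2 / lam, the factor sqrt (lam / L) of the tolerance cancels and leaves the relative error
    1/20 in the local norm.\<close>
  have e_le: "sqrt (e \<bullet> (H *v e)) \<le> \<eta> / 20"
  proof -
    let ?R = "(norm (H *v p))\<^sup>2"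
    have "?R\<^sup>2 = ((H *v p) \<bullet> (H *v p))\<^sup>2" by (simp add: power2_norm_eq_inner)
    also have "\<dots> \<le> ((H *v p) \<bullet> (H *v (H *v p))) * (p \<bullet> (H *v p))"
      unfolding H_def by (rule semi_Cauchy_Schwarz[OF hess_sym' hess_nonneg])
    also have "\<dots> \<le> (L * ?R) * \<eta>\<^sup>2" unfolding \<eta>2[symmetric] unfolding H_def by (intro mult_right_mono hess_le) simp
    finally have "?R * ?R \<le> ?R * (L * \<eta>\<^sup>2)" by (simp add: power2_eq_square algebra_simps)
    then have R: "?R \<le> L * \<eta>\<^sup>2"
      using L mult_le_cancel_left_pos[of ?R ?R "L * \<eta>\<^sup>2"] by (cases "?R = 0") force+
    have "(norm (H *v e))\<^sup>2 \<le> (1 / 20 * sqrt (lam / L) * norm (H *v p))\<^sup>2"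
      unfolding He using v by (intro power_mono) (auto simp: g)
    also have "\<dots> = 1 / 400 * (lam / L) * ?R" using lam_pos L by (simp add: power_mult_distrib power_divide)
    also have "\<dots> \<le> 1 / 400 * (lam / L) * (L * \<eta>\<^sup>2)" using R lam_pos L by (intro mult_left_mono) auto
    finally have He_le: "(norm (H *v e))\<^sup>2 \<le> lam * (\<eta> / 20)\<^sup>2" using L by (simp add: power_divide)
    have "lam * (norm e)\<^sup>2 \<le> norm e * norm (H *v e)"
      using hess_ge[of e w] norm_cauchy_schwarz[of e "H *v e"] by (simp add: H_def)
    then have "lam * norm e \<le> norm (H *v e)"
      using mult_le_cancel_left_pos[of "norm e" "lam * norm e" "norm (H *v e)"]
      by (cases "e = 0") (auto simp: power2_eq_square mult_ac)
    then have "lam * norm e * norm (H *v e) \<le> norm (H *v e) * norm (H *v e)" by (intro mult_right_mono) auto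
    also have "\<dots> \<le> lam * (\<eta> / 20)\<^sup>2" using He_le by (simp add: power2_eq_square)
    finally have "norm e * norm (H *v e) \<le> (\<eta> / 20)\<^sup>2" using lam_pos by (simp add: mult.assoc)
    then have "e \<bullet> (H *v e) \<le> (\<eta> / 20)\<^sup>2" using norm_cauchy_schwarz[of e "H *v e"] by linarith
    then show ?thesis using \<eta> by (intro real_le_lsqrt) auto
  qed
  have \<eta>\<delta>: "19 / 20 * \<eta> \<le> \<delta>"
  proof -
    have "\<eta> * \<eta> = p \<bullet> (H *v v) + p \<bullet> (H *v e)"
      using \<eta>2 by (simp add: e_def matrix_vector_mult_diff_distrib inner_diff_right power2_eq_square)
    also have "\<dots> \<le> \<eta> * \<delta> + \<eta> * sqrt (e \<bullet> (H *v e))"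
      using hess_Cauchy_Schwarz[of p w v] hess_Cauchy_Schwarz[of p w e]
      unfolding \<eta>_def decrement_def p_def[symmetric] \<delta> H_def by linarith
    also have "\<dots> \<le> \<eta> * \<delta> + \<eta> * (\<eta> / 20)" using e_le \<eta> by (intro add_mono mult_left_mono) auto
    finally have "\<eta> * (19 / 20 * \<eta>) \<le> \<eta> * \<delta>" by (simp add: algebra_simps)
    then show ?thesis using \<eta> \<delta>0 mult_le_cancel_left_pos[of \<eta> "19 / 20 * \<eta>" \<delta>] by (cases "\<eta> = 0") auto
  qed
  \<comment> \<open>The error \<eta>/20 is at most \<delta>/19, because \<eta> <= 20/19
    \<delta>.\<close>
  have gv: "\<delta>\<^sup>2 - \<delta>\<^sup>2 / 19 \<le> grad f w \<bullet> v"
  proof -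
    have "grad f w \<bullet> v = v \<bullet> (H *v v) + e \<bullet> (H *v v)"
      by (simp add: g e_def inner_diff_left H_def hess_sym')
    moreover have "- (sqrt (e \<bullet> (H *v e)) * \<delta>) \<le> e \<bullet> (H *v v)"
      using hess_Cauchy_Schwarz[of e w v] by (simp add: \<delta> H_def abs_le_iff)
    moreover have "sqrt (e \<bullet> (H *v e)) * \<delta> \<le> (\<delta> / 19) * \<delta>"
      using e_le \<eta>\<delta> \<delta>0 by (intro mult_right_mono) auto
    ultimately show ?thesis using \<delta>2 by (simp add: power2_eq_square)
  qed
  define h where "h = - ((1 / (1 + \<delta>)) *\<^sub>R v)"
  have s: "sqrt (h \<bullet> (hess f w *v h)) = \<delta> / (1 + \<delta>)"
  proof -
    have "h = (- (1 / (1 + \<delta>))) *\<^sub>R v" by (simp add: h_def)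
    then have "h \<bullet> (hess f w *v h) = (1 / (1 + \<delta>))\<^sup>2 * \<delta>\<^sup>2"
      unfolding \<delta>2 H_def by (simp only: matrix_vector_mult_scaleR inner_scaleR_left inner_scaleR_right)
        (simp add: power2_eq_square)
    also have "\<dots> = (\<delta> / (1 + \<delta>))\<^sup>2" by (simp add: power_divide)
    finally show ?thesis using \<delta>0 by simp
  qed
  have "f (w + h) \<le> f w + grad f w \<bullet> h - \<delta> / (1 + \<delta>) - ln (1 - \<delta> / (1 + \<delta>))"
    using self_concordant_line(1)[where f = f and w = w and h = h, OF sc hess_pos] \<delta>0 by (simp add: s)
  also have "ln (1 - \<delta> / (1 + \<delta>)) = - ln (1 + \<delta>)"
  proof -
    have "1 - \<delta> / (1 + \<delta>) = inverse (1 + \<delta>)" using \<delta>0 by (simp add: field_simps)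
    then show ?thesis using \<delta>0 by (simp add: ln_inverse)
  qed
  also have "grad f w \<bullet> h = - (grad f w \<bullet> v) / (1 + \<delta>)" by (simp add: h_def)
  also have "f w + - (grad f w \<bullet> v) / (1 + \<delta>) - \<delta> / (1 + \<delta>) - - ln (1 + \<delta>)
      \<le> f w + - (\<delta>\<^sup>2 - \<delta>\<^sup>2 / 19) / (1 + \<delta>) - \<delta> / (1 + \<delta>) - - ln (1 + \<delta>)"
    using gv \<delta>0 divide_right_mono[of "- (grad f w \<bullet> v)" "- (\<delta>\<^sup>2 - \<delta>\<^sup>2 / 19)" "1 + \<delta>"] by simp
  also have "\<dots> = f w - omega \<delta> + \<delta>\<^sup>2 / (1 + \<delta>) / 19"
  proof -
    have "- (y - y / 19) / c = y / c / 19 - y / c" for y c :: real by (simp add: diff_divide_distrib)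
    moreover have "\<delta> / (1 + \<delta>) + \<delta>\<^sup>2 / (1 + \<delta>) = \<delta>"
    proof -
      have "\<delta> / (1 + \<delta>) + \<delta>\<^sup>2 / (1 + \<delta>) = \<delta> * (1 + \<delta>) / (1 + \<delta>)"
        by (simp add: add_divide_distrib[symmetric] power2_eq_square distrib_left)
      then show ?thesis using \<delta>0 by simp
    qed
    ultimately show ?thesis unfolding omega_def by (smt (verit))
  qed
  \<comment> \<open>\<open>omega_ge\<close> bounds \<delta>^2 / (1 + \<delta>) by 2 omega(\<delta>),
    whence 17/19 = 1 - 2/19.\<close>
  also have "\<dots> \<le> f w - 17 / 19 * omega \<delta>"
  proof -
    have "w - q + x / 19 \<le> w - 17 / 19 * q" if "x \<le> 2 * q" for x q w :: real using that by linarith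
    then show ?thesis using omega_ge[OF \<delta>0] by blast
  qed
  also have "\<dots> \<le> f w - 17 / 19 * (9 / 10 * omega \<eta>)"
  proof -
    have "omega (19 / 20 * \<eta>) \<le> omega \<delta>" by (rule omega_mono[OF _ \<eta>\<delta>]) (use \<eta> in simp)
    with omega_scale[OF \<eta>] have "9 / 10 * omega \<eta> \<le> omega \<delta>" by (rule order_trans)
    then show ?thesis by simp
  qed
  also have "\<dots> \<le> f w - 3 / 4 * omega \<eta>" using omega_nonneg[OF \<eta>] by simp
  finally show ?thesis by (simp add: h_def \<eta>_def)
qed

end

lemma omega_sixth_pos: "0 < omega (1 / 6)"
  using omega_strict_mono[of 0 "1 / 6"] by simp

text \<open>While the decrement exceeds \<open>1/6\<close> the gap drops by a constant; afterwards it at least halves,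
  and the next decrease certifies that the decrement stays below \<open>1/6\<close>.\<close>

lemma two_phase_count:
  fixes gap \<eta> :: "nat \<Rightarrow> real"
  assumes gap: "\<And>k. 0 \<le> gap k" and \<eta>: "\<And>k. 0 \<le> \<eta> k"
    and decrease: "\<And>k. gap (Suc k) \<le> gap k - 3 / 4 * omega (\<eta> k)"
    and near: "\<And>k. \<eta> k \<le> 1 / 6 \<Longrightarrow> gap k \<le> 3 / 2 * omega (\<eta> k)"
    and \<epsilon>: "0 < \<epsilon>"
  obtains K where "gap K \<le> \<epsilon>"
    "real K \<le> real (nat \<lceil>log 2 (2 * omega (1 / 6) / \<epsilon>)\<rceil>) + 2 * gap 0 / omega (1 / 6)"
proof -
  let ?\<omega> = "omega (1 / 6)"
  have far: "real k * (3 / 4 * ?\<omega>) \<le> gap 0 - gap k" if "\<And>j. j < k \<Longrightarrow> 1 / 6 < \<eta> j" for k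
    using that
  proof (induction k)
    case (Suc k)
    have "?\<omega> \<le> omega (\<eta> k)" using Suc(2)[of k] by (intro omega_mono) auto
    moreover have "real k * (3 / 4 * ?\<omega>) \<le> gap 0 - gap k" using Suc by simp
    ultimately show ?case using decrease[of k] by (simp add: field_simps)
  qed simp
  have count: "real k \<le> 2 * gap 0 / ?\<omega>" if "\<And>j. j < k \<Longrightarrow> 1 / 6 < \<eta> j" for k
  proof -
    have "real k * (3 / 4 * ?\<omega>) \<le> gap 0" using far[of k, OF that] gap[of k] by simp
    moreover have "0 \<le> real k * ?\<omega>" using omega_sixth_pos by simp
    ultimately have "real k * ?\<omega> \<le> 2 * gap 0" by simp
    then show ?thesis using omega_sixth_pos by (simp add: field_simps)
  qed
  have ex: "\<exists>k. \<eta> k \<le> 1 / 6"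
  proof (rule ccontr)
    assume "\<not> ?thesis"
    then have "real k \<le> 2 * gap 0 / ?\<omega>" for k by (intro count) (auto simp: not_le)
    then show False by (metis reals_Archimedean2 not_le)
  qed
  define k1 where "k1 = (LEAST k. \<eta> k \<le> 1 / 6)"
  have k1: "\<eta> k1 \<le> 1 / 6" unfolding k1_def using ex by (rule LeastI_ex)
  have below_k1: "1 / 6 < \<eta> j" if "j < k1" for j
    using not_less_Least[OF that[unfolded k1_def]] by (simp only: not_le)
  have phase2: "\<eta> (k1 + j) \<le> 1 / 6 \<and> gap (k1 + j) \<le> 3 / 2 * ?\<omega> / 2 ^ j" for j
  proof (induction j)
    case 0
    have "omega (\<eta> k1) \<le> ?\<omega>" using k1 \<eta> by (intro omega_mono) auto
    then show ?case using near[OF k1] k1 by simp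
  next
    case (Suc j)
    let ?k = "k1 + j"
    have "gap (Suc ?k) \<le> gap ?k / 2" using decrease[of ?k] near[of ?k] Suc by simp
    then have 1: "gap (Suc ?k) \<le> 3 / 2 * ?\<omega> / 2 ^ Suc j" using Suc by simp
    also have "\<dots> \<le> 3 / 2 * ?\<omega> / 2 ^ 1"
      using omega_sixth_pos by (intro divide_left_mono power_increasing) auto
    finally have "3 / 4 * omega (\<eta> (Suc ?k)) \<le> 3 / 4 * ?\<omega>"
      using decrease[of "Suc ?k"] gap[of "Suc (Suc ?k)"] by simp
    then have "\<eta> (Suc ?k) \<le> 1 / 6" using omega_strict_mono[of "1 / 6" "\<eta> (Suc ?k)"] by force
    then show ?case using 1 by simp
  qed
  let ?l = "log 2 (2 * ?\<omega> / \<epsilon>)"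
  define K2 where "K2 = nat \<lceil>?l\<rceil>"
  have "2 * ?\<omega> / \<epsilon> = 2 powr ?l" using omega_sixth_pos \<epsilon> by simp
  also have "\<dots> \<le> 2 powr real K2" by (intro powr_mono) (auto simp: K2_def real_nat_ceiling_ge)
  also have "\<dots> = 2 ^ K2" by (simp add: powr_realpow)
  finally have "2 * ?\<omega> \<le> \<epsilon> * 2 ^ K2" using \<epsilon> by (simp add: field_simps)
  then have "3 / 2 * ?\<omega> / 2 ^ K2 \<le> \<epsilon>" using omega_sixth_pos by (simp add: field_simps)
  then have "gap (k1 + K2) \<le> \<epsilon>" using phase2[of K2] by linarith
  moreover have "real (k1 + K2) \<le> real K2 + 2 * gap 0 / ?\<omega>" using count[OF below_k1] by simp
  ultimately show ?thesis using that K2_def by blast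
qed

text \<open>The enclosure constants a and b are needed on the initial sublevel set only: termination
  of the inner solve gives the decrease, and the decrease keeps the next iterate in the set. Each
  outer step costs one round for the gradient and at most \<open>?q + 1\<close> inner rounds, hence
  the factor \<open>2 + ?q\<close>.\<close>

lemma disco_rounds_le:
  fixes m :: nat and F :: "nat \<Rightarrow> real ^ 'd \<Rightarrow> real"
  defines "f \<equiv> average_loss m F"
  assumes f: "self_concordant_problem f lam L"
    and min: "\<And>y. f (minimizer f) \<le> f y"
    and P_sym: "\<And>w x y. (disco_preconditioner \<mu> F w *v x) \<bullet> y = x \<bullet> (disco_preconditioner \<mu> F w *v y)"
    and P_pos: "\<And>w x. x \<noteq> 0 \<Longrightarrow> 0 < x \<bullet> (disco_preconditioner \<mu> F w *v x)"
    and ab: "0 < a" "a < b"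
    and lower: "\<And>w x. f w \<le> f (disco_init \<rho> m F) \<Longrightarrow>
        a * (x \<bullet> (disco_preconditioner \<mu> F w *v x)) \<le> x \<bullet> (hess f w *v x)"
    and upper: "\<And>w x. f w \<le> f (disco_init \<rho> m F) \<Longrightarrow>
        x \<bullet> (hess f w *v x) \<le> b * (x \<bullet> (disco_preconditioner \<mu> F w *v x))"
    and \<epsilon>: "0 < \<epsilon>"
  shows "ennreal_of_enat (disco_rounds lam L \<rho> \<mu> m F \<epsilon>) \<le>
    ennreal (1 + (real (nat \<lceil>log 2 (2 * omega (1 / 6) / \<epsilon>)\<rceil>)
        + 2 * (f (disco_init \<rho> m F) - f (minimizer f)) / omega (1 / 6))
      * (2 + sqrt (b / a) * ln (2 * L / (pcg_beta * lam))))"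
proof -
  interpret self_concordant_problem f lam L by (rule f)
  let ?w = "disco_iterate lam L \<rho> \<mu> m F"
  let ?q = "sqrt (b / a) * ln (2 * L / (pcg_beta * lam))"
  define N where "N = nat \<lceil>?q\<rceil>"
  have "1 < 2 * L / (pcg_beta * lam)" using lam_le_L lam_pos by (simp add: pcg_beta_def)
  then have q0: "0 < ?q" using ab by simp
  then have N: "N \<ge> 1" "?q \<le> real N" "real N \<le> ?q + 1"
    by (auto simp: N_def real_nat_ceiling_ge) linarith+
  have its: "disco_pcg_iterations lam L \<mu> m F w \<le> enat N" if w: "f w \<le> f (disco_init \<rho> m F)" for w
  proof -
    interpret pcg_problem "hess f w" "disco_preconditioner \<mu> F w" "grad f w"
      by unfold_locales (auto intro: hess_sym' P_sym hess_pos P_pos)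
    show ?thesis unfolding disco_pcg_iterations_def disco_tolerance_def f_def[symmetric]
      by (rule pcg_iterations_le[of a b])
        (use ab lam_pos lam_le_L lower[OF w] upper[OF w] hess_ge hess_le N in \<open>auto simp: pcg_beta_def\<close>)
  qed
  have step: "f (?w (Suc k)) \<le> f (?w k) - 3 / 4 * omega (decrement (?w k))"
    if w: "f (?w k) \<le> f (disco_init \<rho> m F)" for k
  proof -
    let ?v = "disco_direction lam L \<mu> m F (?w k)"
    interpret P: pcg_problem "hess f (?w k)" "disco_preconditioner \<mu> F (?w k)" "grad f (?w k)"
      by unfold_locales (auto intro: hess_sym' P_sym hess_pos P_pos)
    have "norm (grad f (?w k) - hess f (?w k) *v ?v) \<le> disco_tolerance lam L m F (?w k)"
      unfolding disco_direction_def f_def[symmetric]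
    proof (rule P.pcg_output_residual)
      show "pcg_iterations (hess f (?w k)) (disco_preconditioner \<mu> F (?w k)) (grad f (?w k))
          (disco_tolerance lam L m F (?w k)) \<noteq> \<infinity>"
        using its[OF w] unfolding disco_pcg_iterations_def f_def[symmetric]
        by (metis enat_ord_code(5) infinity_ileE)
      show "0 \<le> disco_tolerance lam L m F (?w k)"
        using lam_pos lam_le_L by (simp add: disco_tolerance_def pcg_beta_def)
    qed
    then have "norm (grad f (?w k) - hess f (?w k) *v ?v) \<le> 1 / 20 * sqrt (lam / L) * norm (grad f (?w k))"
      by (simp add: disco_tolerance_def pcg_beta_def f_def)
    from damped_newton_decrease[OF this refl] show ?thesis by (simp add: f_def Let_def)
  qed
  have mono: "f (?w k) \<le> f (disco_init \<rho> m F)" for k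
  proof (induction k)
    case (Suc k)
    then show ?case using step[OF Suc] omega_nonneg[OF decrement_nonneg, of "?w k"] by simp
  qed simp
  obtain K where K: "f (?w K) - f (minimizer f) \<le> \<epsilon>"
    "real K \<le> real (nat \<lceil>log 2 (2 * omega (1 / 6) / \<epsilon>)\<rceil>) + 2 * (f (?w 0) - f (minimizer f)) / omega (1 / 6)"
  proof (rule two_phase_count[where gap = "\<lambda>k. f (?w k) - f (minimizer f)" and \<eta> = "\<lambda>k. decrement (?w k)"])
    show "f (?w (Suc k)) - f (minimizer f) \<le> f (?w k) - f (minimizer f) - 3 / 4 * omega (decrement (?w k))" for k
      using step[OF mono, of k] by linarith
  qed (use min decrement_nonneg gap_le \<epsilon> in auto)
  have acc: "disco_accurate lam L \<rho> \<mu> m F \<epsilon> K"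
    using K(1) by (simp add: disco_accurate_def f_def)
  define k where "k = (LEAST k. disco_accurate lam L \<rho> \<mu> m F \<epsilon> k)"
  have kK: "k \<le> K" using acc unfolding k_def by (rule Least_le)
  have "disco_rounds lam L \<rho> \<mu> m F \<epsilon> = disco_rounds_until lam L \<rho> \<mu> m F k"
    using acc by (auto simp: disco_rounds_def k_def)
  also have "\<dots> \<le> 1 + (\<Sum>j<k. 1 + enat N)"
    unfolding disco_rounds_until_def by (intro add_left_mono sum_mono its mono)
  also have "(\<Sum>j<k. 1 + enat N) = enat (k * (1 + N))"
    by (simp add: one_enat_def of_nat_eq_enat)
  also have "1 + enat (k * (1 + N)) = enat (1 + k * (1 + N))" by (simp add: one_enat_def)
  finally have "ennreal_of_enat (disco_rounds lam L \<rho> \<mu> m F \<epsilon>) \<le> ennreal_of_enat (enat (1 + k * (1 + N)))"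
    by (subst ennreal_of_enat_le_iff)
  also have "\<dots> = ennreal (real (1 + k * (1 + N)))"
    by (simp only: ennreal_of_enat_enat ennreal_of_nat_eq_real_of_nat)
  also have "\<dots> \<le> ennreal (1 + (real (nat \<lceil>log 2 (2 * omega (1 / 6) / \<epsilon>)\<rceil>)
        + 2 * (f (?w 0) - f (minimizer f)) / omega (1 / 6)) * (2 + ?q))"
  proof (rule ennreal_leI)
    have "real (k * (1 + N)) = real k * (1 + real N)" by (simp add: distrib_left)
    also have "\<dots> \<le> (real (nat \<lceil>log 2 (2 * omega (1 / 6) / \<epsilon>)\<rceil>)
        + 2 * (f (?w 0) - f (minimizer f)) / omega (1 / 6)) * (2 + ?q)"
      using K(2) kK N(3) by (intro mult_mono) auto
    finally show "real (1 + k * (1 + N)) \<le> 1 + (real (nat \<lceil>log 2 (2 * omega (1 / 6) / \<epsilon>)\<rceil>)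
        + 2 * (f (?w 0) - f (minimizer f)) / omega (1 / 6)) * (2 + ?q)" by simp
  qed
  finally show ?thesis by simp
qed


section \<open>Rademacher sums of symmetric matrices\<close>

lemma norm_vec_sq: "(norm (x :: ('a::real_inner) ^ 'n))\<^sup>2 = (\<Sum>i\<in>UNIV. (norm (x $ i))\<^sup>2)"
  by (simp add: power2_norm_eq_inner inner_vec_def)

lemma norm_matrix_vector_le: "norm (A *v x) \<le> norm (A :: real ^ 'n ^ 'm) * norm x"
proof (rule power2_le_imp_le)
  have "(norm (A *v x))\<^sup>2 = (\<Sum>i\<in>UNIV. (A $ i \<bullet> x)\<^sup>2)"
    by (simp add: norm_vec_sq matrix_vector_mul_component)
  also have "\<dots> \<le> (\<Sum>i\<in>UNIV. (norm (A $ i))\<^sup>2 * (norm x)\<^sup>2)"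
    by (intro sum_mono) (metis Cauchy_Schwarz_ineq2 abs_ge_zero power2_abs power_mono power_mult_distrib)
  also have "\<dots> = (norm A * norm x)\<^sup>2"
    by (simp add: norm_vec_sq sum_distrib_right power_mult_distrib)
  finally show "(norm (A *v x))\<^sup>2 \<le> (norm A * norm x)\<^sup>2" .
qed simp

text \<open>On nested vectors the inner product is the trace of A^T B and \<open>norm\<close> is the
  Frobenius norm; for symmetric X the squared norm of \<open>mpow X p\<close> is therefore the trace
  of X^(2p). Left multiplication has the transpose as its adjoint.\<close>

lemma inner_matrix_mult_left:
  fixes A B C :: "real ^ 'n ^ 'n"
  shows "(A ** B) \<bullet> C = B \<bullet> (transpose A ** C)"
proof -
  have "(A ** B) \<bullet> C = (\<Sum>i\<in>UNIV. \<Sum>j\<in>UNIV. \<Sum>k\<in>UNIV. A $ i $ k * B $ k $ j * C $ i $ j)"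
    by (simp add: inner_vec_def matrix_matrix_mult_def sum_distrib_right)
  also have "\<dots> = (\<Sum>k\<in>UNIV. \<Sum>j\<in>UNIV. \<Sum>i\<in>UNIV. A $ i $ k * B $ k $ j * C $ i $ j)"
    by (subst sum.swap, subst (2) sum.swap, subst sum.swap) (rule refl)
  also have "\<dots> = B \<bullet> (transpose A ** C)"
    by (simp add: inner_vec_def matrix_matrix_mult_def transpose_def sum_distrib_left mult_ac)
  finally show ?thesis .
qed

lemma inner_transpose: "transpose A \<bullet> transpose B = A \<bullet> (B :: real ^ 'n ^ 'n)"
  unfolding inner_vec_def transpose_def by (simp, subst sum.swap) (rule refl)

lemma inner_matrix_mult_right:
  fixes A B C :: "real ^ 'n ^ 'n"
  shows "(A ** B) \<bullet> C = A \<bullet> (C ** transpose B)"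
proof -
  have "(A ** B) \<bullet> C = (transpose B ** transpose A) \<bullet> transpose C"
    using inner_transpose[of "A ** B" C] by (simp add: matrix_transpose_mul)
  also have "\<dots> = transpose A \<bullet> transpose (C ** transpose B)"
    by (simp add: inner_matrix_mult_left matrix_transpose_mul)
  finally show ?thesis by (simp only: inner_transpose)
qed

lemma norm_transpose: "norm (transpose A) = norm (A :: real ^ 'n ^ 'n)"
  by (simp add: norm_eq_sqrt_inner inner_transpose)

text \<open>The operator bound c acts on each row of the other factor, so it multiplies the
  Frobenius norm without a factor for the dimension.\<close>

lemma norm_matrix_mult_le:
  fixes A X :: "real ^ 'n ^ 'n"
  assumes "transpose A = A" and A: "\<And>x. norm (A *v x) \<le> c * norm x" and "0 \<le> c"
  shows "norm (X ** A) \<le> c * norm X" "norm (A ** X) \<le> c * norm X"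
proof -
  have *: "norm (Y ** A) \<le> c * norm Y" for Y :: "real ^ 'n ^ 'n"
  proof (rule power2_le_imp_le)
    have "(Y ** A) $ i = A *v (Y $ i)" for i
      by (subst (2) assms(1)[symmetric])
        (simp add: vec_eq_iff matrix_matrix_mult_def matrix_vector_mult_def transpose_def mult.commute)
    then have "(norm (Y ** A))\<^sup>2 \<le> (\<Sum>i\<in>UNIV. (c * norm (Y $ i))\<^sup>2)"
      by (simp add: norm_vec_sq[of "Y ** A"]) (intro sum_mono power_mono A, simp)
    also have "\<dots> = (c * norm Y)\<^sup>2"
      by (simp add: power_mult_distrib norm_vec_sq[of Y] sum_distrib_left)
    finally show "(norm (Y ** A))\<^sup>2 \<le> (c * norm Y)\<^sup>2" .
  qed (use assms in simp)
  then show "norm (X ** A) \<le> c * norm X" by blast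
  have "norm (A ** X) = norm (transpose X ** A)"
    using norm_transpose[of "A ** X"] by (simp add: matrix_transpose_mul assms(1))
  also have "\<dots> \<le> c * norm X" using *[of "transpose X"] by (simp add: norm_transpose)
  finally show "norm (A ** X) \<le> c * norm X" .
qed

section \<open>Matrix powers and trace moments of signed sums\<close>

primrec mpow :: "real ^ 'n ^ 'n \<Rightarrow> nat \<Rightarrow> real ^ 'n ^ 'n" where
  "mpow X 0 = mat 1"
| "mpow X (Suc k) = X ** mpow X k"

lemma mpow_add: "mpow X (i + j) = mpow X i ** mpow X j"
  by (induction i) (simp_all add: matrix_mul_assoc)

lemma transpose_mpow: "transpose X = X \<Longrightarrow> transpose (mpow X k) = mpow X k"
proof (induction k)
  case (Suc k)
  have "mpow X k ** X = X ** mpow X k"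
    using mpow_add[of X k 1] mpow_add[of X 1 k] by (simp add: add.commute)
  then show ?case using Suc by (simp add: matrix_transpose_mul)
qed (simp add: transpose_mat)

text \<open>Noncommutative telescoping: one factor Y at a time is exchanged for X.\<close>

lemma mpow_diff:
  fixes X Y :: "real ^ 'n ^ 'n"
  shows "mpow X (Suc n) - mpow Y (Suc n) = (\<Sum>q\<le>n. mpow X q ** (X - Y) ** mpow Y (n - q))"
proof (induction n)
  case (Suc n)
  have Y: "mpow Y (Suc k) = mpow Y k ** Y" for k using mpow_add[of Y k 1] by simp
  have X: "mpow X (Suc k) = mpow X k ** X" for k using mpow_add[of X k 1] by simp
  have add: "(A + B) ** C = A ** C + B ** C" "(A - B) ** C = A ** C - B ** C"
    "C ** (A - B) = C ** A - C ** B" for A B C :: "real ^ 'n ^ 'n"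
    by (vector matrix_matrix_mult_def sum.distrib sum_subtractf algebra_simps)+
  have "(\<Sum>q\<le>Suc n. mpow X q ** (X - Y) ** mpow Y (Suc n - q))
    = (\<Sum>q\<le>n. mpow X q ** (X - Y) ** mpow Y (n - q)) ** Y + mpow X (Suc n) ** (X - Y)"
  proof -
    have "mpow Y (Suc n - q) = mpow Y (n - q) ** Y" if "q \<le> n" for q
      using Y[of "n - q"] that by (simp only: Suc_diff_le)
    moreover have "(\<Sum>q\<in>S. f q) ** Y = (\<Sum>q\<in>S. f q ** Y)" for f :: "nat \<Rightarrow> real ^ 'n ^ 'n" and S
      by (induction S rule: infinite_finite_induct) (simp_all add: add)
    ultimately show ?thesis by (simp add: matrix_mul_assoc)
  qed
  also have "\<dots> = (mpow X (Suc n) - mpow Y (Suc n)) ** Y + mpow X (Suc n) ** (X - Y)"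
    using Suc by simp
  also have "\<dots> = mpow X (Suc (Suc n)) - mpow Y (Suc (Suc n))"
    unfolding X[of "Suc n"] Y[of "Suc n"] add by simp
  finally show ?case ..
qed simp

text \<open>Only even-indexed terms are available on the right of the convexity inequalities. The
  even subsequence is convex, so pairing k with r - k bounds its mean by that of the endpoints; each
  odd term then lies below the mean of its even neighbours.\<close>

lemma convex_sequence_sum_le:
  fixes s :: "nat \<Rightarrow> real"
  assumes odd: "\<And>k. k < r \<Longrightarrow> s (2 * k + 1) \<le> (s (2 * k) + s (2 * k + 2)) / 2"
    and even: "\<And>k. k + 1 < r \<Longrightarrow> s (2 * k + 2) \<le> (s (2 * k) + s (2 * k + 4)) / 2"
  shows "(\<Sum>q\<le>2 * r. s q) \<le> (2 * real r + 1) / 2 * (s 0 + s (2 * r))"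
proof -
  define t where "t k = s (2 * k)" for k
  define \<Delta> where "\<Delta> k = t (k + 1) - t k" for k
  have \<Delta>_Suc: "\<Delta> k \<le> \<Delta> (Suc k)" if "k + 1 < r" for k
    using even[OF that] by (simp add: \<Delta>_def t_def eval_nat_numeral)
  have \<Delta>_mono: "\<Delta> i \<le> \<Delta> j" if "i \<le> j" "j < r" for i j
    using that
  proof (induction j rule: dec_induct)
    case (step j)
    then show ?case using \<Delta>_Suc[of j] by simp
  qed simp
  have conv: "t k + t (r - k) \<le> t 0 + t r" if "k \<le> r" for k
  proof -
    have "t k - t 0 = (\<Sum>i<k. \<Delta> i)"
      unfolding \<Delta>_def using sum_lessThan_telescope[of t k] by simp
    also have "\<dots> \<le> (\<Sum>i<k. \<Delta> (r - k + i))"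
      using that by (intro sum_mono \<Delta>_mono) auto
    also have "\<dots> = t r - t (r - k)"
      unfolding \<Delta>_def using sum_lessThan_telescope[of "\<lambda>i. t (r - k + i)" k] that by simp
    finally show ?thesis by simp
  qed
  have "2 * (\<Sum>k\<le>r. t k) = (\<Sum>k\<le>r. t k) + (\<Sum>k\<le>r. t (r - k))"
    using sum.nat_diff_reindex[of t "Suc r"] by (simp add: lessThan_Suc_atMost)
  also have "\<dots> = (\<Sum>k\<le>r. t k + t (r - k))" by (simp add: sum.distrib)
  also have "\<dots> \<le> (\<Sum>k\<le>r. t 0 + t r)" by (intro sum_mono conv) simp
  finally have T: "2 * (\<Sum>k\<le>r. t k) \<le> (real r + 1) * (t 0 + t r)" by (simp add: algebra_simps)
  have "(\<Sum>q\<le>2 * n. s q) = (\<Sum>k\<le>n. t k) + (\<Sum>k<n. s (2 * k + 1))" for n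
    by (induction n) (simp_all add: t_def)
  then have "(\<Sum>q\<le>2 * r. s q) \<le> (\<Sum>k\<le>r. t k) + (\<Sum>k<r. (t k + t (k + 1)) / 2)"
    using odd sum_mono[of "{..<r}" "\<lambda>k. s (2 * k + 1)" "\<lambda>k. (t k + t (k + 1)) / 2"]
    by (simp add: t_def)
  also have "(\<Sum>k<r. (t k + t (k + 1)) / 2) = (\<Sum>k\<le>r. t k) - (t 0 + t r) / 2"
    by (induction r) (simp_all add: field_simps)
  finally have "(\<Sum>q\<le>2 * r. s q) \<le> (real r + 1) * (t 0 + t r) - (t 0 + t r) / 2"
    using T by simp
  also have "\<dots> = (2 * real r + 1) / 2 * (s 0 + s (2 * r))" by (simp add: t_def algebra_simps)
  finally show ?thesis .
qed

text \<open>The summands with even powers are squared norms of the matrices z i j = W^i A Y^j. The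
  inequality 2 x y <= x^2 + y^2 for inner products of such matrices gives exactly the convexity
  needed, with even indices on the right; summands with odd powers of indefinite matrices have no
  sign of their own.\<close>

lemma trace_power_sum_le:
  fixes W Y A :: "real ^ 'n ^ 'n"
  assumes W: "transpose W = W" and Y: "transpose Y = Y"
  shows "(\<Sum>q\<le>2 * r. A \<bullet> (mpow W q ** A ** mpow Y (2 * r - q)))
    \<le> (2 * real r + 1) / 2 * ((norm (A ** mpow Y r))\<^sup>2 + (norm (mpow W r ** A))\<^sup>2)"
proof -
  define z where "z i j = mpow W i ** A ** mpow Y j" for i j
  define s where "s q = A \<bullet> z q (2 * r - q)" for q
  have z: "z i j \<bullet> z k l = A \<bullet> z (i + k) (j + l)" for i j k l
  proof -
    have "z i j \<bullet> z k l = A \<bullet> (mpow W i ** (z k l ** mpow Y j))"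
      unfolding z_def[of i j] inner_matrix_mult_right[of "mpow W i ** A" "mpow Y j"]
        inner_matrix_mult_left[of "mpow W i" A] transpose_mpow[OF W] transpose_mpow[OF Y] ..
    also have "mpow W i ** (z k l ** mpow Y j) = z (i + k) (l + j)"
      by (simp add: z_def mpow_add matrix_mul_assoc)
    finally show ?thesis by (simp add: add.commute)
  qed
  have le: "z i j \<bullet> z k l \<le> (A \<bullet> z (2 * i) (2 * j) + A \<bullet> z (2 * k) (2 * l)) / 2" for i j k l
  proof -
    have "0 \<le> (z i j - z k l) \<bullet> (z i j - z k l)" by simp
    then have "2 * (z i j \<bullet> z k l) \<le> z i j \<bullet> z i j + z k l \<bullet> z k l"
      by (simp add: inner_diff_left inner_diff_right inner_commute[of "z k l" "z i j"])
    then have "z i j \<bullet> z k l \<le> (z i j \<bullet> z i j + z k l \<bullet> z k l) / 2" by simp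
    then show ?thesis by (simp only: z mult_2)
  qed
  have s_eq: "s q = A \<bullet> z i j" if "q = i" "2 * r = i + j" for q i j
    using that by (simp add: s_def)
  have "(\<Sum>q\<le>2 * r. s q) \<le> (2 * real r + 1) / 2 * (s 0 + s (2 * r))"
  proof (rule convex_sequence_sum_le)
    fix k assume "k < r"
    then obtain l where r: "r = k + l + 1" by (metis add.assoc less_natE add_Suc_right add.right_neutral One_nat_def)
    show "s (2 * k + 1) \<le> (s (2 * k) + s (2 * k + 2)) / 2"
      using le[of k "l + 1" "k + 1" l] s_eq[of "2 * k + 1" "k + (k + 1)" "l + 1 + l"]
        s_eq[of "2 * k" "2 * k" "2 * (l + 1)"] s_eq[of "2 * k + 2" "2 * (k + 1)" "2 * l"]
      unfolding z r by simp
  next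
    fix k assume "k + 1 < r"
    then obtain l where r: "r = k + l + 2" by (metis add.commute add.left_commute add_2_eq_Suc' add_Suc_right less_natE plus_1_eq_Suc)
    show "s (2 * k + 2) \<le> (s (2 * k) + s (2 * k + 4)) / 2"
      using le[of k "l + 2" "k + 2" l] s_eq[of "2 * k + 2" "k + (k + 2)" "l + 2 + l"]
        s_eq[of "2 * k" "2 * k" "2 * (l + 2)"] s_eq[of "2 * k + 4" "2 * (k + 2)" "2 * l"]
      unfolding z r by simp
  qed
  moreover have "s 0 = (norm (A ** mpow Y r))\<^sup>2"
    using z[of 0 r 0 r] s_eq[of 0 "0 + 0" "r + r"] by (simp add: power2_norm_eq_inner z_def[of 0 r])
  moreover have "s (2 * r) = (norm (mpow W r ** A))\<^sup>2"
    using z[of r 0 r 0] s_eq[of "2 * r" "r + r" "0 + 0"] by (simp add: power2_norm_eq_inner z_def[of r 0])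
  ultimately show ?thesis by (simp add: s_def z_def)
qed

text \<open>J is the set of positive signs; averaging over \<open>Pow I\<close> is the expectation
  over independent Rademacher signs.\<close>

definition signed_sum :: "('i \<Rightarrow> real ^ 'n ^ 'n) \<Rightarrow> 'i set \<Rightarrow> 'i set \<Rightarrow> real ^ 'n ^ 'n" where
  "signed_sum A I J = (\<Sum>i\<in>I. (if i \<in> J then A i else - A i))"

lemma sum_Pow_remove:
  fixes f :: "'a set \<Rightarrow> real"
  assumes "finite I" "i \<in> I"
  shows "(\<Sum>J\<in>Pow I. f J) = (\<Sum>J\<in>Pow (I - {i}). f (insert i J) + f J)"
proof -
  have "Pow I = Pow (I - {i}) \<union> insert i ` Pow (I - {i})"
    using assms by (metis Pow_insert insert_Diff)
  moreover have "Pow (I - {i}) \<inter> insert i ` Pow (I - {i}) = {}" by auto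
  ultimately have "(\<Sum>J\<in>Pow I. f J) = (\<Sum>J\<in>Pow (I - {i}). f J) + (\<Sum>J\<in>insert i ` Pow (I - {i}). f J)"
    using assms by (simp add: sum.union_disjoint)
  also have "(\<Sum>J\<in>insert i ` Pow (I - {i}). f J) = (\<Sum>J\<in>Pow (I - {i}). f (insert i J))"
    by (subst sum.reindex) (auto simp: inj_on_def)
  finally show ?thesis by (simp add: sum.distrib add.commute)
qed

lemma transpose_sum: "transpose (\<Sum>i\<in>I. f i) = (\<Sum>i\<in>I. transpose (f i :: real ^ 'n ^ 'n))"
  by (induction I rule: infinite_finite_induct) (simp_all add: transpose_def vec_eq_iff)

lemma transpose_signed_sum:
  assumes "\<And>i. i \<in> I \<Longrightarrow> transpose (A i) = A i"
  shows "transpose (signed_sum A I J) = signed_sum A I J"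
proof -
  have neg: "transpose (- B) = - transpose B" for B :: "real ^ 'n ^ 'n"
    by (simp add: transpose_def vec_eq_iff)
  show ?thesis unfolding signed_sum_def transpose_sum
    by (rule sum.cong) (simp_all add: neg assms)
qed

text \<open>A discrete integration by parts. The squared norm of X^(p+1) is the sum over i of the
  i-th sign times the trace of A_i X^(2p+1). Summing over that sign leaves the difference of the
  powers of two matrices that differ by 2 A_i; telescoping and \<open>trace_power_sum_le\<close>
  bound it by (2p + 1) c^2 times moments of order p.\<close>

lemma signed_moment_Suc:
  fixes A :: "'i \<Rightarrow> real ^ 'n ^ 'n"
  assumes I: "finite I" and sym: "\<And>i. i \<in> I \<Longrightarrow> transpose (A i) = A i"
    and bound: "\<And>i x. i \<in> I \<Longrightarrow> norm (A i *v x) \<le> c * norm x" and c: "0 \<le> c"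
  shows "(\<Sum>J\<in>Pow I. (norm (mpow (signed_sum A I J) (Suc p)))\<^sup>2)
    \<le> (2 * real p + 1) * (real (card I) * c\<^sup>2) * (\<Sum>J\<in>Pow I. (norm (mpow (signed_sum A I J) p))\<^sup>2)"
proof -
  define X where "X = signed_sum A I"
  have X: "transpose (X J) = X J" for J unfolding X_def by (rule transpose_signed_sum[OF sym])
  define \<sigma> :: "'i \<Rightarrow> 'i set \<Rightarrow> real" where "\<sigma> i J = (if i \<in> J then 1 else - 1)" for i J
  have sq: "(norm (mpow (X J) (Suc p)))\<^sup>2 = (\<Sum>i\<in>I. \<sigma> i J * (A i \<bullet> mpow (X J) (2 * p + 1)))" for J
  proof -
    have "(norm (mpow (X J) (Suc p)))\<^sup>2 = X J \<bullet> (mpow (X J) (Suc p) ** mpow (X J) p)"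
      by (simp add: power2_norm_eq_inner inner_matrix_mult_right transpose_mpow[OF X])
    also have "mpow (X J) (Suc p) ** mpow (X J) p = mpow (X J) (2 * p + 1)"
      by (subst mpow_add[symmetric]) (simp add: mult_2)
    also have "X J \<bullet> B = (\<Sum>i\<in>I. \<sigma> i J * (A i \<bullet> B))" for B
      unfolding X_def signed_sum_def \<sigma>_def inner_sum_left by (intro sum.cong) auto
    finally show ?thesis .
  qed
  have "(\<Sum>J\<in>Pow I. (norm (mpow (X J) (Suc p)))\<^sup>2)
      = (\<Sum>i\<in>I. \<Sum>J\<in>Pow I. \<sigma> i J * (A i \<bullet> mpow (X J) (2 * p + 1)))"
    unfolding sq by (rule sum.swap)
  also have "\<dots> \<le> (\<Sum>i\<in>I. (2 * real p + 1) * c\<^sup>2 * (\<Sum>J\<in>Pow I. (norm (mpow (X J) p))\<^sup>2))"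
  proof (rule sum_mono)
    fix i assume i: "i \<in> I"
    have "(\<Sum>J\<in>Pow I. \<sigma> i J * (A i \<bullet> mpow (X J) (2 * p + 1)))
      = (\<Sum>J\<in>Pow (I - {i}). A i \<bullet> (mpow (X (insert i J)) (2 * p + 1) - mpow (X J) (2 * p + 1)))"
      by (subst sum_Pow_remove[OF I i], intro sum.cong) (auto simp: \<sigma>_def inner_diff_right)
    also have "\<dots> \<le> (\<Sum>J\<in>Pow (I - {i}). (2 * real p + 1) * c\<^sup>2 *
        ((norm (mpow (X (insert i J)) p))\<^sup>2 + (norm (mpow (X J) p))\<^sup>2))"
    proof (rule sum_mono)
      fix J assume J: "J \<in> Pow (I - {i})"
      let ?W = "X (insert i J)" and ?Y = "X J"
      have "X K = (\<Sum>j\<in>I - {i}. (if j \<in> K then A j else - A j)) + (if i \<in> K then A i else - A i)" for K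
        unfolding X_def signed_sum_def by (subst sum.remove[OF I i]) simp
      moreover have "(\<Sum>j\<in>I - {i}. (if j \<in> insert i J then A j else - A j))
          = (\<Sum>j\<in>I - {i}. (if j \<in> J then A j else - A j))"
        by (intro sum.cong) auto
      ultimately have D: "?W - ?Y = 2 *\<^sub>R A i" using J by (auto simp: scaleR_2)
      have "mpow ?W (2 * p + 1) - mpow ?Y (2 * p + 1) =
          (\<Sum>q\<le>2 * p. mpow ?W q ** (2 *\<^sub>R A i) ** mpow ?Y (2 * p - q))"
        using mpow_diff[of ?W "2 * p" ?Y] D by simp
      also have "\<dots> = (\<Sum>q\<le>2 * p. 2 *\<^sub>R (mpow ?W q ** A i ** mpow ?Y (2 * p - q)))"
        by (simp add: vec_eq_iff matrix_matrix_mult_def sum_distrib_left mult_ac)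
      finally have "A i \<bullet> (mpow ?W (2 * p + 1) - mpow ?Y (2 * p + 1)) =
          2 * (\<Sum>q\<le>2 * p. A i \<bullet> (mpow ?W q ** A i ** mpow ?Y (2 * p - q)))"
        by (simp add: inner_sum_right sum_distrib_left)
      also have "\<dots> \<le> 2 * ((2 * real p + 1) / 2 * ((norm (A i ** mpow ?Y p))\<^sup>2 + (norm (mpow ?W p ** A i))\<^sup>2))"
        by (intro mult_left_mono trace_power_sum_le X) simp
      also have "\<dots> \<le> 2 * ((2 * real p + 1) / 2 * ((c * norm (mpow ?Y p))\<^sup>2 + (c * norm (mpow ?W p))\<^sup>2))"
        using norm_matrix_mult_le[OF sym[OF i] bound[OF i] c]
        by (intro mult_left_mono add_mono power_mono) auto
      also have "\<dots> = (2 * real p + 1) * c\<^sup>2 * ((norm (mpow ?W p))\<^sup>2 + (norm (mpow ?Y p))\<^sup>2)"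
        by (simp add: power_mult_distrib field_simps)
      finally show "A i \<bullet> (mpow ?W (2 * p + 1) - mpow ?Y (2 * p + 1)) \<le> (2 * real p + 1) * c\<^sup>2 *
          ((norm (mpow ?W p))\<^sup>2 + (norm (mpow ?Y p))\<^sup>2)" .
    qed
    also have "\<dots> = (2 * real p + 1) * c\<^sup>2 * (\<Sum>J\<in>Pow I. (norm (mpow (X J) p))\<^sup>2)"
      by (simp add: sum_Pow_remove[OF I i] sum_distrib_left)
    finally show "(\<Sum>J\<in>Pow I. \<sigma> i J * (A i \<bullet> mpow (X J) (2 * p + 1)))
      \<le> (2 * real p + 1) * c\<^sup>2 * (\<Sum>J\<in>Pow I. (norm (mpow (X J) p))\<^sup>2)" .
  qed
  finally show ?thesis by (simp add: X_def mult_ac)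
qed

text \<open>The factors with indices k and p - 1 - k multiply to p^2 - (p - 2k - 1)^2.\<close>

lemma prod_odd_le: "(\<Prod>k<p. 2 * real k + 1) \<le> real p ^ p"
proof (rule power2_le_imp_le)
  have "(\<Prod>k<p. 2 * real k + 1)\<^sup>2 = (\<Prod>k<p. 2 * real k + 1) * (\<Prod>k<p. 2 * real (p - Suc k) + 1)"
    using prod.nat_diff_reindex[of "\<lambda>k. 2 * real k + 1" p] by (simp add: power2_eq_square)
  also have "\<dots> = (\<Prod>k<p. (2 * real k + 1) * (2 * real (p - Suc k) + 1))" by (simp add: prod.distrib)
  also have "\<dots> \<le> (\<Prod>k<p. (real p)\<^sup>2)"
  proof (rule prod_mono)
    fix k assume "k \<in> {..<p}"
    then have "real (p - Suc k) = real p - real k - 1" by (auto simp: of_nat_diff)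
    then have "(2 * real k + 1) * (2 * real (p - Suc k) + 1) = (real p)\<^sup>2 - (real p - 2 * real k - 1)\<^sup>2"
      by (simp only:) (simp add: power2_eq_square algebra_simps)
    moreover have "0 \<le> (2 * real k + 1) * (2 * real (p - Suc k) + 1)" by simp
    ultimately show "0 \<le> (2 * real k + 1) * (2 * real (p - Suc k) + 1) \<and>
        (2 * real k + 1) * (2 * real (p - Suc k) + 1) \<le> (real p)\<^sup>2"
      using zero_le_power2[of "real p - 2 * real k - 1"] by linarith
  qed
  also have "\<dots> = (real p ^ p)\<^sup>2" by (simp only: prod_constant card_lessThan) (metis mult.commute power_mult)
  finally show "(\<Prod>k<p. 2 * real k + 1)\<^sup>2 \<le> (real p ^ p)\<^sup>2" .
qed simp

text \<open>The moment recursion ends at the identity matrix, whose squared Frobenius norm is the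
  dimension. It accumulates the double factorial (2p - 1)!!, for which p^p is a convenient
  bound.\<close>

theorem signed_moment_le:
  fixes A :: "'i \<Rightarrow> real ^ 'n ^ 'n"
  assumes "finite I" "\<And>i. i \<in> I \<Longrightarrow> transpose (A i) = A i"
    "\<And>i x. i \<in> I \<Longrightarrow> norm (A i *v x) \<le> c * norm x" "0 \<le> c"
  shows "(\<Sum>J\<in>Pow I. (norm (mpow (signed_sum A I J) p))\<^sup>2)
    \<le> 2 ^ card I * real CARD('n) * (real p * (real (card I) * c\<^sup>2)) ^ p"
proof -
  let ?M = "\<lambda>p. \<Sum>J\<in>Pow I. (norm (mpow (signed_sum A I J) p))\<^sup>2"
  let ?C = "real (card I) * c\<^sup>2"
  have "?M p \<le> 2 ^ card I * real CARD('n) * ((\<Prod>k<p. 2 * real k + 1) * ?C ^ p)"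
  proof (induction p)
    case 0
    have "(norm (mat 1 :: real ^ 'n ^ 'n))\<^sup>2 = real CARD('n)"
    proof -
      have "(norm ((mat 1 :: real ^ 'n ^ 'n) $ i))\<^sup>2 = 1" for i
        by (simp add: norm_vec_sq mat_def if_distrib[of "\<lambda>x. x\<^sup>2"] cong: if_cong)
      then show ?thesis by (simp add: norm_vec_sq[of "mat 1 :: real ^ 'n ^ 'n"])
    qed
    then show ?case using assms(1) by (simp add: card_Pow)
  next
    case (Suc p)
    have "?M (Suc p) \<le> (2 * real p + 1) * ?C * ?M p" by (rule signed_moment_Suc[OF assms])
    also have "\<dots> \<le> (2 * real p + 1) * ?C * (2 ^ card I * real CARD('n) * ((\<Prod>k<p. 2 * real k + 1) * ?C ^ p))"
      by (intro mult_left_mono Suc) simp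
    finally show ?case by (simp add: mult_ac)
  qed
  also have "\<dots> \<le> 2 ^ card I * real CARD('n) * (real p ^ p * ?C ^ p)"
    by (intro mult_left_mono mult_right_mono prod_odd_le) auto
  finally show ?thesis by (simp add: power_mult_distrib)
qed

text \<open>The norms b k of X^k u are log-convex by symmetry and Cauchy-Schwarz, so (b 1)^k <= b k;
  this replaces an eigenbasis.\<close>

lemma quadratic_form_power_le:
  fixes X :: "real ^ 'n ^ 'n"
  assumes X: "transpose X = X" and u: "norm u = 1"
  shows "\<bar>u \<bullet> (X *v u)\<bar> ^ (2 * p) \<le> (norm (mpow X p))\<^sup>2"
proof -
  define b where "b k = norm (mpow X k *v u)" for k
  have b0: "b 0 = 1" by (simp add: b_def u)
  have b1: "b 1 = norm (X *v u)" by (simp add: b_def)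
  have X_sym: "(X *v x) \<bullet> y = x \<bullet> (X *v y)" for x y
    by (metis X dot_lmul_matrix transpose_matrix_vector)
  have log_convex: "(b (Suc k))\<^sup>2 \<le> b k * b (Suc (Suc k))" for k
  proof -
    have "(b (Suc k))\<^sup>2 = (X *v (mpow X k *v u)) \<bullet> (X *v (mpow X k *v u))"
      by (simp add: b_def power2_norm_eq_inner matrix_vector_mul_assoc)
    also have "\<dots> = (mpow X k *v u) \<bullet> (X *v (X *v (mpow X k *v u)))" by (rule X_sym)
    also have "X *v (X *v (mpow X k *v u)) = mpow X (Suc (Suc k)) *v u"
      by (simp add: matrix_vector_mul_assoc matrix_mul_assoc)
    also have "(mpow X k *v u) \<bullet> (mpow X (Suc (Suc k)) *v u) \<le> b k * b (Suc (Suc k))" unfolding b_def by (rule norm_cauchy_schwarz)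
    finally show ?thesis .
  qed
  have nn: "0 \<le> b k" for k by (simp add: b_def)
  have step: "b 1 * b k \<le> b (Suc k)" for k
  proof (induction k)
    case (Suc k)
    show ?case
    proof (cases "b (Suc k) = 0")
      case False
      then have p: "0 < b (Suc k)" using nn[of "Suc k"] by simp
      then have "0 < b k * b (Suc (Suc k))" using log_convex[of k] by (smt (verit) zero_less_power)
      then have bk: "0 < b k" using nn[of k] by (simp add: zero_less_mult_iff)
      have "b k * (b 1 * b (Suc k)) \<le> b (Suc k) * b (Suc k)"
        using mult_right_mono[OF Suc nn[of "Suc k"]] by (simp add: mult_ac)
      also have "\<dots> \<le> b k * b (Suc (Suc k))" using log_convex[of k] by (simp add: power2_eq_square)
      finally show ?thesis using bk by simp
    qed (simp add: nn)
  qed (simp add: b0)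
  have pw: "b 1 ^ k \<le> b k" for k
  proof (induction k)
    case (Suc k)
    have "b 1 ^ Suc k \<le> b 1 * b k" using Suc nn[of 1] by (simp add: mult_left_mono)
    then show ?case using step[of k] by simp
  qed (simp add: b0)
  have "\<bar>u \<bullet> (X *v u)\<bar> \<le> b 1" unfolding b1 using Cauchy_Schwarz_ineq2[of u "X *v u"] by (simp add: u)
  then have "\<bar>u \<bullet> (X *v u)\<bar> ^ (2 * p) \<le> b 1 ^ (2 * p)" by (rule power_mono) simp
  also have "\<dots> = (b 1 ^ p)\<^sup>2" by (metis mult.commute power_mult)
  also have "\<dots> \<le> (b p)\<^sup>2" using pw[of p] nn[of 1] by (intro power_mono) auto
  also have "\<dots> \<le> (norm (mpow X p))\<^sup>2"
    using norm_matrix_vector_le[of "mpow X p" u] by (intro power_mono) (auto simp: b_def u)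
  finally show ?thesis .
qed


section \<open>Empirical losses\<close>

text \<open>Polarization of x against the vector of the same length in the direction of A x,
  followed by the parallelogram law.\<close>

lemma symmetric_norm_le:
  fixes A :: "real ^ 'n ^ 'n"
  assumes sym: "\<And>x y. x \<bullet> (A *v y) = y \<bullet> (A *v x)" and form: "\<And>x. \<bar>x \<bullet> (A *v x)\<bar> \<le> c * (norm x)\<^sup>2"
  shows "norm (A *v x) \<le> c * norm x"
proof (cases "A *v x = 0 \<or> x = 0")
  case True
  have "0 \<le> c"
  proof -
    have "\<bar>axis undefined 1 \<bullet> (A *v axis undefined 1)\<bar> \<le> c * 1"
      using form[of "axis undefined 1"] by simp
    then show ?thesis by simp
  qed
  then show ?thesis using True by auto
next
  case False
  define s where "s = norm x / norm (A *v x)"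
  define y where "y = s *\<^sub>R (A *v x)"
  have ny: "norm y = norm x" using False by (simp add: y_def s_def)
  have "4 * (y \<bullet> (A *v x)) = (x + y) \<bullet> (A *v (x + y)) - (x - y) \<bullet> (A *v (x - y))"
    using sym[of x y] by (simp add: matrix_vector_right_distrib matrix_vector_mult_diff_distrib
        inner_add_left inner_add_right inner_diff_left inner_diff_right)
  also have "\<dots> \<le> c * (norm (x + y))\<^sup>2 + c * (norm (x - y))\<^sup>2"
    using form[of "x + y"] form[of "x - y"] by linarith
  also have "\<dots> = 2 * c * ((norm x)\<^sup>2 + (norm y)\<^sup>2)"
    by (simp add: power2_norm_eq_inner inner_add_left inner_add_right inner_diff_left inner_diff_right
        algebra_simps)
  also have "y \<bullet> (A *v x) = norm x * norm (A *v x)"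
    using False by (simp add: y_def s_def power2_norm_eq_inner[symmetric] power2_eq_square)
  finally have "norm x * norm (A *v x) \<le> norm x * (c * norm x)"
    by (simp add: ny power2_eq_square mult_ac)
  then show ?thesis using False by simp
qed

lemma GDERIV_sum:
  assumes "\<And>i. i \<in> I \<Longrightarrow> GDERIV (f i) w :> g i"
  shows "GDERIV (\<lambda>w. \<Sum>i\<in>I. f i w) w :> (\<Sum>i\<in>I. g i)"
  using assms unfolding gderiv_def inner_sum_right by (intro has_derivative_sum) auto

lemma GDERIV_const_mult:
  assumes "GDERIV f w :> g" shows "GDERIV (\<lambda>w. c * f w) w :> c *\<^sub>R g"
  using assms unfolding gderiv_def by (auto intro!: derivative_eq_intros)

lemma GDERIV_norm_sq: "GDERIV (\<lambda>w. c / 2 * (norm w)\<^sup>2) w :> c *\<^sub>R w"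
  unfolding gderiv_def power2_norm_eq_inner
  by (auto intro!: derivative_eq_intros simp: inner_commute algebra_simps)

text \<open>The weights serve twice: c is lam for a local loss and 0 for the average of the local
  losses.\<close>

lemma smooth_combination:
  fixes f :: "'i \<Rightarrow> real ^ 'n \<Rightarrow> real"
  assumes "\<And>i. i \<in> I \<Longrightarrow> twice_differentiable (f i)"
    and g_def: "g = (\<lambda>w. a * (\<Sum>i\<in>I. f i w) + c / 2 * (norm w)\<^sup>2)"
  shows "grad g w = a *\<^sub>R (\<Sum>i\<in>I. grad (f i) w) + c *\<^sub>R w"
    "hess g w = a *\<^sub>R (\<Sum>i\<in>I. hess (f i) w) + c *\<^sub>R mat 1"
    "twice_differentiable g"
proof -
  let ?g = "\<lambda>w. a *\<^sub>R (\<Sum>i\<in>I. grad (f i) w) + c *\<^sub>R w"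
  let ?h = "\<lambda>w. a *\<^sub>R (\<Sum>i\<in>I. hess (f i) w) + c *\<^sub>R mat 1"
  have 1: "GDERIV g w :> ?g w" for w
    unfolding g_def using assms(1)
    by (intro GDERIV_add GDERIV_const_mult GDERIV_sum GDERIV_norm_sq twice_differentiableD) auto
  have "(\<Sum>i\<in>I. A i) *v x = (\<Sum>i\<in>I. A i *v x)" for A :: "'i \<Rightarrow> real ^ 'n ^ 'n" and x
    by (induction I rule: infinite_finite_induct) (simp_all add: matrix_vector_mult_add_rdistrib)
  then have h: "?h w *v x = a *\<^sub>R (\<Sum>i\<in>I. hess (f i) w *v x) + c *\<^sub>R x" for w x
    by (simp add: matrix_vector_mult_add_rdistrib scaleR_matrix_vector_assoc[symmetric])
  have 2: "(?g has_derivative (\<lambda>x. ?h w *v x)) (at w)" for w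
    unfolding h using assms(1)
    by (intro has_derivative_add has_derivative_scaleR_right has_derivative_sum
        twice_differentiableD has_derivative_ident) auto
  show "grad g w = ?g w" by (rule grad_eqI[OF 1])
  show "hess g w = ?h w" by (rule hess_eqI[OF 1 2])
  show "twice_differentiable g" by (rule twice_differentiableI[OF 1 2])
qed

lemma matrix_sum_vector: "(\<Sum>i\<in>I. A i) *v x = (\<Sum>i\<in>I. A i *v (x :: real ^ 'n))"
  by (induction I rule: infinite_finite_induct) (simp_all add: matrix_vector_mult_add_rdistrib)

lemma inner_sum_matrix:
  "x \<bullet> ((a *\<^sub>R (\<Sum>i\<in>I. A i)) *v y) = a * (\<Sum>i\<in>I. x \<bullet> (A i *v (y :: real ^ 'n)))"
  by (simp add: scaleR_matrix_vector_assoc[symmetric] matrix_sum_vector inner_sum_right)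

lemma average_le:
  assumes "m \<ge> (1 :: nat)" "\<And>i. i \<in> {1..m} \<Longrightarrow> x i \<le> (c :: real)"
  shows "(1 / real m) * (\<Sum>i=1..m. x i) \<le> c"
proof -
  have "(\<Sum>i=1..m. x i) \<le> real (card {1..m}) * c" by (rule sum_bounded_above) (use assms in auto)
  then show ?thesis using assms(1) by (simp add: field_simps)
qed

lemma average_ge:
  assumes "m \<ge> (1 :: nat)" "\<And>i. i \<in> {1..m} \<Longrightarrow> (c :: real) \<le> x i"
  shows "c \<le> (1 / real m) * (\<Sum>i=1..m. x i)"
proof -
  have "real (card {1..m}) * c \<le> (\<Sum>i=1..m. x i)" by (rule sum_bounded_below) (use assms in auto)
  then show ?thesis using assms(1) by (simp add: field_simps)
qed

section \<open>Bounds for the regularized losses on a fixed data set\<close>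

locale erm =
  fixes \<phi> :: "real ^ 'd \<Rightarrow> 'z \<Rightarrow> real" and S :: "'z measure" and lam V\<^sub>0 G L M :: real and m n :: nat
  assumes m: "m \<ge> 1" and n: "n \<ge> 1" and lam: "lam > 0"
    and phi_meas: "\<And>w. \<phi> w \<in> borel_measurable S"
    and phi_convex: "\<And>x. x \<in> space S \<Longrightarrow> convex_on UNIV (\<lambda>w. \<phi> w x)"
    and phi_smooth: "\<And>x. x \<in> space S \<Longrightarrow> twice_differentiable (\<lambda>w. \<phi> w x)"
    and phi_nonneg: "\<And>x w. x \<in> space S \<Longrightarrow> \<phi> w x \<ge> 0"
    and phi_zero: "\<And>x. x \<in> space S \<Longrightarrow> \<phi> 0 x \<le> V\<^sub>0"
    and phi_grad: "\<And>x w. x \<in> space S \<Longrightarrow> norm w \<le> sqrt (2 * V\<^sub>0 / lam) \<Longrightarrow>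
                     norm (grad (\<lambda>w. \<phi> w x) w) \<le> G"
    and phi_hess: "\<And>x w. x \<in> space S \<Longrightarrow> spectral_norm (hess (\<lambda>w. \<phi> w x) w) \<le> L - lam"
    and phi_hess_lipschitz: "\<And>x u w. x \<in> space S \<Longrightarrow>
          spectral_norm (hess (\<lambda>w. \<phi> w x) u - hess (\<lambda>w. \<phi> w x) w) \<le> M * norm (u - w)"
    and space_S: "space S \<noteq> {}"
begin

definition "R = sqrt (2 * V\<^sub>0 / lam)"

text \<open>The signs of the constants come from nonemptiness of the sample space: each constant
  bounds a nonnegative quantity at some sample.\<close>

lemma V0_nonneg: "0 \<le> V\<^sub>0"
  using space_S phi_nonneg phi_zero by (metis ex_in_conv order_trans)

lemma R_nonneg: "0 \<le> R" and R_sq: "R\<^sup>2 = 2 * V\<^sub>0 / lam"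
  using V0_nonneg lam by (simp_all add: R_def)

lemma lam_le_L: "lam \<le> L"
  using space_S phi_hess spectral_norm_bounds(2) by (metis diff_ge_0_iff_ge ex_in_conv order_trans)

lemma L_pos: "0 < L"
  using lam_le_L lam by simp

lemma G_nonneg: "0 \<le> G"
  using space_S phi_grad[of _ 0] R_nonneg unfolding R_def
  by (metis ex_in_conv norm_ge_zero norm_zero order_trans)

lemma M_nonneg: "0 \<le> M"
proof -
  obtain x where "x \<in> space S" using space_S by blast
  from phi_hess_lipschitz[OF this, of "axis undefined 1" 0] show ?thesis
    using spectral_norm_bounds(2) by (metis diff_zero mult.right_neutral norm_axis_1 order_trans)
qed

abbreviation "h x w \<equiv> hess (\<lambda>w. \<phi> w x) w"

lemma h_sym: "x \<in> space S \<Longrightarrow> u \<bullet> (h x w *v v) = v \<bullet> (h x w *v u)"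
  by (rule hess_symmetric[OF phi_smooth phi_hess_lipschitz])

lemma h_nonneg: "x \<in> space S \<Longrightarrow> 0 \<le> u \<bullet> (h x w *v u)"
  by (rule convex_hess_nonneg[OF phi_smooth phi_convex])

lemma h_le: "x \<in> space S \<Longrightarrow> u \<bullet> (h x w *v u) \<le> (L - lam) * (norm u)\<^sup>2"
proof -
  assume x: "x \<in> space S"
  have "u \<bullet> (h x w *v u) \<le> norm u * norm (h x w *v u)" by (rule norm_cauchy_schwarz)
  also have "\<dots> \<le> norm u * (spectral_norm (h x w) * norm u)"
    by (intro mult_left_mono spectral_norm_bounds) simp
  also have "\<dots> \<le> norm u * ((L - lam) * norm u)"
    by (intro mult_left_mono mult_right_mono phi_hess x) auto
  finally show ?thesis by (simp add: power2_eq_square mult_ac)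
qed

lemma h_lipschitz:
  assumes "x \<in> space S"
  shows "\<bar>u \<bullet> (h x w *v u) - u \<bullet> (h x w' *v u)\<bar> \<le> M * norm (w - w') * (norm u)\<^sup>2"
proof -
  have "\<bar>u \<bullet> ((h x w - h x w') *v u)\<bar> \<le> norm u * norm ((h x w - h x w') *v u)"
    by (rule Cauchy_Schwarz_ineq2)
  also have "\<dots> \<le> norm u * (spectral_norm (h x w - h x w') * norm u)"
    by (intro mult_left_mono spectral_norm_bounds) simp
  also have "\<dots> \<le> norm u * ((M * norm (w - w')) * norm u)"
    by (intro mult_left_mono mult_right_mono phi_hess_lipschitz assms) auto
  finally show ?thesis
    by (simp add: matrix_vector_mult_diff_rdistrib inner_diff_right power2_eq_square mult_ac)
qed

lemma h_continuous: "x \<in> space S \<Longrightarrow> continuous_on UNIV (h x)"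
proof -
  assume x: "x \<in> space S"
  have "continuous_on UNIV (\<lambda>w. h x w $ a $ b)" for a b
  proof -
    have entry: "A $ a $ b = axis a 1 \<bullet> (A *v axis b 1)" for A :: "real ^ 'd ^ 'd"
      by (simp add: inner_axis' matrix_vector_mul_component inner_axis)
    have "dist (h x w $ a $ b) (h x w' $ a $ b) \<le> M * dist w w'" for w w'
    proof -
      have "dist (h x w $ a $ b) (h x w' $ a $ b) = \<bar>axis a 1 \<bullet> ((h x w - h x w') *v axis b 1)\<bar>"
        unfolding entry dist_real_def by (simp add: matrix_vector_mult_diff_rdistrib inner_diff_right)
      also have "\<dots> \<le> norm (axis a 1 :: real ^ 'd) * norm ((h x w - h x w') *v axis b 1)"
        by (rule Cauchy_Schwarz_ineq2)
      also have "\<dots> \<le> 1 * (spectral_norm (h x w - h x w') * norm (axis b 1 :: real ^ 'd))"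
        by (intro mult_mono spectral_norm_bounds) auto
      also have "\<dots> \<le> M * dist w w'" using phi_hess_lipschitz[OF x] by (simp add: dist_norm)
      finally show ?thesis .
    qed
    then show ?thesis
      by (intro lipschitz_on_continuous_on[of M]) (auto simp: lipschitz_on_def M_nonneg)
  qed
  then show ?thesis by (intro continuous_on_vec_lambda[of UNIV "\<lambda>a w. h x w $ a", simplified] 
        continuous_on_vec_lambda[of UNIV "\<lambda>b w. h x w $ _ $ b", simplified])
qed

text \<open>The tangent is taken at u, so the gradient bound is invoked only there and w may lie
  outside the ball.\<close>

lemma phi_lipschitz:
  assumes "x \<in> space S" "norm u \<le> R"
  shows "\<phi> u x - \<phi> w x \<le> G * norm (u - w)"
proof -
  let ?g = "grad (\<lambda>w. \<phi> w x) u"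
  have "\<phi> u x + ?g \<bullet> (w - u) \<le> \<phi> w x"
    by (rule convex_ge_tangent[OF phi_smooth phi_convex]) fact+
  moreover have "- (?g \<bullet> (w - u)) \<le> norm ?g * norm (u - w)"
    using Cauchy_Schwarz_ineq2[of ?g "w - u"] by (simp add: norm_minus_commute abs_le_iff)
  moreover have "norm ?g * norm (u - w) \<le> G * norm (u - w)"
    using phi_grad[OF assms(1)] assms(2) by (intro mult_right_mono) (auto simp: R_def)
  ultimately show ?thesis by linarith
qed

abbreviation "F c \<equiv> local_loss \<phi> lam n c"
abbreviation "f c \<equiv> average_loss m (F c)"
abbreviation "valid c \<equiv> \<forall>i\<in>{1..m}. \<forall>j\<in>{1..n}. c i j \<in> space S"
abbreviation "reg \<rho> c i \<equiv> (\<lambda>w. F c i w + \<rho> / 2 * (norm w)\<^sup>2)"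
abbreviation "local_min \<rho> c i \<equiv> minimizer (reg \<rho> c i)"

lemma valid_nth: "valid c \<Longrightarrow> i \<in> {1..m} \<Longrightarrow> j \<in> {1..n} \<Longrightarrow> c i j \<in> space S"
  by blast

lemma F_smooth:
  assumes "valid c" "i \<in> {1..m}"
  shows "hess (F c i) w = (1 / real n) *\<^sub>R (\<Sum>j=1..n. h (c i j) w) + lam *\<^sub>R mat 1"
    "twice_differentiable (F c i)"
proof -
  have "F c i = (\<lambda>w. (1 / real n) * (\<Sum>j\<in>{1..n}. \<phi> w (c i j)) + lam / 2 * (norm w)\<^sup>2)"
    by (rule ext) (simp add: local_loss_def)
  from smooth_combination(2,3)[of "{1..n}" "\<lambda>j w. \<phi> w (c i j)", OF phi_smooth[OF valid_nth[OF assms]] this]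
  show "hess (F c i) w = (1 / real n) *\<^sub>R (\<Sum>j=1..n. h (c i j) w) + lam *\<^sub>R mat 1"
    "twice_differentiable (F c i)" by auto
qed

lemma f_smooth:
  assumes "valid c"
  shows "hess (f c) w = (1 / real m) *\<^sub>R (\<Sum>i=1..m. hess (F c i) w)" "twice_differentiable (f c)"
proof -
  have "f c = (\<lambda>w. (1 / real m) * (\<Sum>i\<in>{1..m}. F c i w) + 0 / 2 * (norm w)\<^sup>2)"
    by (rule ext) (simp add: average_loss_def)
  from smooth_combination(2,3)[of "{1..m}" "F c", OF F_smooth(2)[OF assms] this]
  show "hess (f c) w = (1 / real m) *\<^sub>R (\<Sum>i=1..m. hess (F c i) w)" "twice_differentiable (f c)"
    by auto
qed

lemma F_hess_form:
  assumes "valid c" "i \<in> {1..m}"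
  shows "u \<bullet> (hess (F c i) w *v v) = (1 / real n) * (\<Sum>j=1..n. u \<bullet> (h (c i j) w *v v)) + lam * (u \<bullet> v)"
  unfolding F_smooth(1)[OF assms] matrix_vector_mult_add_rdistrib inner_add_right inner_sum_matrix
  by (simp add: scaleR_matrix_vector_assoc[symmetric])

lemma f_hess_form:
  assumes "valid c"
  shows "u \<bullet> (hess (f c) w *v v) = (1 / real m) * (\<Sum>i=1..m. u \<bullet> (hess (F c i) w *v v))"
  unfolding f_smooth(1)[OF assms] inner_sum_matrix ..

lemma F_hess:
  assumes c: "valid c" and i: "i \<in> {1..m}"
  shows "u \<bullet> (hess (F c i) w *v v) = v \<bullet> (hess (F c i) w *v u)"
    "lam * (norm u)\<^sup>2 \<le> u \<bullet> (hess (F c i) w *v u)"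
    "u \<bullet> (hess (F c i) w *v u) \<le> L * (norm u)\<^sup>2"
proof -
  show "u \<bullet> (hess (F c i) w *v v) = v \<bullet> (hess (F c i) w *v u)"
    unfolding F_hess_form[OF assms] using h_sym valid_nth[OF assms]
    by (intro arg_cong2[where f = "(+)"] arg_cong2[where f = "(*)"] sum.cong refl) (auto simp: inner_commute)
  have "0 \<le> (1 / real n) * (\<Sum>j=1..n. u \<bullet> (h (c i j) w *v u))"
    by (rule average_ge[OF n h_nonneg[OF valid_nth[OF assms]]])
  then show "lam * (norm u)\<^sup>2 \<le> u \<bullet> (hess (F c i) w *v u)"
    unfolding F_hess_form[OF assms] by (simp add: power2_norm_eq_inner)
  have "(1 / real n) * (\<Sum>j=1..n. u \<bullet> (h (c i j) w *v u)) \<le> (L - lam) * (norm u)\<^sup>2"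
    by (rule average_le[OF n h_le[OF valid_nth[OF assms]]])
  then show "u \<bullet> (hess (F c i) w *v u) \<le> L * (norm u)\<^sup>2"
    unfolding F_hess_form[OF assms] by (simp add: power2_norm_eq_inner[symmetric] algebra_simps)
qed

lemma f_hess:
  assumes c: "valid c"
  shows "u \<bullet> (hess (f c) w *v v) = v \<bullet> (hess (f c) w *v u)"
    "lam * (norm u)\<^sup>2 \<le> u \<bullet> (hess (f c) w *v u)"
    "u \<bullet> (hess (f c) w *v u) \<le> L * (norm u)\<^sup>2"
  unfolding f_hess_form[OF c]
  using F_hess(1)[OF c, of _ u w v] average_ge[OF m F_hess(2)[OF c]] average_le[OF m F_hess(3)[OF c]]
  by (auto intro: sum.cong)

lemma hess_continuous:
  assumes c: "valid c"
  shows "i \<in> {1..m} \<Longrightarrow> continuous_on UNIV (hess (F c i))" "continuous_on UNIV (hess (f c))"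
proof -
  show F: "continuous_on UNIV (hess (F c i))" if "i \<in> {1..m}" for i
    unfolding F_smooth(1)[OF c that, abs_def] using valid_nth[OF c that]
    by (intro continuous_intros h_continuous) auto
  show "continuous_on UNIV (hess (f c))"
    unfolding f_smooth(1)[OF c, abs_def] by (intro continuous_intros F) auto
qed

lemma F_nonneg: "valid c \<Longrightarrow> i \<in> {1..m} \<Longrightarrow> lam / 2 * (norm w)\<^sup>2 \<le> F c i w"
  unfolding local_loss_def using average_ge[OF n, of 0 "\<lambda>j. \<phi> w (c i j)"] phi_nonneg by auto

lemma f_nonneg: "valid c \<Longrightarrow> lam / 2 * (norm w)\<^sup>2 \<le> f c w"
  unfolding average_loss_def by (rule average_ge[OF m F_nonneg])

lemma F_zero: "valid c \<Longrightarrow> i \<in> {1..m} \<Longrightarrow> F c i 0 \<le> V\<^sub>0"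
  using average_le[OF n, of "\<lambda>j. \<phi> 0 (c i j)" V\<^sub>0] phi_zero by (auto simp: local_loss_def)

lemma f_zero: "valid c \<Longrightarrow> f c 0 \<le> V\<^sub>0"
  unfolding average_loss_def by (rule average_le[OF m F_zero])

lemma convex_average:
  assumes "\<And>i. i \<in> I \<Longrightarrow> convex_on UNIV (g i)" "0 \<le> a"
  shows "convex_on UNIV (\<lambda>w. a * (\<Sum>i\<in>I. g i w))"
proof -
  have "convex_on UNIV (\<lambda>w. \<Sum>i\<in>I. g i w)"
    using assms(1) by (induction I rule: infinite_finite_induct) (auto intro!: convex_on_add simp: convex_on_const)
  then show ?thesis using assms(2) by (intro convex_on_cmul)
qed

lemma F_convex_part:
  assumes "valid c" "i \<in> {1..m}"
  shows "convex_on UNIV (\<lambda>w. (1 / real n) * (\<Sum>j=1..n. \<phi> w (c i j)))"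
  using assms by (intro convex_average phi_convex) auto

text \<open>The data term is merely convex; the two quadratic terms are merged to exhibit the
  modulus lam + \<rho>.\<close>

lemma reg_growth:
  assumes c: "valid c" and i: "i \<in> {1..m}" and \<rho>: "0 \<le> \<rho>"
  shows "reg \<rho> c i (local_min \<rho> c i) + (lam + \<rho>) / 2 * (norm (w - local_min \<rho> c i))\<^sup>2 \<le> reg \<rho> c i w"
proof -
  let ?p = "\<lambda>w. (1 / real n) * (\<Sum>j=1..n. \<phi> w (c i j))"
  have eq: "reg \<rho> c i w = ?p w + (lam + \<rho>) / 2 * (norm w)\<^sup>2" for w
    by (simp add: local_loss_def algebra_simps add_divide_distrib)
  have "reg \<rho> c i (local_min \<rho> c i) \<le> reg \<rho> c i y" for y
  proof (rule coercive_minimizer[OF _ lam])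
    show "continuous_on UNIV (reg \<rho> c i)"
      by (intro continuous_intros twice_differentiableD(3)[OF F_smooth(2)[OF c i]])
    show "lam / 2 * (norm w)\<^sup>2 \<le> reg \<rho> c i w" for w
      using F_nonneg[OF c i, of w] \<rho> by (simp add: add_increasing2)
  qed
  then show ?thesis unfolding eq by (rule strongly_convex_growth[OF F_convex_part[OF c i]])
qed

lemma f_growth:
  assumes c: "valid c"
  shows "f c (minimizer (f c)) + lam / 2 * (norm (w - minimizer (f c)))\<^sup>2 \<le> f c w"
proof -
  let ?p = "\<lambda>w. (1 / real m) * (\<Sum>i=1..m. (1 / real n) * (\<Sum>j=1..n. \<phi> w (c i j)))"
  have eq: "f c w = ?p w + lam / 2 * (norm w)\<^sup>2" for w
    unfolding average_loss_def local_loss_def sum.distrib distrib_left[of "1 / real m"] using m by simp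
  have "f c (minimizer (f c)) \<le> f c y" for y
    by (rule coercive_minimizer[OF twice_differentiableD(3)[OF f_smooth(2)[OF c]] lam f_nonneg[OF c]])
  moreover have "convex_on UNIV ?p" by (intro convex_average F_convex_part c) auto
  ultimately show ?thesis unfolding eq by (intro strongly_convex_growth)
qed

lemma f_min_le: "valid c \<Longrightarrow> f c (minimizer (f c)) \<le> f c w"
  using f_growth[of c w] lam by (smt (verit) mult_nonneg_nonneg zero_le_power2 divide_nonneg_pos)

lemma f_convex: "valid c \<Longrightarrow> convex_on UNIV (f c)"
proof -
  assume c: "valid c"
  have "convex_on UNIV (F c i)" if i: "i \<in> {1..m}" for i
  proof -
    have "convex_on UNIV (\<lambda>w :: real ^ 'd. (norm w)\<^sup>2)"
    proof (rule convex_onI)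
      fix t :: real and x y :: "real ^ 'd" assume t: "0 < t" "t < 1"
      have "(norm ((1 - t) *\<^sub>R x + t *\<^sub>R y))\<^sup>2 = (1 - t) * (norm x)\<^sup>2 + t * (norm y)\<^sup>2 - t * (1 - t) * (norm (y - x))\<^sup>2"
        by (simp add: power2_norm_eq_inner inner_add_left inner_add_right inner_diff_left inner_diff_right
          inner_commute[of y x] algebra_simps)
      then show "(norm ((1 - t) *\<^sub>R x + t *\<^sub>R y))\<^sup>2 \<le> (1 - t) * (norm x)\<^sup>2 + t * (norm y)\<^sup>2" using t by simp
    qed simp
    then show ?thesis
      unfolding local_loss_def using lam by (intro convex_on_add convex_on_cmul[of "lam / 2"] F_convex_part[OF c i]) auto
  qed
  then show ?thesis unfolding average_loss_def by (intro convex_average) auto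
qed

lemma norm_le_R: "lam / 2 * (norm w)\<^sup>2 \<le> V\<^sub>0 \<Longrightarrow> norm w \<le> R"
proof (rule power2_le_imp_le[OF _ R_nonneg])
  assume "lam / 2 * (norm w)\<^sup>2 \<le> V\<^sub>0"
  then have "(norm w)\<^sup>2 * lam \<le> 2 * V\<^sub>0" by (simp add: mult.commute)
  then show "(norm w)\<^sup>2 \<le> R\<^sup>2" unfolding R_sq using lam by (simp only: pos_le_divide_eq)
qed

lemma reg_min_le:
  assumes "valid c" "i \<in> {1..m}" "0 \<le> \<rho>"
  shows "reg \<rho> c i (local_min \<rho> c i) \<le> reg \<rho> c i w"
  using reg_growth[OF assms, of w] lam assms(3)
  by (smt (verit) mult_nonneg_nonneg zero_le_power2 divide_nonneg_pos)

lemma F_local_min_le: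
  assumes "valid c" "i \<in> {1..m}" "0 \<le> \<rho>"
  shows "F c i (local_min \<rho> c i) \<le> V\<^sub>0"
proof -
  have "F c i (local_min \<rho> c i) \<le> reg \<rho> c i (local_min \<rho> c i)" using assms(3) by simp
  also have "\<dots> \<le> reg \<rho> c i 0" by (rule reg_min_le[OF assms])
  also have "\<dots> \<le> V\<^sub>0" using F_zero[OF assms(1,2)] by simp
  finally show ?thesis .
qed

lemma local_min_norm:
  assumes "valid c" "i \<in> {1..m}" "0 \<le> \<rho>" shows "norm (local_min \<rho> c i) \<le> R"
  using order_trans[OF F_nonneg[OF assms(1,2)] F_local_min_le[OF assms]] by (rule norm_le_R)

lemma minimizer_norm: "valid c \<Longrightarrow> norm (minimizer (f c)) \<le> R"
  using order_trans[OF f_nonneg order_trans[OF f_min_le f_zero]] by (intro norm_le_R)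

lemma disco_init_norm:
  assumes "valid c" "0 \<le> \<rho>" shows "norm (disco_init \<rho> m (F c)) \<le> R"
proof -
  have "norm (disco_init \<rho> m (F c)) \<le> (1 / real m) * (\<Sum>i=1..m. norm (local_min \<rho> c i))"
    unfolding disco_init_def using norm_sum[of "\<lambda>i. local_min \<rho> c i" "{1..m}"] by (simp add: divide_right_mono)
  also have "\<dots> \<le> R" by (rule average_le[OF m local_min_norm]) (use assms in auto)
  finally show ?thesis .
qed

text \<open>The regularization terms cancel: the mean square distance of the local minimizers to their
  mean is their mean square norm minus the square norm of the mean.\<close>

lemma f_init_le:
  assumes c: "valid c" and \<rho>: "0 \<le> \<rho>"
  shows "f c (disco_init \<rho> m (F c)) \<le> V\<^sub>0 + G * R"
proof -
  let ?w = "disco_init \<rho> m (F c)"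
  define u where "u i = local_min \<rho> c i" for i
  define A where "A x = (1 / real m) * (\<Sum>i=1..m. x i)" for x :: "nat \<Rightarrow> real"
  have A_mono: "A x \<le> A y" if "\<And>i. i \<in> {1..m} \<Longrightarrow> x i \<le> y i" for x y
    unfolding A_def using that by (intro mult_left_mono sum_mono) auto
  have A_add: "A (\<lambda>i. x i + y i) = A x + A y" "A (\<lambda>i. a * x i) = a * A x" for x y a
    unfolding A_def by (simp_all add: sum.distrib distrib_left sum_distrib_left mult_ac)
  have A_const: "A (\<lambda>i. a) = a" for a unfolding A_def using m by simp
  have var: "A (\<lambda>i. (norm (?w - u i))\<^sup>2) = A (\<lambda>i. (norm (u i))\<^sup>2) - (norm ?w)\<^sup>2"
  proof -
    have w: "?w = (1 / real m) *\<^sub>R (\<Sum>i=1..m. u i)" unfolding disco_init_def u_def ..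
    have "A (\<lambda>i. ?w \<bullet> u i) = ?w \<bullet> ((1 / real m) *\<^sub>R (\<Sum>i=1..m. u i))"
      unfolding A_def by (simp add: inner_sum_right)
    also have "\<dots> = (norm ?w)\<^sup>2" unfolding w[symmetric] power2_norm_eq_inner ..
    finally have *: "A (\<lambda>i. ?w \<bullet> u i) = (norm ?w)\<^sup>2" .
    have "(norm (?w - u i))\<^sup>2 = ((norm ?w)\<^sup>2 + - 2 * (?w \<bullet> u i)) + (norm (u i))\<^sup>2" for i
      by (simp add: power2_norm_eq_inner inner_diff_left inner_diff_right inner_commute[of "u i" ?w])
    then show ?thesis by (simp only: A_add A_const *)
  qed
  have dist: "A (\<lambda>i. norm (?w - u i)) \<le> R"
  proof (rule power2_le_imp_le[OF _ R_nonneg])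
    have "(\<Sum>i=1..m. norm (?w - u i) * 1)\<^sup>2 \<le> (\<Sum>i=1..m. (norm (?w - u i))\<^sup>2) * (\<Sum>i=1..m. 1\<^sup>2)"
      by (rule Cauchy_Schwarz_ineq_sum)
    then have "(A (\<lambda>i. norm (?w - u i)))\<^sup>2 \<le> A (\<lambda>i. (norm (?w - u i))\<^sup>2)"
      unfolding A_def using m by (simp add: power_mult_distrib power2_eq_square field_simps)
    also have "\<dots> \<le> A (\<lambda>i. (norm (u i))\<^sup>2)" unfolding var by simp
    also have "\<dots> \<le> R\<^sup>2" unfolding A_def u_def
      by (intro average_le[OF m] power_mono local_min_norm c \<rho>) auto
    finally show "(A (\<lambda>i. norm (?w - u i)))\<^sup>2 \<le> R\<^sup>2" .
  qed
  have "f c ?w = A (\<lambda>i. F c i ?w)" by (simp add: average_loss_def A_def)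
  also have "\<dots> \<le> A (\<lambda>i. (V\<^sub>0 + (G * norm (?w - u i) + - (lam / 2) * (norm (u i))\<^sup>2)) + lam / 2 * (norm ?w)\<^sup>2)"
  proof (rule A_mono)
    fix i assume i: "i \<in> {1..m}"
    have "(1 / real n) * (\<Sum>j=1..n. \<phi> ?w (c i j) - \<phi> (u i) (c i j)) \<le> G * norm (?w - u i)"
      by (intro average_le[OF n] phi_lipschitz valid_nth[OF c i] disco_init_norm c \<rho>) auto
    then have "F c i ?w - lam / 2 * (norm ?w)\<^sup>2 \<le> (F c i (u i) - lam / 2 * (norm (u i))\<^sup>2) + G * norm (?w - u i)"
      by (simp add: local_loss_def sum_subtractf right_diff_distrib diff_divide_distrib)
    then show "F c i ?w \<le> V\<^sub>0 + (G * norm (?w - u i) + - (lam / 2) * (norm (u i))\<^sup>2) + lam / 2 * (norm ?w)\<^sup>2"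
      using F_local_min_le[OF c i \<rho>] by (simp add: u_def)
  qed
  also have "\<dots> = V\<^sub>0 + (G * A (\<lambda>i. norm (?w - u i)) + - (lam / 2) * A (\<lambda>i. (norm (u i))\<^sup>2)) + lam / 2 * (norm ?w)\<^sup>2"
    by (simp only: A_add A_const)
  also have "\<dots> \<le> V\<^sub>0 + G * R"
  proof -
    have "0 \<le> A (\<lambda>i. (norm (?w - u i))\<^sup>2)" unfolding A_def by (intro mult_nonneg_nonneg sum_nonneg) auto
    then have "lam / 2 * (norm ?w)\<^sup>2 \<le> lam / 2 * A (\<lambda>i. (norm (u i))\<^sup>2)"
      using lam unfolding var by (intro mult_left_mono) auto
    moreover have "G * A (\<lambda>i. norm (?w - u i)) \<le> G * R" using dist G_nonneg by (intro mult_left_mono)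
    ultimately show ?thesis by linarith
  qed
  finally show ?thesis .
qed

text \<open>This is the origin of the radius r: the quadratic lower bound confines the sublevel set
  of a value at most \<open>V\<^sub>0 + G * R\<close>, and all iterates stay in the sublevel set of
  the initial one.\<close>

lemma sublevel_norm_le:
  assumes c: "valid c" and \<rho>: "0 \<le> \<rho>" and w: "f c w \<le> f c (disco_init \<rho> m (F c))"
  shows "norm w \<le> sqrt (2 * V\<^sub>0 / lam + 2 * G / lam * R)"
proof (rule real_le_rsqrt)
  have "lam / 2 * (norm w)\<^sup>2 \<le> V\<^sub>0 + G * R"
    using f_nonneg[OF c, of w] w f_init_le[OF c \<rho>] by linarith
  then show "(norm w)\<^sup>2 \<le> 2 * V\<^sub>0 / lam + 2 * G / lam * R" using lam by (simp add: field_simps)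
qed

text \<open>Each minimizer is inserted into the growth inequality of the other. In the sum all
  common samples cancel, leaving two one-sided Lipschitz estimates of order G / n against lam +
  \<rho> times the squared distance.\<close>

lemma local_min_stable:
  assumes c: "valid c" and c': "valid c'" and i: "i \<in> {1..m}" and \<rho>: "0 \<le> \<rho>"
    and k: "k \<in> {1..n}" and eq: "\<And>j. j \<in> {1..n} \<Longrightarrow> j \<noteq> k \<Longrightarrow> c i j = c' i j"
  shows "norm (local_min \<rho> c' i - local_min \<rho> c i) \<le> 2 * G / ((lam + \<rho>) * real n)"
proof -
  let ?u = "local_min \<rho> c i" and ?u' = "local_min \<rho> c' i"
  let ?N = "norm (?u' - ?u)"
  have diff: "reg \<rho> c i w - reg \<rho> c' i w = (\<phi> w (c i k) - \<phi> w (c' i k)) / real n" for w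
  proof -
    have s: "(\<Sum>j=1..n. \<phi> w (d i j)) = \<phi> w (d i k) + (\<Sum>j\<in>{1..n} - {k}. \<phi> w (d i j))" for d
      using sum.remove[of "{1..n}" k] k by simp
    have "(\<Sum>j\<in>{1..n} - {k}. \<phi> w (c i j)) = (\<Sum>j\<in>{1..n} - {k}. \<phi> w (c' i j))"
      using eq by (intro sum.cong) auto
    then show ?thesis unfolding local_loss_def s by (simp add: add_divide_distrib diff_divide_distrib)
  qed
  have "(lam + \<rho>) * ?N\<^sup>2 \<le> (reg \<rho> c i ?u' - reg \<rho> c' i ?u') - (reg \<rho> c i ?u - reg \<rho> c' i ?u)"
  proof -
    have "k * y \<le> (x' - z) - (x - z')" if "x + k / 2 * y \<le> x'" "z + k / 2 * y \<le> z'" for k x y z x' z' :: real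
      using that by (simp add: field_simps)
    from this[OF reg_growth[OF c i \<rho>] reg_growth[OF c' i \<rho>, of ?u, unfolded norm_minus_commute[of ?u ?u']]]
    show ?thesis .
  qed
  also have "\<dots> = ((\<phi> ?u' (c i k) - \<phi> ?u (c i k)) + (\<phi> ?u (c' i k) - \<phi> ?u' (c' i k))) / real n"
    unfolding diff by (simp add: add_divide_distrib diff_divide_distrib)
  also have "\<dots> \<le> (G * ?N + G * ?N) / real n"
    using phi_lipschitz[OF valid_nth[OF c i k] local_min_norm[OF c' i \<rho>], of ?u]
      phi_lipschitz[OF valid_nth[OF c' i k] local_min_norm[OF c i \<rho>], of ?u']
    by (intro divide_right_mono add_mono) (auto simp: norm_minus_commute)
  finally have *: "?N * ((lam + \<rho>) * ?N) \<le> ?N * (2 * G / real n)"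
    by (simp add: power2_eq_square mult_ac)
  show ?thesis
  proof (cases "?N = 0")
    case True
    then show ?thesis using G_nonneg lam \<rho> by simp
  next
    case False
    then have "(lam + \<rho>) * ?N \<le> 2 * G / real n"
      using * mult_le_cancel_left_pos[of ?N "(lam + \<rho>) * ?N" "2 * G / real n"] by simp
    then have "?N * ((lam + \<rho>) * real n) \<le> 2 * G"
      using n pos_le_divide_eq[of "real n" "(lam + \<rho>) * ?N" "2 * G"] by (simp add: mult_ac)
    moreover have "0 < (lam + \<rho>) * real n" using lam \<rho> n by simp
    ultimately show ?thesis by (simp only: pos_le_divide_eq)
  qed
qed

end


section \<open>Measurability\<close>

lemma dense_sequence:
  obtains d :: "nat \<Rightarrow> 'a :: {second_countable_topology, metric_space}"
  where "\<And>x e. 0 < e \<Longrightarrow> \<exists>i. dist x (d i) < e"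
proof -
  obtain D :: "'a set" where D: "countable D" "\<And>X. open X \<Longrightarrow> X \<noteq> {} \<Longrightarrow> \<exists>d\<in>D. d \<in> X"
    using countable_dense_setE by metis
  have "D \<noteq> {}" using D(2)[of UNIV] by auto
  have "\<exists>i. dist x (from_nat_into D i) < e" if "0 < e" for x e
  proof -
    obtain y where y: "y \<in> D" "y \<in> ball x e" using D(2)[of "ball x e"] \<open>0 < e\<close> by auto
    then obtain i where "from_nat_into D i = y" using from_nat_into_surj[OF D(1)] by blast
    then show ?thesis using y(2) by (auto intro: exI[of _ i])
  qed
  then show ?thesis using that by blast
qed

text \<open>X is approximated by points of a dense sequence, selected measurably by least index; at
  each fixed point the function is measurable, and continuity passes to the limit. Evaluations at
  random iterates rest on this.\<close>

lemma caratheodory_measurable: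
  fixes g :: "'a \<Rightarrow> 'b :: {second_countable_topology, metric_space} \<Rightarrow> 'c :: metric_space"
  assumes g: "\<And>w. (\<lambda>\<xi>. g \<xi> w) \<in> borel_measurable N"
    and cont: "\<And>\<xi>. \<xi> \<in> space N \<Longrightarrow> continuous_on UNIV (g \<xi>)"
    and X[measurable]: "X \<in> borel_measurable N"
  shows "(\<lambda>\<xi>. g \<xi> (X \<xi>)) \<in> borel_measurable N"
proof -
  obtain d :: "nat \<Rightarrow> 'b" where d: "\<And>x e. 0 < e \<Longrightarrow> \<exists>i. dist x (d i) < e" using dense_sequence by blast
  define I where "I k \<xi> = (LEAST i. dist (X \<xi>) (d i) < 1 / real (Suc k))" for k \<xi>
  have I[measurable]: "I k \<in> measurable N (count_space UNIV)" for k
    unfolding I_def by (rule measurable_Least) measurable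
  have near: "dist (X \<xi>) (d (I k \<xi>)) < 1 / real (Suc k)" for k \<xi>
    unfolding I_def by (rule LeastI_ex) (rule d, simp)
  show ?thesis
  proof (rule borel_measurable_LIMSEQ_metric)
    show "(\<lambda>\<xi>. g \<xi> (d (I k \<xi>))) \<in> borel_measurable N" for k
      by (rule measurable_compose_countable[OF g I])
    fix \<xi> assume \<xi>: "\<xi> \<in> space N"
    have "(\<lambda>k. dist (X \<xi>) (d (I k \<xi>))) \<longlonglongrightarrow> 0"
      by (rule tendsto_sandwich[OF _ _ tendsto_const LIMSEQ_inverse_real_of_nat])
        (use near in \<open>auto intro!: always_eventually less_imp_le simp: inverse_eq_divide\<close>)
    then have lim: "(\<lambda>k. d (I k \<xi>)) \<longlonglongrightarrow> X \<xi>" by (subst tendsto_dist_iff) (simp add: dist_commute)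
    have "isCont (g \<xi>) (X \<xi>)" using cont[OF \<xi>] by (simp add: continuous_on_eq_continuous_at)
    then show "(\<lambda>k. g \<xi> (d (I k \<xi>))) \<longlonglongrightarrow> g \<xi> (X \<xi>)"
      using lim by (rule isCont_tendsto_compose)
  qed
qed

lemma borel_measurable_vecI:
  fixes X :: "'a \<Rightarrow> 'b :: euclidean_space ^ 'n"
  assumes "\<And>i. (\<lambda>\<xi>. X \<xi> $ i) \<in> borel_measurable N"
  shows "X \<in> borel_measurable N"
  unfolding borel_measurable_euclidean_space[of X]
proof
  fix b :: "'b ^ 'n" assume "b \<in> Basis"
  then obtain i u where "b = axis i u" by (auto simp: Basis_vec_def)
  then show "(\<lambda>\<xi>. X \<xi> \<bullet> b) \<in> borel_measurable N" using assms[of i] by (simp add: inner_axis)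
qed

lemma borel_measurable_vec_nth [measurable (raw)]:
  fixes X :: "'a \<Rightarrow> 'b :: euclidean_space ^ 'n"
  assumes "X \<in> borel_measurable N"
  shows "(\<lambda>\<xi>. X \<xi> $ i) \<in> borel_measurable N"
  by (rule borel_measurable_continuous_on[OF _ assms]) (intro continuous_intros)

lemma borel_measurable_matrix_vector_mult [measurable (raw)]:
  fixes A :: "'a \<Rightarrow> real ^ 'n ^ 'm"
  assumes [measurable]: "A \<in> borel_measurable N" "x \<in> borel_measurable N"
  shows "(\<lambda>\<xi>. A \<xi> *v x \<xi>) \<in> borel_measurable N"
  by (rule borel_measurable_vecI) (simp add: matrix_vector_mult_def)

lemma borel_measurable_det:
  fixes A :: "'a \<Rightarrow> real ^ 'n ^ 'n"
  assumes [measurable]: "\<And>i j. (\<lambda>\<xi>. A \<xi> $ i $ j) \<in> borel_measurable N"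
  shows "(\<lambda>\<xi>. det (A \<xi>)) \<in> borel_measurable N"
  unfolding det_def by measurable

text \<open>Cramer's rule writes each coordinate as a quotient of determinants, that is, of
  polynomials in measurable entries.\<close>

lemma borel_measurable_matrix_inv:
  fixes A :: "'a \<Rightarrow> real ^ 'n ^ 'n"
  assumes A[measurable]: "A \<in> borel_measurable N" and b[measurable]: "b \<in> borel_measurable N"
    and inv: "\<And>\<xi>. \<xi> \<in> space N \<Longrightarrow> invertible (A \<xi>)"
  shows "(\<lambda>\<xi>. matrix_inv (A \<xi>) *v b \<xi>) \<in> borel_measurable N"
proof (rule borel_measurable_vecI)
  fix k
  let ?B = "\<lambda>\<xi>. \<chi> i j. if j = k then b \<xi> $ i else A \<xi> $ i $ j"
  have "(\<lambda>\<xi>. det (?B \<xi>) / det (A \<xi>)) \<in> borel_measurable N"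
    by (intro borel_measurable_divide borel_measurable_det) auto
  moreover have "(matrix_inv (A \<xi>) *v b \<xi>) $ k = det (?B \<xi>) / det (A \<xi>)" if "\<xi> \<in> space N" for \<xi>
  proof -
    have "det (A \<xi>) \<noteq> 0" using inv[OF that] invertible_det_nz by blast
    from cramer[OF this, THEN iffD1, OF matrix_inv_vector(1)[OF inv[OF that]]]
    show ?thesis by simp
  qed
  ultimately show "(\<lambda>\<xi>. (matrix_inv (A \<xi>) *v b \<xi>) $ k) \<in> borel_measurable N"
    using measurable_cong[of N "\<lambda>\<xi>. (matrix_inv (A \<xi>) *v b \<xi>) $ k" "\<lambda>\<xi>. det (?B \<xi>) / det (A \<xi>)" borel] by blast
qed

text \<open>Along a fixed null sequence, gradients and Hessians become countable limits of
  measurable difference quotients.\<close>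

lemma derivative_sequence:
  assumes "(F has_real_derivative D) (at 0)"
  shows "(\<lambda>k. (F (inverse (real (Suc k))) - F 0) / inverse (real (Suc k))) \<longlonglongrightarrow> D"
proof -
  have "((\<lambda>h. (F (0 + h) - F 0) / h) \<longlongrightarrow> D) (at 0)" using assms unfolding DERIV_def .
  moreover have "filterlim (\<lambda>k. inverse (real (Suc k))) (at 0) sequentially"
    unfolding filterlim_at using LIMSEQ_inverse_real_of_nat by (auto intro!: always_eventually)
  ultimately show ?thesis using filterlim_compose by fastforce
qed

lemma borel_measurable_grad:
  fixes f :: "'a \<Rightarrow> real ^ 'd \<Rightarrow> real"
  assumes f[measurable]: "\<And>w. (\<lambda>\<xi>. f \<xi> w) \<in> borel_measurable N"
    and smooth: "\<And>\<xi>. \<xi> \<in> space N \<Longrightarrow> twice_differentiable (f \<xi>)"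
  shows "(\<lambda>\<xi>. grad (f \<xi>) w) \<in> borel_measurable N"
proof (rule borel_measurable_vecI, rule borel_measurable_LIMSEQ_metric)
  fix i k
  let ?h = "inverse (real (Suc k))"
  show "(\<lambda>\<xi>. (f \<xi> (w + ?h *\<^sub>R axis i 1) - f \<xi> (w + 0 *\<^sub>R axis i 1)) / ?h) \<in> borel_measurable N"
    by measurable
next
  fix i \<xi> assume "\<xi> \<in> space N"
  from derivative_sequence[OF line_derivative(1)[OF smooth[OF this], of w "axis i 1" 0]]
  show "(\<lambda>k. (f \<xi> (w + inverse (real (Suc k)) *\<^sub>R axis i 1) - f \<xi> (w + 0 *\<^sub>R axis i 1)) / inverse (real (Suc k)))
      \<longlonglongrightarrow> grad (f \<xi>) w $ i"
    by (simp add: inner_axis)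
qed

lemma borel_measurable_hess:
  fixes f :: "'a \<Rightarrow> real ^ 'd \<Rightarrow> real"
  assumes f[measurable]: "\<And>w. (\<lambda>\<xi>. f \<xi> w) \<in> borel_measurable N"
    and smooth: "\<And>\<xi>. \<xi> \<in> space N \<Longrightarrow> twice_differentiable (f \<xi>)"
  shows "(\<lambda>\<xi>. hess (f \<xi>) w) \<in> borel_measurable N"
proof (rule borel_measurable_vecI, rule borel_measurable_vecI, rule borel_measurable_LIMSEQ_metric)
  note [measurable] = borel_measurable_grad[OF f smooth]
  fix i j k
  let ?h = "inverse (real (Suc k))"
  show "(\<lambda>\<xi>. (grad (f \<xi>) (w + ?h *\<^sub>R axis j 1) \<bullet> axis i 1 - grad (f \<xi>) (w + 0 *\<^sub>R axis j 1) \<bullet> axis i 1) / ?h)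
      \<in> borel_measurable N"
    by measurable
next
  fix i j \<xi> assume "\<xi> \<in> space N"
  from derivative_sequence[OF line_derivative(2)[OF smooth[OF this], of w "axis j 1" "axis i 1" 0]]
  show "(\<lambda>k. (grad (f \<xi>) (w + inverse (real (Suc k)) *\<^sub>R axis j 1) \<bullet> axis i 1
        - grad (f \<xi>) (w + 0 *\<^sub>R axis j 1) \<bullet> axis i 1) / inverse (real (Suc k))) \<longlonglongrightarrow> hess (f \<xi>) w $ i $ j"
    by (simp add: inner_axis' matrix_vector_mul_component inner_axis)
qed

text \<open>The minimizer is the limit of running minimizers along a dense sequence.\<close>

lemma borel_measurable_minimizer:
  fixes g :: "'a \<Rightarrow> real ^ 'd \<Rightarrow> real"
  assumes g[measurable]: "\<And>w. (\<lambda>\<xi>. g \<xi> w) \<in> borel_measurable N"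
    and cont: "\<And>\<xi>. \<xi> \<in> space N \<Longrightarrow> continuous_on UNIV (g \<xi>)" and c: "0 < c"
    and growth: "\<And>\<xi> w. \<xi> \<in> space N \<Longrightarrow>
      g \<xi> (minimizer (g \<xi>)) + c / 2 * (norm (w - minimizer (g \<xi>)))\<^sup>2 \<le> g \<xi> w"
  shows "(\<lambda>\<xi>. minimizer (g \<xi>)) \<in> borel_measurable N"
proof -
  obtain d :: "nat \<Rightarrow> real ^ 'd" where d: "\<And>x e. 0 < e \<Longrightarrow> \<exists>i. dist x (d i) < e" using dense_sequence by blast
  define Y where "Y = rec_nat (\<lambda>\<xi>. d 0) (\<lambda>k y \<xi>. if g \<xi> (d (Suc k)) < g \<xi> (y \<xi>) then d (Suc k) else y \<xi>)"
  have Y_simps: "Y 0 \<xi> = d 0" "Y (Suc k) \<xi> = (if g \<xi> (d (Suc k)) < g \<xi> (Y k \<xi>) then d (Suc k) else Y k \<xi>)" for k \<xi>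
    by (simp_all add: Y_def)
  have Y[measurable]: "Y k \<in> borel_measurable N" for k
  proof (induction k)
    case (Suc k)
    note [measurable] = Suc caratheodory_measurable[OF g cont Suc]
    have "Y (Suc k) = (\<lambda>\<xi>. if g \<xi> (d (Suc k)) < g \<xi> (Y k \<xi>) then d (Suc k) else Y k \<xi>)"
      by (rule ext) (rule Y_simps)
    then show ?case by simp
  qed (simp add: Y_def)
  have Y_le: "g \<xi> (Y k \<xi>) \<le> g \<xi> (d i)" if "i \<le> k" for i k \<xi>
    using that by (induction k) (auto simp: Y_simps le_Suc_eq intro: order_trans less_imp_le)
  show ?thesis
  proof (rule borel_measurable_LIMSEQ_metric[OF Y])
    fix \<xi> assume \<xi>: "\<xi> \<in> space N"
    let ?x = "minimizer (g \<xi>)"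
    show "(\<lambda>k. Y k \<xi>) \<longlonglongrightarrow> ?x"
    proof (rule metric_LIMSEQ_I)
      fix e :: real assume e: "0 < e"
      have "isCont (g \<xi>) ?x" using cont[OF \<xi>] by (simp add: continuous_on_eq_continuous_at)
      then obtain \<eta> where \<eta>: "0 < \<eta>" "\<And>y. dist y ?x < \<eta> \<Longrightarrow> dist (g \<xi> y) (g \<xi> ?x) < c / 2 * e\<^sup>2"
        using c e unfolding continuous_at_eps_delta by (metis half_gt_zero mult_pos_pos zero_less_power)
      obtain i where "dist ?x (d i) < \<eta>" using d[OF \<eta>(1)] by blast
      then have "dist (d i) ?x < \<eta>" by (simp only: dist_commute)
      from \<eta>(2)[OF this] have i: "g \<xi> (d i) < g \<xi> ?x + c / 2 * e\<^sup>2"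
        unfolding dist_real_def by linarith
      have "dist (Y k \<xi>) ?x < e" if "i \<le> k" for k
      proof -
        have "c / 2 * (norm (Y k \<xi> - ?x))\<^sup>2 < c / 2 * e\<^sup>2"
          using growth[OF \<xi>, of "Y k \<xi>"] Y_le[OF that, of \<xi>] i by linarith
        then have "(norm (Y k \<xi> - ?x))\<^sup>2 < e\<^sup>2" using c by simp
        then show ?thesis using e by (simp add: dist_norm power_less_imp_less_base)
      qed
      then show "\<exists>no. \<forall>k\<ge>no. dist (Y k \<xi>) ?x < e" by blast
    qed
  qed
qed

lemma enat_measurableI:
  fixes X :: "'a \<Rightarrow> enat"
  assumes [measurable]: "\<And>k. Measurable.pred N (\<lambda>\<xi>. X \<xi> \<le> enat k)"
  shows "X \<in> measurable N (count_space UNIV)"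
proof (subst measurable_count_space_eq2_countable, safe)
  fix a :: enat
  have "Measurable.pred N (\<lambda>\<xi>. X \<xi> = a)"
  proof (cases a)
    case (enat k)
    have "X \<xi> = a \<longleftrightarrow> X \<xi> \<le> enat k \<and> (\<forall>j<k. \<not> X \<xi> \<le> enat j)" for \<xi>
    proof (cases "X \<xi>")
      case (enat i)
      have "i = k \<longleftrightarrow> i \<le> k \<and> (\<forall>j<k. \<not> i \<le> j)" by (metis le_less not_le order_refl)
      then show ?thesis using enat \<open>a = _\<close> by simp
    qed (simp add: enat)
    then show ?thesis by simp
  next
    case infinity
    have "X \<xi> = a \<longleftrightarrow> (\<forall>j. \<not> X \<xi> \<le> enat j)" for \<xi>
      unfolding infinity by (cases "X \<xi>") auto
    then show ?thesis by simp
  qed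
  then have "{\<xi> \<in> space N. X \<xi> = a} \<in> sets N" by simp
  moreover have "X -` {a} \<inter> space N = {\<xi> \<in> space N. X \<xi> = a}" by auto
  ultimately show "X -` {a} \<inter> space N \<in> sets N" by simp
qed simp

lemma measurable_count_space_add:
  fixes X Y :: "'a \<Rightarrow> enat"
  assumes "X \<in> measurable N (count_space UNIV)" "Y \<in> measurable N (count_space UNIV)"
  shows "(\<lambda>\<xi>. X \<xi> + Y \<xi>) \<in> measurable N (count_space UNIV)"
proof (rule measurable_compose_countable[OF _ assms(1), where f = "\<lambda>x \<xi>. x + Y \<xi>"])
  show "(\<lambda>\<xi>. i + Y \<xi>) \<in> measurable N (count_space UNIV)" for i
    by (rule measurable_compose[OF assms(2)]) simp
qed

section \<open>Measurability of the inner solver and of the number of rounds\<close>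

context
  fixes N :: "'a measure" and H P :: "'a \<Rightarrow> real ^ 'd ^ 'd" and g :: "'a \<Rightarrow> real ^ 'd" and \<epsilon> :: "'a \<Rightarrow> real"
  assumes H[measurable]: "H \<in> borel_measurable N" and P: "P \<in> borel_measurable N"
    and g[measurable]: "g \<in> borel_measurable N" and \<epsilon>[measurable]: "\<epsilon> \<in> borel_measurable N"
    and inv: "\<And>\<xi>. \<xi> \<in> space N \<Longrightarrow> invertible (P \<xi>)"
begin

lemma pcg_measurable:
  "(\<lambda>\<xi>. fst (pcg (H \<xi>) (P \<xi>) (g \<xi>) t)) \<in> borel_measurable N \<and>
   (\<lambda>\<xi>. fst (snd (pcg (H \<xi>) (P \<xi>) (g \<xi>) t))) \<in> borel_measurable N \<and>
   (\<lambda>\<xi>. fst (snd (snd (pcg (H \<xi>) (P \<xi>) (g \<xi>) t)))) \<in> borel_measurable N \<and>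
   (\<lambda>\<xi>. snd (snd (snd (pcg (H \<xi>) (P \<xi>) (g \<xi>) t)))) \<in> borel_measurable N"
proof (induction t)
  case 0
  show ?case using borel_measurable_matrix_inv[OF P g inv] by simp
next
  case (Suc t)
  define v r s u where "v \<xi> = fst (pcg (H \<xi>) (P \<xi>) (g \<xi>) t)" and "r \<xi> = fst (snd (pcg (H \<xi>) (P \<xi>) (g \<xi>) t))"
    and "s \<xi> = fst (snd (snd (pcg (H \<xi>) (P \<xi>) (g \<xi>) t)))" and "u \<xi> = snd (snd (snd (pcg (H \<xi>) (P \<xi>) (g \<xi>) t)))" for \<xi>
  have [measurable]: "v \<in> borel_measurable N" "r \<in> borel_measurable N" "s \<in> borel_measurable N" "u \<in> borel_measurable N"
    using Suc unfolding v_def[abs_def] r_def[abs_def] s_def[abs_def] u_def[abs_def] by auto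
  define a where "a \<xi> = (r \<xi> \<bullet> s \<xi>) / (u \<xi> \<bullet> (H \<xi> *v u \<xi>))" for \<xi>
  have [measurable]: "a \<in> borel_measurable N" unfolding a_def[abs_def] by measurable
  define r' where "r' \<xi> = r \<xi> - a \<xi> *\<^sub>R (H \<xi> *v u \<xi>)" for \<xi>
  have r'[measurable]: "r' \<in> borel_measurable N" unfolding r'_def[abs_def] by measurable
  define s' where "s' \<xi> = matrix_inv (P \<xi>) *v r' \<xi>" for \<xi>
  have [measurable]: "s' \<in> borel_measurable N"
    unfolding s'_def[abs_def] by (rule borel_measurable_matrix_inv[OF P r' inv])
  have eq: "pcg (H \<xi>) (P \<xi>) (g \<xi>) (Suc t) = (v \<xi> + a \<xi> *\<^sub>R u \<xi>, r' \<xi>, s' \<xi>,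
      s' \<xi> + ((r' \<xi> \<bullet> s' \<xi>) / (r \<xi> \<bullet> s \<xi>)) *\<^sub>R u \<xi>)" for \<xi>
    by (simp add: Let_def v_def r_def s_def u_def a_def r'_def s'_def split: prod.split)
  show ?case unfolding eq fst_conv snd_conv by (intro conjI; measurable)
qed

text \<open>The infimum is at most k exactly if one of finitely many residuals is small, or if the
  gradient vanishes; an empty index set gives infinity and satisfies neither.\<close>

lemma pcg_iterations_measurable:
  "(\<lambda>\<xi>. pcg_iterations (H \<xi>) (P \<xi>) (g \<xi>) (\<epsilon> \<xi>)) \<in> measurable N (count_space UNIV)"
proof (rule enat_measurableI)
  fix k
  have r[measurable]: "(\<lambda>\<xi>. pcg_residual (H \<xi>) (P \<xi>) (g \<xi>) t) \<in> borel_measurable N" for t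
    unfolding pcg_residual_def using pcg_measurable by blast
  have "pcg_iterations (H \<xi>) (P \<xi>) (g \<xi>) (\<epsilon> \<xi>) \<le> enat k \<longleftrightarrow>
      g \<xi> = 0 \<or> (\<exists>t<k. norm (pcg_residual (H \<xi>) (P \<xi>) (g \<xi>) (Suc t)) \<le> \<epsilon> \<xi>)" for \<xi>
  proof (cases "g \<xi> = 0")
    case False
    let ?A = "{t. norm (pcg_residual (H \<xi>) (P \<xi>) (g \<xi>) (Suc t)) \<le> \<epsilon> \<xi>}"
    have it: "pcg_iterations (H \<xi>) (P \<xi>) (g \<xi>) (\<epsilon> \<xi>) = (INF t\<in>?A. enat (Suc t))"
      unfolding pcg_iterations_def using False by (rule if_not_P)
    show ?thesis
    proof (cases "?A = {}")
      case True
      have "(INF t\<in>?A. enat (Suc t)) = \<infinity>" unfolding True by (simp add: Inf_enat_def)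
      moreover have "\<not> (\<exists>t<k. norm (pcg_residual (H \<xi>) (P \<xi>) (g \<xi>) (Suc t)) \<le> \<epsilon> \<xi>)" using True by blast
      ultimately show ?thesis unfolding it using False by simp
    next
      case ne: False
      obtain t where t: "t \<in> ?A" "(INF t\<in>?A. enat (Suc t)) = enat (Suc t)"
        by (rule enat_INF_attained[OF ne])
      have "t \<le> i" if "i \<in> ?A" for i
        using INF_lower[OF that, of "\<lambda>t. enat (Suc t)"] unfolding t(2) by simp
      then have "Suc t \<le> k \<longleftrightarrow> (\<exists>i<k. i \<in> ?A)" using t(1) by (metis Suc_le_eq le_less_trans)
      then show ?thesis unfolding it t(2) using False by simp
    qed
  qed (simp add: pcg_iterations_def)
  then show "Measurable.pred N (\<lambda>\<xi>. pcg_iterations (H \<xi>) (P \<xi>) (g \<xi>) (\<epsilon> \<xi>) \<le> enat k)"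
    by simp
qed

lemma pcg_output_measurable:
  "(\<lambda>\<xi>. pcg_output (H \<xi>) (P \<xi>) (g \<xi>) (\<epsilon> \<xi>)) \<in> borel_measurable N"
  unfolding pcg_output_def
proof (rule measurable_compose_countable[where f = "\<lambda>t \<xi>. pcg_solution (H \<xi>) (P \<xi>) (g \<xi>) t"])
  show "(\<lambda>\<xi>. pcg_solution (H \<xi>) (P \<xi>) (g \<xi>) t) \<in> borel_measurable N" for t
    unfolding pcg_solution_def using pcg_measurable by blast
  show "(\<lambda>\<xi>. the_enat (pcg_iterations (H \<xi>) (P \<xi>) (g \<xi>) (\<epsilon> \<xi>))) \<in> measurable N (count_space UNIV)"
    by (rule measurable_compose[OF pcg_iterations_measurable]) simp
qed

end

text \<open>By induction on the outer steps the iterates are random vectors. The stopping index has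
  countably many values, so the rounds up to it compose measurably.\<close>

lemma disco_rounds_measurable:
  fixes F :: "'a \<Rightarrow> nat \<Rightarrow> real ^ 'd \<Rightarrow> real"
  assumes m: "1 \<le> m"
    and F[measurable]: "\<And>i w. i \<in> {1..m} \<Longrightarrow> (\<lambda>\<xi>. F \<xi> i w) \<in> borel_measurable N"
    and F_smooth: "\<And>\<xi> i. \<xi> \<in> space N \<Longrightarrow> i \<in> {1..m} \<Longrightarrow> twice_differentiable (F \<xi> i)"
    and f_smooth: "\<And>\<xi>. \<xi> \<in> space N \<Longrightarrow> twice_differentiable (average_loss m (F \<xi>))"
    and F_cont: "\<And>\<xi>. \<xi> \<in> space N \<Longrightarrow> continuous_on UNIV (hess (F \<xi> 1))"
    and f_cont: "\<And>\<xi>. \<xi> \<in> space N \<Longrightarrow> continuous_on UNIV (hess (average_loss m (F \<xi>)))"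
    and init: "(\<lambda>\<xi>. disco_init \<rho> m (F \<xi>)) \<in> borel_measurable N"
    and opt: "(\<lambda>\<xi>. minimizer (average_loss m (F \<xi>))) \<in> borel_measurable N"
    and inv: "\<And>\<xi> w. \<xi> \<in> space N \<Longrightarrow> invertible (disco_preconditioner \<mu> (F \<xi>) w)"
  shows "(\<lambda>\<xi>. ennreal_of_enat (disco_rounds lam L \<rho> \<mu> m (F \<xi>) \<epsilon>)) \<in> borel_measurable N"
proof -
  let ?f = "\<lambda>\<xi>. average_loss m (F \<xi>)"
  have f[measurable]: "(\<lambda>\<xi>. ?f \<xi> w) \<in> borel_measurable N" for w
    unfolding average_loss_def using F by measurable
  have one: "1 \<in> {1..m}" using m by simp
  have fX: "(\<lambda>\<xi>. ?f \<xi> (X \<xi>)) \<in> borel_measurable N" if "X \<in> borel_measurable N" for X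
    by (rule caratheodory_measurable[OF f twice_differentiableD(3)[OF f_smooth] that])
  have gX: "(\<lambda>\<xi>. grad (?f \<xi>) (X \<xi>)) \<in> borel_measurable N" if "X \<in> borel_measurable N" for X
    by (rule caratheodory_measurable[OF borel_measurable_grad[OF f f_smooth] twice_differentiableD(4)[OF f_smooth] that])
  have hX: "(\<lambda>\<xi>. hess (?f \<xi>) (X \<xi>)) \<in> borel_measurable N" if "X \<in> borel_measurable N" for X
    by (rule caratheodory_measurable[OF borel_measurable_hess[OF f f_smooth] f_cont that])
  have PX: "(\<lambda>\<xi>. disco_preconditioner \<mu> (F \<xi>) (X \<xi>)) \<in> borel_measurable N" if "X \<in> borel_measurable N" for X
    unfolding disco_preconditioner_def
    by (intro borel_measurable_add borel_measurable_const
        caratheodory_measurable[OF borel_measurable_hess[OF F[OF one] F_smooth[OF _ one]] F_cont that])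
  have tolX: "(\<lambda>\<xi>. disco_tolerance lam L m (F \<xi>) (X \<xi>)) \<in> borel_measurable N" if "X \<in> borel_measurable N" for X
    unfolding disco_tolerance_def using gX[OF that] by measurable
  note X_rules = hX PX gX tolX inv
  have its: "(\<lambda>\<xi>. disco_pcg_iterations lam L \<mu> m (F \<xi>) (X \<xi>)) \<in> measurable N (count_space UNIV)"
    if X: "X \<in> borel_measurable N" for X
    unfolding disco_pcg_iterations_def by (intro pcg_iterations_measurable X_rules X)
  have w: "(\<lambda>\<xi>. disco_iterate lam L \<rho> \<mu> m (F \<xi>) k) \<in> borel_measurable N" for k
  proof (induction k)
    case (Suc k)
    have v: "(\<lambda>\<xi>. disco_direction lam L \<mu> m (F \<xi>) (disco_iterate lam L \<rho> \<mu> m (F \<xi>) k)) \<in> borel_measurable N"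
      unfolding disco_direction_def by (intro pcg_output_measurable X_rules Suc)
    note [measurable] = Suc v hX[OF Suc]
    show ?case by (simp add: Let_def)
  qed (simp add: init)
  have acc: "Measurable.pred N (\<lambda>\<xi>. disco_accurate lam L \<rho> \<mu> m (F \<xi>) \<epsilon> k)" for k
    unfolding disco_accurate_def using fX[OF w] fX[OF opt] by measurable
  note [measurable] = acc
  have "(\<lambda>\<xi>. \<Sum>j<k. 1 + disco_pcg_iterations lam L \<mu> m (F \<xi>) (disco_iterate lam L \<rho> \<mu> m (F \<xi>) j))
      \<in> measurable N (count_space UNIV)" for k
    by (induction k) (auto intro!: measurable_count_space_add its w)
  then have until: "(\<lambda>\<xi>. disco_rounds_until lam L \<rho> \<mu> m (F \<xi>) k) \<in> measurable N (count_space UNIV)" for k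
    unfolding disco_rounds_until_def by (intro measurable_count_space_add) auto
  have rounds: "(\<lambda>\<xi>. disco_rounds_until lam L \<rho> \<mu> m (F \<xi>) (LEAST k. disco_accurate lam L \<rho> \<mu> m (F \<xi>) \<epsilon> k))
      \<in> measurable N (count_space UNIV)"
    by (rule measurable_compose_countable[OF until measurable_Least[OF acc]])
  have ex: "{\<xi> \<in> space N. \<exists>k. disco_accurate lam L \<rho> \<mu> m (F \<xi>) \<epsilon> k} \<in> sets N"
    by measurable
  have "(\<lambda>\<xi>. disco_rounds lam L \<rho> \<mu> m (F \<xi>) \<epsilon>) \<in> measurable N (count_space UNIV)"
    unfolding disco_rounds_def by (rule measurable_If[OF rounds _ ex]) simp
  then show ?thesis by (rule measurable_compose) simp
qed


section \<open>Nets of Euclidean balls\<close>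

text \<open>Volume comparison: the balls of radius \<eta>/2 around the points are disjoint and lie
  in the ball of radius r + \<eta>/2.\<close>

lemma separated_card_le:
  fixes N :: "(real ^ 'd) set"
  assumes N: "finite N" "N \<subseteq> cball 0 r" and \<eta>: "0 < \<eta>"
    and sep: "\<And>v w. v \<in> N \<Longrightarrow> w \<in> N \<Longrightarrow> v \<noteq> w \<Longrightarrow> \<eta> \<le> dist v w" and r: "0 \<le> r"
  shows "real (card N) \<le> (1 + 2 * r / \<eta>) ^ CARD('d)"
proof -
  let ?c = "measure lborel (ball (0 :: real ^ 'd) 1)"
  have vol: "measure lborel (ball v s) = s ^ CARD('d) * ?c" if "0 \<le> s" for v :: "real ^ 'd" and s
    using content_ball_conv_unit_ball[OF that, of v] by simp
  have c: "?c > 0" by (rule content_ball_pos) simp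
  have disj: "disjoint_family_on (\<lambda>v. ball v (\<eta> / 2)) N"
    unfolding disjoint_family_on_def
  proof (intro ballI impI)
    fix v w assume *: "v \<in> N" "w \<in> N" "v \<noteq> w"
    have "dist v x < \<eta> / 2 \<Longrightarrow> dist w x < \<eta> / 2 \<Longrightarrow> False" for x
      using sep[OF *] dist_triangle2[of v w x] by linarith
    then show "ball v (\<eta> / 2) \<inter> ball w (\<eta> / 2) = {}" by auto
  qed
  have "real (card N) * ((\<eta> / 2) ^ CARD('d) * ?c) = (\<Sum>v\<in>N. measure lborel (ball v (\<eta> / 2)))"
    using vol[of "\<eta> / 2"] \<eta> by simp
  also have "\<dots> = measure lborel (\<Union>v\<in>N. ball v (\<eta> / 2))"
    by (rule measure_finite_Union[symmetric, OF N(1) _ disj])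
      (auto simp: less_imp_neq[OF emeasure_lborel_ball_finite, unfolded infinity_ennreal_def])
  also have "\<dots> \<le> measure lborel (ball (0 :: real ^ 'd) (r + \<eta> / 2))"
  proof (rule measure_mono_fmeasurable)
    show "(\<Union>v\<in>N. ball v (\<eta> / 2)) \<subseteq> ball 0 (r + \<eta> / 2)"
    proof
      fix x assume "x \<in> (\<Union>v\<in>N. ball v (\<eta> / 2))"
      then obtain v where v: "v \<in> N" "dist v x < \<eta> / 2" by auto
      then have "dist 0 v \<le> r" using N(2) by auto
      then show "x \<in> ball 0 (r + \<eta> / 2)" using v(2) dist_triangle[of 0 x v] by simp
    qed
  qed (auto simp: fmeasurable_def emeasure_lborel_ball_finite[unfolded infinity_ennreal_def] intro!: borel_open)
  also have "\<dots> = (r + \<eta> / 2) ^ CARD('d) * ?c" using r \<eta> by (intro vol) simp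
  finally have "real (card N) * (\<eta> / 2) ^ CARD('d) \<le> (r + \<eta> / 2) ^ CARD('d)" using c by simp
  also have "r + \<eta> / 2 = (1 + 2 * r / \<eta>) * (\<eta> / 2)" using \<eta> by (simp add: field_simps)
  finally have "real (card N) * (\<eta> / 2) ^ CARD('d) \<le> (1 + 2 * r / \<eta>) ^ CARD('d) * (\<eta> / 2) ^ CARD('d)"
    by (simp only: power_mult_distrib)
  moreover have "0 < (\<eta> / 2) ^ CARD('d)" using \<eta> by simp
  ultimately show ?thesis using mult_le_cancel_right_pos by blast
qed

text \<open>A separated subset of maximal cardinality is a net, since a point far from all its
  members could be added; the cardinality bound makes the maximum exist.\<close>

lemma net_exists:
  assumes r: "0 \<le> r" and \<eta>: "0 < \<eta>"
  obtains N :: "(real ^ 'd) set" where "finite N" "N \<subseteq> cball 0 r"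
    "real (card N) \<le> (1 + 2 * r / \<eta>) ^ CARD('d)"
    "\<And>w. w \<in> cball 0 r \<Longrightarrow> \<exists>v\<in>N. dist v w < \<eta>"
proof -
  define sep where "sep N \<longleftrightarrow> finite N \<and> N \<subseteq> cball (0 :: real ^ 'd) r \<and>
    (\<forall>v\<in>N. \<forall>w\<in>N. v \<noteq> w \<longrightarrow> \<eta> \<le> dist v w)" for N
  let ?B = "(1 + 2 * r / \<eta>) ^ CARD('d)"
  have card: "real (card N) \<le> ?B" if "sep N" for N
    using that unfolding sep_def by (intro separated_card_le \<eta> r) auto
  define Q where "Q k \<longleftrightarrow> (\<exists>N. sep N \<and> card N = k)" for k
  have "Q 0" unfolding Q_def sep_def by (intro exI[of _ "{}"]) auto
  moreover have bound: "k \<le> nat \<lfloor>?B\<rfloor>" if "Q k" for k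
    using card that unfolding Q_def by (metis le_nat_floor)
  ultimately have "Q (Greatest Q)" by (rule GreatestI_nat)
  then obtain N where N: "sep N" "card N = Greatest Q" unfolding Q_def by blast
  have "\<exists>v\<in>N. dist v w < \<eta>" if w: "w \<in> cball 0 r" for w
  proof (rule ccontr)
    assume "\<not> ?thesis"
    then have far: "\<And>v. v \<in> N \<Longrightarrow> \<eta> \<le> dist v w" by (auto simp: not_less)
    then have "w \<notin> N" using \<eta> by force
    have "sep (insert w N)"
      using N(1) w far unfolding sep_def by (auto simp: dist_commute)
    moreover have "card (insert w N) = Suc (Greatest Q)"
      using N \<open>w \<notin> N\<close> unfolding sep_def by simp
    ultimately have "Q (Suc (Greatest Q))" unfolding Q_def by blast
    then have "Suc (Greatest Q) \<le> Greatest Q" using bound by (rule Greatest_le_nat)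
    then show False by simp
  qed
  then show ?thesis using that N(1) card unfolding sep_def by blast
qed


section \<open>The sample\<close>

context erm
begin

text \<open>\<open>Z\<close> is left abstract because these facts are used twice: for the samples on
  the probability space and for the coordinate projections of the product space.\<close>

context
  fixes N :: "'a measure" and Z :: "nat \<Rightarrow> nat \<Rightarrow> 'a \<Rightarrow> 'z"
  assumes Z: "\<And>i j. i \<in> {1..m} \<Longrightarrow> j \<in> {1..n} \<Longrightarrow> Z i j \<in> measurable N S"
begin

lemma valid_Z: "\<xi> \<in> space N \<Longrightarrow> valid (\<lambda>i j. Z i j \<xi>)"
  using Z measurable_space by metis

lemma F_measurable: "i \<in> {1..m} \<Longrightarrow> (\<lambda>\<xi>. F (\<lambda>i j. Z i j \<xi>) i w) \<in> borel_measurable N"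
  unfolding local_loss_def
  by (intro borel_measurable_add borel_measurable_times borel_measurable_const borel_measurable_sum
      measurable_compose[OF Z phi_meas])

lemma f_measurable: "(\<lambda>\<xi>. f (\<lambda>i j. Z i j \<xi>) w) \<in> borel_measurable N"
  unfolding average_loss_def by (intro borel_measurable_times borel_measurable_const borel_measurable_sum F_measurable)

lemma local_min_measurable:
  assumes i: "i \<in> {1..m}" and \<rho>: "0 \<le> \<rho>"
  shows "(\<lambda>\<xi>. local_min \<rho> (\<lambda>i j. Z i j \<xi>) i) \<in> borel_measurable N"
proof (rule borel_measurable_minimizer[where c = "lam + \<rho>"])
  show "(\<lambda>\<xi>. reg \<rho> (\<lambda>i j. Z i j \<xi>) i w) \<in> borel_measurable N" for w
    by (intro borel_measurable_add borel_measurable_const F_measurable i)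
  fix \<xi> assume \<xi>: "\<xi> \<in> space N"
  show "continuous_on UNIV (reg \<rho> (\<lambda>i j. Z i j \<xi>) i)"
    by (intro continuous_intros twice_differentiableD(3)[OF F_smooth(2)[OF valid_Z[OF \<xi>] i]])
  show "reg \<rho> (\<lambda>i j. Z i j \<xi>) i (local_min \<rho> (\<lambda>i j. Z i j \<xi>) i)
      + (lam + \<rho>) / 2 * (norm (w - local_min \<rho> (\<lambda>i j. Z i j \<xi>) i))\<^sup>2 \<le> reg \<rho> (\<lambda>i j. Z i j \<xi>) i w" for w
    by (rule reg_growth[OF valid_Z[OF \<xi>] i \<rho>])
qed (use lam \<rho> in simp)

lemma minimizer_measurable: "(\<lambda>\<xi>. minimizer (f (\<lambda>i j. Z i j \<xi>))) \<in> borel_measurable N"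
  by (rule borel_measurable_minimizer[OF f_measurable _ lam f_growth[OF valid_Z]])
    (use twice_differentiableD(3)[OF f_smooth(2)[OF valid_Z]] in auto)

lemma disco_init_measurable: "0 \<le> \<rho> \<Longrightarrow> (\<lambda>\<xi>. disco_init \<rho> m (F (\<lambda>i j. Z i j \<xi>))) \<in> borel_measurable N"
  unfolding disco_init_def
  by (intro borel_measurable_scaleR borel_measurable_const borel_measurable_sum local_min_measurable)

lemma f_at_measurable:
  assumes "X \<in> borel_measurable N"
  shows "(\<lambda>\<xi>. f (\<lambda>i j. Z i j \<xi>) (X \<xi>)) \<in> borel_measurable N"
  by (rule caratheodory_measurable[OF f_measurable twice_differentiableD(3)[OF f_smooth(2)[OF valid_Z]] assms])

lemma phi_at_measurable:
  assumes "X \<in> borel_measurable N" "k \<in> {1..m}" "j \<in> {1..n}"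
  shows "(\<lambda>\<xi>. \<phi> (X \<xi>) (Z k j \<xi>)) \<in> borel_measurable N"
  by (rule caratheodory_measurable[OF measurable_compose[OF Z[OF assms(2,3)] phi_meas]
        twice_differentiableD(3)[OF phi_smooth[OF measurable_space[OF Z[OF assms(2,3)]]]] assms(1)])

lemma h_measurable:
  assumes "i \<in> {1..m}" "j \<in> {1..n}"
  shows "(\<lambda>\<xi>. h (Z i j \<xi>) w) \<in> borel_measurable N"
proof (rule measurable_compose[OF Z[OF assms], where g = "\<lambda>x. h x w"])
  show "(\<lambda>x. h x w) \<in> borel_measurable S" by (rule borel_measurable_hess[OF phi_meas phi_smooth])
qed

end

lemma phi_bounds: "x \<in> space S \<Longrightarrow> norm w \<le> R \<Longrightarrow> 0 \<le> \<phi> w x \<and> \<phi> w x \<le> V\<^sub>0 + G * R"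
  using phi_nonneg[of x w] phi_zero[of x] phi_lipschitz[of x w 0] mult_left_mono[of "norm w" R G] G_nonneg
  by simp

end

lemma borel_measurable_matrix_mult [measurable (raw)]:
  fixes A B :: "'a \<Rightarrow> real ^ 'n ^ 'n"
  assumes [measurable]: "A \<in> borel_measurable N" "B \<in> borel_measurable N"
  shows "(\<lambda>\<xi>. A \<xi> ** B \<xi>) \<in> borel_measurable N"
  by (rule borel_measurable_vecI, rule borel_measurable_vecI) (simp add: matrix_matrix_mult_def)

section \<open>Exchangeability, stability and the expected initial gap\<close>

locale erm_sample = erm \<phi> S lam V\<^sub>0 G L M m n + prob_space P
  for \<phi> :: "real ^ 'd \<Rightarrow> 'z \<Rightarrow> real" and S :: "'z measure" and lam V\<^sub>0 G L M :: real and m n :: nat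
    and P :: "'a measure" +
  fixes z :: "nat \<Rightarrow> nat \<Rightarrow> 'a \<Rightarrow> 'z" and Q :: "'z measure"
  assumes indep: "indep_vars (\<lambda>_. S) (\<lambda>(i, j). z i j) ({1..m} \<times> {1..n})"
    and ident: "\<And>i j. i \<in> {1..m} \<Longrightarrow> j \<in> {1..n} \<Longrightarrow> distr P S (z i j) = Q"
begin

abbreviation "I \<equiv> {1..m} \<times> {1..n}"
abbreviation "\<Omega> \<equiv> PiM I (\<lambda>_. S)"

text \<open>All samples as one random variable; the restriction to \<open>I\<close> makes its value
  a point of the product space.\<close>

definition "Z \<xi> = (\<lambda>p\<in>I. z (fst p) (snd p) \<xi>)"

lemma z_measurable: "i \<in> {1..m} \<Longrightarrow> j \<in> {1..n} \<Longrightarrow> z i j \<in> measurable P S"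
  using indep unfolding indep_vars_def by fastforce

lemma Z_measurable: "Z \<in> measurable P \<Omega>"
  unfolding Z_def[abs_def] by (rule measurable_restrict) (auto intro: z_measurable)

lemma Z_nth: "i \<in> {1..m} \<Longrightarrow> j \<in> {1..n} \<Longrightarrow> Z \<xi> (i, j) = z i j \<xi>"
  by (simp add: Z_def)

lemma component_measurable: "i \<in> {1..m} \<Longrightarrow> j \<in> {1..n} \<Longrightarrow> (\<lambda>\<omega>. \<omega> (i, j)) \<in> measurable \<Omega> S"
  by (rule measurable_component_singleton) auto

text \<open>Independence and equal laws make the joint law a product of copies of \<open>Q\<close>,
  which reindexing by an injection of \<open>I\<close> into itself preserves. It is applied to
  transpositions of single samples and to exchanges of blocks between two machines.\<close>

lemma exchangeable:
  assumes \<pi>: "inj_on \<pi> I" "\<pi> \<in> I \<rightarrow> I"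
  shows "distr P \<Omega> (\<lambda>\<xi>. \<lambda>p\<in>I. Z \<xi> (\<pi> p)) = distr P \<Omega> Z"
    "(\<lambda>\<xi>. \<lambda>p\<in>I. Z \<xi> (\<pi> p)) \<in> measurable P \<Omega>"
proof -
  have ne: "I \<noteq> {}" using m n by auto
  have one: "1 \<in> {1..m}" "1 \<in> {1..n}" using m n by auto
  have Q: "sets Q = sets S" using ident[OF one] by (metis sets_distr)
  have Q_prob: "prob_space Q" using ident[OF one] prob_space_distr[OF z_measurable[OF one]] by simp
  have "distr P \<Omega> (\<lambda>\<xi>. \<lambda>p\<in>I. (case p of (i, j) \<Rightarrow> z i j) \<xi>) = PiM I (\<lambda>p. distr P S (case p of (i, j) \<Rightarrow> z i j))"
    using indep_vars_iff_distr_eq_PiM'[OF ne, of "\<lambda>(i, j). z i j" "\<lambda>_. S"] indep z_measurable by auto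
  also have "PiM I (\<lambda>p. distr P S (case p of (i, j) \<Rightarrow> z i j)) = PiM I (\<lambda>_. Q)"
    by (rule PiM_cong) (auto simp: ident)
  also have "(\<lambda>\<xi>. \<lambda>p\<in>I. (case p of (i, j) \<Rightarrow> z i j) \<xi>) = Z"
    unfolding Z_def[abs_def] by (intro ext restrict_ext) (auto split: prod.split)
  finally have Z_distr: "distr P \<Omega> Z = PiM I (\<lambda>_. Q)" .
  have sets: "sets (PiM I (\<lambda>_. Q)) = sets \<Omega>" by (rule sets_PiM_cong) (simp_all add: Q)
  let ?\<pi> = "\<lambda>\<omega>. \<lambda>p\<in>I. \<omega> (\<pi> p)"
  have \<pi>_meas: "?\<pi> \<in> measurable \<Omega> \<Omega>"
    by (rule measurable_restrict) (use \<pi>(2) in \<open>auto intro!: measurable_component_singleton\<close>)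
  show "(\<lambda>\<xi>. \<lambda>p\<in>I. Z \<xi> (\<pi> p)) \<in> measurable P \<Omega>"
    using measurable_compose[OF Z_measurable \<pi>_meas] .
  have "distr P \<Omega> (\<lambda>\<xi>. \<lambda>p\<in>I. Z \<xi> (\<pi> p)) = distr (distr P \<Omega> Z) \<Omega> ?\<pi>"
    using distr_distr[OF \<pi>_meas Z_measurable] by (simp add: comp_def)
  also have "\<dots> = distr (PiM I (\<lambda>_. Q)) (PiM I (\<lambda>_. Q)) ?\<pi>"
    unfolding Z_distr by (rule distr_cong[OF refl sets[symmetric] refl])
  also have "\<dots> = PiM I (\<lambda>_. Q)"
    using distr_PiM_reindex[OF _ \<pi>, of "\<lambda>_. Q"] Q_prob by simp
  finally show "distr P \<Omega> (\<lambda>\<xi>. \<lambda>p\<in>I. Z \<xi> (\<pi> p)) = distr P \<Omega> Z" using Z_distr by simp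
qed

abbreviation "conf \<omega> \<equiv> (\<lambda>i j. \<omega> (i, j))"
abbreviation "sample \<xi> \<equiv> (\<lambda>i j. z i j \<xi>)"

lemma sample_valid: "\<xi> \<in> space P \<Longrightarrow> valid (sample \<xi>)"
  by (rule valid_Z[OF z_measurable])

lemma F_cong: "(\<And>j. j \<in> {1..n} \<Longrightarrow> c i j = c' i j) \<Longrightarrow> F c i = F c' i"
  by (rule ext) (simp add: local_loss_def)

lemma F_Z: "i \<in> {1..m} \<Longrightarrow> F (conf (Z \<xi>)) i = F (sample \<xi>) i"
  by (rule F_cong) (simp add: Z_nth)

text \<open>Interchanging the samples (i, j) and (k, j) preserves the law. It turns the foreign
  sample into a training sample of machine i, and the local minimizer into one whose training set
  differs in a single sample; stability bounds the displacement, and the gradient bound G converts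
  it into a difference of losses.\<close>

lemma swap_bound:
  assumes i: "i \<in> {1..m}" and k: "k \<in> {1..m}" and j: "j \<in> {1..n}" and \<rho>: "0 \<le> \<rho>"
  defines "u \<equiv> \<lambda>\<xi>. local_min \<rho> (sample \<xi>) i"
  shows "expectation (\<lambda>\<xi>. \<phi> (u \<xi>) (z k j \<xi>))
    \<le> expectation (\<lambda>\<xi>. \<phi> (u \<xi>) (z i j \<xi>)) + 2 * G\<^sup>2 / ((lam + \<rho>) * real n)"
proof (cases "k = i")
  case True
  then show ?thesis using lam \<rho> by simp
next
  case False
  define \<pi> where "\<pi> = Transposition.transpose (i, j) (k, j)"
  have \<pi>: "inj_on \<pi> I" "\<pi> \<in> I \<rightarrow> I"
    using i k j by (auto simp: \<pi>_def Transposition.transpose_def inj_on_def split: if_splits)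
  let ?h = "\<lambda>\<omega>. \<phi> (local_min \<rho> (conf \<omega>) i) (\<omega> (k, j))"
  let ?Z' = "\<lambda>\<xi>. \<lambda>p\<in>I. Z \<xi> (\<pi> p)"
  have h[measurable]: "?h \<in> borel_measurable \<Omega>"
    by (intro phi_at_measurable[where Z = "\<lambda>i j \<omega>. \<omega> (i, j)"] local_min_measurable component_measurable i k j \<rho>)
  have "expectation (\<lambda>\<xi>. \<phi> (u \<xi>) (z k j \<xi>)) = expectation (\<lambda>\<xi>. ?h (Z \<xi>))"
    by (simp add: F_Z[OF i] Z_nth[OF k j] u_def)
  also have "\<dots> = integral\<^sup>L (distr P \<Omega> Z) ?h" by (rule integral_distr[symmetric, OF Z_measurable h])
  also have "\<dots> = integral\<^sup>L (distr P \<Omega> ?Z') ?h" by (simp only: exchangeable(1)[OF \<pi>])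
  also have "\<dots> = expectation (\<lambda>\<xi>. ?h (?Z' \<xi>))" by (rule integral_distr[OF exchangeable(2)[OF \<pi>] h])
  also have "\<dots> \<le> expectation (\<lambda>\<xi>. \<phi> (u \<xi>) (z i j \<xi>) + 2 * G\<^sup>2 / ((lam + \<rho>) * real n))"
  proof (rule integral_mono')
    have u: "u \<in> borel_measurable P" unfolding u_def by (rule local_min_measurable[OF z_measurable i \<rho>])
    have "integrable P (\<lambda>\<xi>. \<phi> (u \<xi>) (z i j \<xi>))"
    proof (rule integrable_const_bound[where B = "V\<^sub>0 + G * R"])
      show "AE \<xi> in P. norm (\<phi> (u \<xi>) (z i j \<xi>)) \<le> V\<^sub>0 + G * R"
        using phi_bounds[OF valid_nth[OF sample_valid i j] local_min_norm[OF sample_valid i \<rho>]]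
        by (intro AE_I2) (simp add: u_def)
    qed (rule phi_at_measurable[OF z_measurable u i j])
    then show "integrable P (\<lambda>\<xi>. \<phi> (u \<xi>) (z i j \<xi>) + 2 * G\<^sup>2 / ((lam + \<rho>) * real n))" by simp
    fix \<xi> assume \<xi>: "\<xi> \<in> space P"
    have c: "valid (sample \<xi>)" by (rule sample_valid[OF \<xi>])
    have c': "valid (conf (?Z' \<xi>))"
    proof (intro ballI)
      fix a b assume "a \<in> {1..m}" "b \<in> {1..n}"
      then have "?Z' \<xi> (a, b) \<in> space S"
        using measurable_space[OF exchangeable(2)[OF \<pi>] \<xi>] by (auto simp: space_PiM PiE_iff)
      then show "?Z' \<xi> (a, b) \<in> space S" .
    qed
    have kj: "?Z' \<xi> (k, j) = z i j \<xi>" using i k j by (simp add: \<pi>_def Z_nth)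
    have "norm (local_min \<rho> (conf (?Z' \<xi>)) i - u \<xi>) \<le> 2 * G / ((lam + \<rho>) * real n)"
      unfolding u_def
    proof (rule local_min_stable[OF c c' i \<rho> j])
      fix b assume b: "b \<in> {1..n}" "b \<noteq> j"
      then show "sample \<xi> i b = ?Z' \<xi> (i, b)" using i by (simp add: \<pi>_def Transposition.transpose_def Z_nth)
    qed
    then have "G * norm (local_min \<rho> (conf (?Z' \<xi>)) i - u \<xi>) \<le> G * (2 * G / ((lam + \<rho>) * real n))"
      using G_nonneg by (intro mult_left_mono)
    then show "?h (?Z' \<xi>) \<le> \<phi> (u \<xi>) (z i j \<xi>) + 2 * G\<^sup>2 / ((lam + \<rho>) * real n)"
      using phi_lipschitz[OF valid_nth[OF c i j] local_min_norm[OF c' i \<rho>], of "u \<xi>"]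
      unfolding kj by (simp add: power2_eq_square mult_ac)
    show "0 \<le> \<phi> (u \<xi>) (z i j \<xi>) + 2 * G\<^sup>2 / ((lam + \<rho>) * real n)"
      using phi_nonneg[OF valid_nth[OF c i j]] lam \<rho> by simp
  qed
  also have "\<dots> = expectation (\<lambda>\<xi>. \<phi> (u \<xi>) (z i j \<xi>)) + 2 * G\<^sup>2 / ((lam + \<rho>) * real n)"
  proof -
    have "integrable P (\<lambda>\<xi>. \<phi> (u \<xi>) (z i j \<xi>))"
    proof (rule integrable_const_bound[where B = "V\<^sub>0 + G * R"])
      show "AE \<xi> in P. norm (\<phi> (u \<xi>) (z i j \<xi>)) \<le> V\<^sub>0 + G * R"
        using phi_bounds[OF valid_nth[OF sample_valid i j] local_min_norm[OF sample_valid i \<rho>]]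
        by (intro AE_I2) (simp add: u_def)
      show "(\<lambda>\<xi>. \<phi> (u \<xi>) (z i j \<xi>)) \<in> borel_measurable P"
        unfolding u_def by (intro phi_at_measurable z_measurable local_min_measurable i j \<rho>)
    qed
    then show ?thesis by (simp add: prob_space)
  qed
  finally show ?thesis .
qed


text \<open>Convexity passes from the averaged point to the local minimizers, exchangeability
  replaces the global loss by the local one there, local optimality compares with the global
  minimizer, and averaging the local losses at that common point restores the global loss.\<close>

lemma expected_initial_gap:
  assumes \<rho>: "0 \<le> \<rho>"
  defines "w\<^sub>0 \<equiv> \<lambda>\<xi>. disco_init \<rho> m (F (sample \<xi>))" and "x \<equiv> \<lambda>\<xi>. minimizer (f (sample \<xi>))"
  shows "expectation (\<lambda>\<xi>. f (sample \<xi>) (w\<^sub>0 \<xi>) - f (sample \<xi>) (x \<xi>))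
    \<le> \<rho> / 2 * expectation (\<lambda>\<xi>. (norm (x \<xi>))\<^sup>2) + 2 * G\<^sup>2 / ((lam + \<rho>) * real n)"
proof -
  let ?s = "2 * G\<^sup>2 / ((lam + \<rho>) * real n)"
  let ?E = expectation
  let ?f = "\<lambda>\<xi>. f (sample \<xi>)" and ?F = "\<lambda>\<xi>. F (sample \<xi>)"
  define u where "u i \<xi> = local_min \<rho> (sample \<xi>) i" for i \<xi>
  have u_meas: "u i \<in> borel_measurable P" if "i \<in> {1..m}" for i
    unfolding u_def[abs_def] by (intro local_min_measurable z_measurable that \<rho>)
  have u_norm: "norm (u i \<xi>) \<le> R" if "i \<in> {1..m}" "\<xi> \<in> space P" for i \<xi>
    unfolding u_def by (intro local_min_norm sample_valid that \<rho>)
  have x_meas: "x \<in> borel_measurable P" unfolding x_def by (intro minimizer_measurable z_measurable)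
  have x_norm: "norm (x \<xi>) \<le> R" if "\<xi> \<in> space P" for \<xi>
    unfolding x_def by (intro minimizer_norm sample_valid that)
  have w_meas: "w\<^sub>0 \<in> borel_measurable P" unfolding w\<^sub>0_def by (intro disco_init_measurable z_measurable \<rho>)
  have w_norm: "norm (w\<^sub>0 \<xi>) \<le> R" if "\<xi> \<in> space P" for \<xi>
    unfolding w\<^sub>0_def by (intro disco_init_norm sample_valid that \<rho>)
  have phi_int: "integrable P (\<lambda>\<xi>. \<phi> (X \<xi>) (z k j \<xi>))"
    if "X \<in> borel_measurable P" "\<And>\<xi>. \<xi> \<in> space P \<Longrightarrow> norm (X \<xi>) \<le> R" "k \<in> {1..m}" "j \<in> {1..n}" for X k j
  proof (rule integrable_const_bound[where B = "V\<^sub>0 + G * R"])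
    show "AE \<xi> in P. norm (\<phi> (X \<xi>) (z k j \<xi>)) \<le> V\<^sub>0 + G * R"
      using phi_bounds[OF valid_nth[OF sample_valid that(3,4)] that(2)] by (intro AE_I2) simp
  qed (intro phi_at_measurable z_measurable that)
  have sq_int: "integrable P (\<lambda>\<xi>. (norm (X \<xi>))\<^sup>2)"
    if [measurable]: "X \<in> borel_measurable P" and "\<And>\<xi>. \<xi> \<in> space P \<Longrightarrow> norm (X \<xi>) \<le> R" for X :: "'a \<Rightarrow> real ^ 'd"
    by (rule integrable_const_bound[where B = "R\<^sup>2"]) (auto intro!: AE_I2 power_mono that)
  have F_int: "integrable P (\<lambda>\<xi>. ?F \<xi> k (X \<xi>))"
    if "X \<in> borel_measurable P" "\<And>\<xi>. \<xi> \<in> space P \<Longrightarrow> norm (X \<xi>) \<le> R" "k \<in> {1..m}" for X k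
    unfolding local_loss_def using that by (intro Bochner_Integration.integrable_add integrable_mult_right
        Bochner_Integration.integrable_sum phi_int sq_int) auto
  have f_int: "integrable P (\<lambda>\<xi>. ?f \<xi> (X \<xi>))"
    if "X \<in> borel_measurable P" "\<And>\<xi>. \<xi> \<in> space P \<Longrightarrow> norm (X \<xi>) \<le> R" for X
    unfolding average_loss_def using that by (intro integrable_mult_right Bochner_Integration.integrable_sum F_int) auto
  have f_E: "?E (\<lambda>\<xi>. ?f \<xi> (X \<xi>)) = (1 / real m) * (\<Sum>k=1..m. ?E (\<lambda>\<xi>. ?F \<xi> k (X \<xi>)))"
    if "X \<in> borel_measurable P" "\<And>\<xi>. \<xi> \<in> space P \<Longrightarrow> norm (X \<xi>) \<le> R" for X
    unfolding average_loss_def using F_int[OF that] by (subst integral_mult_right_zero, subst Bochner_Integration.integral_sum) auto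
  have F_E: "?E (\<lambda>\<xi>. ?F \<xi> k (X \<xi>)) = (1 / real n) * (\<Sum>j=1..n. ?E (\<lambda>\<xi>. \<phi> (X \<xi>) (z k j \<xi>)))
      + lam / 2 * ?E (\<lambda>\<xi>. (norm (X \<xi>))\<^sup>2)"
    if "X \<in> borel_measurable P" "\<And>\<xi>. \<xi> \<in> space P \<Longrightarrow> norm (X \<xi>) \<le> R" "k \<in> {1..m}" for X k
  proof -
    have i1: "integrable P (\<lambda>\<xi>. \<Sum>j=1..n. \<phi> (X \<xi>) (z k j \<xi>))"
      by (intro Bochner_Integration.integrable_sum phi_int that)
    have i2: "integrable P (\<lambda>\<xi>. (norm (X \<xi>))\<^sup>2)" by (intro sq_int that)
    have "?E (\<lambda>\<xi>. ?F \<xi> k (X \<xi>)) = ?E (\<lambda>\<xi>. (1 / real n) * (\<Sum>j=1..n. \<phi> (X \<xi>) (z k j \<xi>)))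
        + ?E (\<lambda>\<xi>. lam / 2 * (norm (X \<xi>))\<^sup>2)"
      unfolding local_loss_def
      by (rule Bochner_Integration.integral_add) (intro integrable_mult_right i1 i2)+
    also have "?E (\<lambda>\<xi>. (1 / real n) * (\<Sum>j=1..n. \<phi> (X \<xi>) (z k j \<xi>)))
        = (1 / real n) * (\<Sum>j=1..n. ?E (\<lambda>\<xi>. \<phi> (X \<xi>) (z k j \<xi>)))"
      by (subst integral_mult_right_zero, subst Bochner_Integration.integral_sum) (auto intro!: phi_int that)
    finally show ?thesis by (simp only: integral_mult_right_zero)
  qed
  \<comment> \<open>Generalization error of a local minimizer: the loss of every machine k is
    compared with that of machine i sample by sample, each at the cost of the stability
    term.\<close>
  have fu: "?E (\<lambda>\<xi>. ?f \<xi> (u i \<xi>)) \<le> ?E (\<lambda>\<xi>. ?F \<xi> i (u i \<xi>)) + ?s" if i: "i \<in> {1..m}" for i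
  proof -
    have "?E (\<lambda>\<xi>. ?F \<xi> k (u i \<xi>)) \<le> ?E (\<lambda>\<xi>. ?F \<xi> i (u i \<xi>)) + ?s" if k: "k \<in> {1..m}" for k
    proof -
      have "(1 / real n) * (\<Sum>j=1..n. ?E (\<lambda>\<xi>. \<phi> (u i \<xi>) (z k j \<xi>)) - ?E (\<lambda>\<xi>. \<phi> (u i \<xi>) (z i j \<xi>))) \<le> ?s"
      proof (rule average_le[OF n])
        fix j assume j: "j \<in> {1..n}"
        show "?E (\<lambda>\<xi>. \<phi> (u i \<xi>) (z k j \<xi>)) - ?E (\<lambda>\<xi>. \<phi> (u i \<xi>) (z i j \<xi>)) \<le> ?s"
          using swap_bound[OF i k j \<rho>] unfolding u_def by linarith
      qed
      then show ?thesis
        using F_E[of "u i", OF u_meas[OF i] u_norm[OF i] k] F_E[of "u i", OF u_meas[OF i] u_norm[OF i] i]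
        unfolding sum_subtractf right_diff_distrib by linarith
    qed
    from average_le[OF m this] show ?thesis
      using f_E[of "u i", OF u_meas[OF i] u_norm[OF i]] by simp
  qed
  have Fu: "?E (\<lambda>\<xi>. ?F \<xi> i (u i \<xi>)) \<le> ?E (\<lambda>\<xi>. ?F \<xi> i (x \<xi>)) + \<rho> / 2 * ?E (\<lambda>\<xi>. (norm (x \<xi>))\<^sup>2)"
    if i: "i \<in> {1..m}" for i
  proof -
    have "?E (\<lambda>\<xi>. ?F \<xi> i (u i \<xi>)) \<le> ?E (\<lambda>\<xi>. ?F \<xi> i (x \<xi>) + \<rho> / 2 * (norm (x \<xi>))\<^sup>2)"
    proof (rule integral_mono)
      show "integrable P (\<lambda>\<xi>. ?F \<xi> i (u i \<xi>))" by (intro F_int u_meas u_norm i)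
      show "integrable P (\<lambda>\<xi>. ?F \<xi> i (x \<xi>) + \<rho> / 2 * (norm (x \<xi>))\<^sup>2)"
        by (intro Bochner_Integration.integrable_add integrable_mult_right F_int sq_int x_meas x_norm i)
      fix \<xi> assume "\<xi> \<in> space P"
      from reg_min_le[OF sample_valid[OF this] i \<rho>, of "x \<xi>"] \<rho>
      show "?F \<xi> i (u i \<xi>) \<le> ?F \<xi> i (x \<xi>) + \<rho> / 2 * (norm (x \<xi>))\<^sup>2"
        unfolding u_def by (smt (verit) divide_nonneg_pos mult_nonneg_nonneg zero_le_power2)
    qed
    also have "\<dots> = ?E (\<lambda>\<xi>. ?F \<xi> i (x \<xi>)) + ?E (\<lambda>\<xi>. \<rho> / 2 * (norm (x \<xi>))\<^sup>2)"
      by (intro Bochner_Integration.integral_add integrable_mult_right F_int sq_int x_meas x_norm i)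
    finally show ?thesis by (simp only: integral_mult_right_zero)
  qed
  have "?E (\<lambda>\<xi>. ?f \<xi> (w\<^sub>0 \<xi>)) \<le> ?E (\<lambda>\<xi>. (1 / real m) * (\<Sum>i=1..m. ?f \<xi> (u i \<xi>)))"
  proof (rule integral_mono)
    show "integrable P (\<lambda>\<xi>. ?f \<xi> (w\<^sub>0 \<xi>))" by (intro f_int w_meas w_norm)
    show "integrable P (\<lambda>\<xi>. (1 / real m) * (\<Sum>i=1..m. ?f \<xi> (u i \<xi>)))"
      by (intro integrable_mult_right Bochner_Integration.integrable_sum f_int u_meas u_norm)
    fix \<xi> assume "\<xi> \<in> space P"
    from convex_on_sum[of "{1..m}" UNIV "?f \<xi>" "\<lambda>_. 1 / real m" "\<lambda>i. u i \<xi>", OF _ _ f_convex[OF sample_valid[OF this]]]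
    show "?f \<xi> (w\<^sub>0 \<xi>) \<le> (1 / real m) * (\<Sum>i=1..m. ?f \<xi> (u i \<xi>))"
      using m by (simp add: w\<^sub>0_def disco_init_def u_def scaleR_sum_right sum_distrib_left)
  qed
  also have "\<dots> = (1 / real m) * (\<Sum>i=1..m. ?E (\<lambda>\<xi>. ?f \<xi> (u i \<xi>)))"
    by (subst integral_mult_right_zero, subst Bochner_Integration.integral_sum) (auto intro!: f_int u_meas u_norm)
  also have "\<dots> \<le> (1 / real m) * (\<Sum>i=1..m. ?E (\<lambda>\<xi>. ?F \<xi> i (x \<xi>)) + (\<rho> / 2 * ?E (\<lambda>\<xi>. (norm (x \<xi>))\<^sup>2) + ?s))"
  proof (intro mult_left_mono sum_mono)
    fix i assume i: "i \<in> {1..m}"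
    show "?E (\<lambda>\<xi>. ?f \<xi> (u i \<xi>)) \<le> ?E (\<lambda>\<xi>. ?F \<xi> i (x \<xi>)) + (\<rho> / 2 * ?E (\<lambda>\<xi>. (norm (x \<xi>))\<^sup>2) + ?s)"
      using fu[OF i] Fu[OF i] by linarith
  qed simp
  also have "\<dots> = ?E (\<lambda>\<xi>. ?f \<xi> (x \<xi>)) + (\<rho> / 2 * ?E (\<lambda>\<xi>. (norm (x \<xi>))\<^sup>2) + ?s)"
    using f_E[of x, OF x_meas x_norm] m
    by (simp add: sum.distrib distrib_left[of "1 / real m"] add_divide_distrib)
  finally have "?E (\<lambda>\<xi>. ?f \<xi> (w\<^sub>0 \<xi>)) \<le> ?E (\<lambda>\<xi>. ?f \<xi> (x \<xi>)) + (\<rho> / 2 * ?E (\<lambda>\<xi>. (norm (x \<xi>))\<^sup>2) + ?s)" .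
  moreover have "?E (\<lambda>\<xi>. ?f \<xi> (w\<^sub>0 \<xi>) - ?f \<xi> (x \<xi>)) = ?E (\<lambda>\<xi>. ?f \<xi> (w\<^sub>0 \<xi>)) - ?E (\<lambda>\<xi>. ?f \<xi> (x \<xi>))"
    by (intro Bochner_Integration.integral_diff f_int w_meas w_norm x_meas x_norm)
  ultimately show ?thesis by linarith
qed

end


section \<open>Uniform deviation of the Hessians\<close>

lemma symmetric_matrixI:
  fixes A :: "real ^ 'n ^ 'n"
  assumes "\<And>x y. x \<bullet> (A *v y) = y \<bullet> (A *v x)"
  shows "Finite_Cartesian_Product.transpose A = A"
proof -
  have "A $ a $ b = axis a 1 \<bullet> (A *v axis b 1)" for a b
    by (simp add: inner_axis' matrix_vector_mul_component inner_axis)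
  then have "A $ a $ b = A $ b $ a" for a b using assms by metis
  then show ?thesis by (simp add: Finite_Cartesian_Product.transpose_def vec_eq_iff)
qed

lemma mpow_scaleR: "mpow (c *\<^sub>R A) p = c ^ p *\<^sub>R mpow A p"
proof (induction p)
  case (Suc p)
  have "(a *\<^sub>R X) ** (b *\<^sub>R Y) = (a * b) *\<^sub>R (X ** Y)" for a b and X Y :: "real ^ 'n ^ 'n"
    by (simp add: vec_eq_iff matrix_matrix_mult_def sum_distrib_left mult_ac)
  then show ?case by (simp add: Suc)
qed simp

lemma borel_measurable_mpow [measurable (raw)]:
  assumes [measurable]: "A \<in> borel_measurable N"
  shows "(\<lambda>\<xi>. mpow (A \<xi>) p) \<in> borel_measurable N"
  by (induction p) simp_all

context erm
begin

text \<open>The j-th sample of machine 1 is paired with the j-th sample of machine i, so that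
  interchanging the two flips the sign of the matrix.\<close>

definition hess_diff :: "(nat \<Rightarrow> nat \<Rightarrow> 'z) \<Rightarrow> nat \<Rightarrow> real ^ 'd \<Rightarrow> nat \<Rightarrow> real ^ 'd ^ 'd" where
  "hess_diff c i w j = h (c 1 j) w - h (c i j) w"

definition mean_diff :: "(nat \<Rightarrow> nat \<Rightarrow> 'z) \<Rightarrow> nat \<Rightarrow> real ^ 'd \<Rightarrow> real ^ 'd ^ 'd" where
  "mean_diff c i w = (1 / real n) *\<^sub>R (\<Sum>j=1..n. hess_diff c i w j)"

lemma one_in: "1 \<in> {1..m}"
  using m by simp

text \<open>Both Hessians lie between 0 and L - lam as forms, hence the difference is bounded by L -
  lam in modulus; the triangle inequality would lose a factor 2.\<close>

lemma hess_diff: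
  assumes c: "valid c" and i: "i \<in> {1..m}" and j: "j \<in> {1..n}"
  shows "Finite_Cartesian_Product.transpose (hess_diff c i w j) = hess_diff c i w j"
    "norm (hess_diff c i w j *v u) \<le> L * norm u"
proof -
  note S = valid_nth[OF c one_in j] valid_nth[OF c i j]
  have sym: "x \<bullet> (hess_diff c i w j *v y) = y \<bullet> (hess_diff c i w j *v x)" for x y
    using h_sym[OF S(1), of x w y] h_sym[OF S(2), of x w y]
    by (simp add: hess_diff_def matrix_vector_mult_diff_rdistrib inner_diff_right)
  then show "Finite_Cartesian_Product.transpose (hess_diff c i w j) = hess_diff c i w j"
    by (rule symmetric_matrixI)
  show "norm (hess_diff c i w j *v u) \<le> L * norm u"
  proof (rule symmetric_norm_le[OF sym])
    fix x
    have "\<bar>x \<bullet> (hess_diff c i w j *v x)\<bar> \<le> (L - lam) * (norm x)\<^sup>2"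
      using h_nonneg[OF S(1), of x w] h_nonneg[OF S(2), of x w] h_le[OF S(1), of x w] h_le[OF S(2), of x w]
      by (simp add: hess_diff_def matrix_vector_mult_diff_rdistrib inner_diff_right abs_le_iff)
    also have "\<dots> \<le> L * (norm x)\<^sup>2" using lam by (intro mult_right_mono) auto
    finally show "\<bar>x \<bullet> (hess_diff c i w j *v x)\<bar> \<le> L * (norm x)\<^sup>2" .
  qed
qed

lemma mean_diff_form:
  assumes c: "valid c" and i: "i \<in> {1..m}"
  shows "u \<bullet> (mean_diff c i w *v v) = u \<bullet> (hess (F c 1) w *v v) - u \<bullet> (hess (F c i) w *v v)"
  unfolding mean_diff_def inner_sum_matrix F_hess_form[OF c one_in] F_hess_form[OF c i]
  by (simp add: hess_diff_def matrix_vector_mult_diff_rdistrib inner_diff_right sum_subtractf diff_divide_distrib)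

lemma mean_diff_symmetric:
  assumes "valid c" "i \<in> {1..m}"
  shows "Finite_Cartesian_Product.transpose (mean_diff c i w) = mean_diff c i w"
proof (rule symmetric_matrixI)
  show "x \<bullet> (mean_diff c i w *v y) = y \<bullet> (mean_diff c i w *v x)" for x y
    unfolding mean_diff_form[OF assms]
    using F_hess(1)[OF assms(1) one_in, of x w y] F_hess(1)[OF assms, of x w y] by simp
qed

lemma mean_diff_lipschitz:
  assumes c: "valid c" and i: "i \<in> {1..m}"
  shows "\<bar>u \<bullet> (mean_diff c i w *v u) - u \<bullet> (mean_diff c i w' *v u)\<bar> \<le> 2 * (M * norm (w - w')) * (norm u)\<^sup>2"
proof -
  have *: "\<bar>u \<bullet> (hess (F c k) w *v u) - u \<bullet> (hess (F c k) w' *v u)\<bar> \<le> M * norm (w - w') * (norm u)\<^sup>2"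
    if k: "k \<in> {1..m}" for k
  proof -
    have "\<bar>(1 / real n) * (\<Sum>j=1..n. u \<bullet> (h (c k j) w *v u) - u \<bullet> (h (c k j) w' *v u))\<bar>
        \<le> (1 / real n) * (\<Sum>j=1..n. \<bar>u \<bullet> (h (c k j) w *v u) - u \<bullet> (h (c k j) w' *v u)\<bar>)"
      by (simp add: abs_mult divide_right_mono)
    also have "\<dots> \<le> M * norm (w - w') * (norm u)\<^sup>2"
      by (intro average_le[OF n] h_lipschitz valid_nth[OF c k])
    finally show ?thesis
      unfolding F_hess_form[OF c k] by (simp add: sum_subtractf right_diff_distrib diff_divide_distrib)
  qed
  show ?thesis unfolding mean_diff_form[OF c i] using *[OF one_in] *[OF i] by linarith
qed

lemma quadratic_form_scale:
  fixes A :: "real ^ 'n ^ 'n"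
  assumes "\<And>u. norm u = 1 \<Longrightarrow> \<bar>u \<bullet> (A *v u)\<bar> \<le> c"
  shows "\<bar>u \<bullet> (A *v u)\<bar> \<le> c * (norm u)\<^sup>2"
proof (cases "u = 0")
  case False
  let ?v = "(1 / norm u) *\<^sub>R u"
  define x where "x = ?v \<bullet> (A *v ?v)"
  have "x = (1 / norm u) * ((1 / norm u) * (u \<bullet> (A *v u)))"
    unfolding x_def by (simp only: matrix_vector_mult_scaleR inner_scaleR_left inner_scaleR_right)
  then have "u \<bullet> (A *v u) = (norm u)\<^sup>2 * x" using False by (simp add: power2_eq_square)
  moreover have "\<bar>x\<bar> \<le> c" unfolding x_def using False by (intro assms) simp
  ultimately show ?thesis by (simp add: abs_mult mult.commute mult_right_mono)
qed simp

end

context erm_sample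
begin

text \<open>Exchanging the samples of two machines outside \<open>J\<close> preserves the joint law and flips signs in the
  difference, which may therefore be averaged into a Rademacher sum.\<close>

lemma mean_diff_moment:
  assumes i: "i \<in> {1..m}"
  shows "(\<integral>\<^sup>+\<xi>. ennreal ((norm (mpow (mean_diff (sample \<xi>) i w) p))\<^sup>2) \<partial>P)
    \<le> ennreal (real CARD('d) * (real p * (L\<^sup>2 / real n)) ^ p)"
proof -
  define \<pi> where "\<pi> J = (\<lambda>(a, j). if j \<in> J then (a, j) else (Transposition.transpose 1 i a, j))" for J :: "nat set"
  have \<pi>: "inj_on (\<pi> J) I" "\<pi> J \<in> I \<rightarrow> I" for J
    using i m by (auto simp: \<pi>_def Transposition.transpose_def inj_on_def split: if_splits)
  define X where "X \<omega> = ennreal ((norm (mpow (mean_diff (conf \<omega>) i w) p))\<^sup>2)" for \<omega>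
  have diff_meas: "(\<lambda>\<omega>. hess_diff (conf \<omega>) i w j) \<in> borel_measurable \<Omega>" if j: "j \<in> {1..n}" for j
    unfolding hess_diff_def
    by (intro borel_measurable_diff h_measurable[where Z = "\<lambda>i j \<omega>. \<omega> (i, j)"] component_measurable one_in i j)
  have "(\<lambda>\<omega>. mean_diff (conf \<omega>) i w) \<in> borel_measurable \<Omega>"
    unfolding mean_diff_def by (intro borel_measurable_scaleR borel_measurable_const borel_measurable_sum diff_meas)
  then have X[measurable]: "X \<in> borel_measurable \<Omega>" unfolding X_def[abs_def] by measurable
  let ?Z' = "\<lambda>J \<xi>. \<lambda>p\<in>I. Z \<xi> (\<pi> J p)"
  define B where "B J \<xi> = (1 / real n ^ p)\<^sup>2 * (norm (mpow (signed_sum (hess_diff (sample \<xi>) i w) {1..n} J) p))\<^sup>2" for J \<xi>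
  have X_sample: "X (Z \<xi>) = ennreal ((norm (mpow (mean_diff (sample \<xi>) i w) p))\<^sup>2)" for \<xi>
  proof -
    have "mean_diff (conf (Z \<xi>)) i w = mean_diff (sample \<xi>) i w"
      unfolding mean_diff_def hess_diff_def using Z_nth one_in i by (intro arg_cong[where f = "scaleR _"] sum.cong) auto
    then show ?thesis by (simp add: X_def)
  qed
  have X_swap: "X (?Z' J \<xi>) = ennreal (B J \<xi>)" for J \<xi>
  proof -
    have d: "hess_diff (conf (?Z' J \<xi>)) i w j = (if j \<in> J then hess_diff (sample \<xi>) i w j else - hess_diff (sample \<xi>) i w j)"
      if j: "j \<in> {1..n}" for j
      using one_in i j by (cases "i = 1") (auto simp: hess_diff_def \<pi>_def Z_nth)
    have "mean_diff (conf (?Z' J \<xi>)) i w = (1 / real n) *\<^sub>R signed_sum (hess_diff (sample \<xi>) i w) {1..n} J"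
      unfolding mean_diff_def signed_sum_def using d by (intro arg_cong[where f = "scaleR _"] sum.cong) auto
    then show ?thesis by (simp add: X_def B_def mpow_scaleR power_mult_distrib power_divide)
  qed
  have eq: "(\<integral>\<^sup>+\<xi>. X (Z \<xi>) \<partial>P) = (\<integral>\<^sup>+\<xi>. ennreal (B J \<xi>) \<partial>P)" for J
  proof -
    have "(\<integral>\<^sup>+\<xi>. X (Z \<xi>) \<partial>P) = (\<integral>\<^sup>+\<omega>. X \<omega> \<partial>distr P \<Omega> Z)"
      by (rule nn_integral_distr[symmetric, OF Z_measurable]) (simp only: measurable_distr_eq1 X)
    also have "\<dots> = (\<integral>\<^sup>+\<omega>. X \<omega> \<partial>distr P \<Omega> (?Z' J))" by (simp only: exchangeable(1)[OF \<pi>])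
    also have "\<dots> = (\<integral>\<^sup>+\<xi>. X (?Z' J \<xi>) \<partial>P)" by (rule nn_integral_distr[OF exchangeable(2)[OF \<pi>]]) (simp only: measurable_distr_eq1 X)
    finally show ?thesis by (simp only: X_swap)
  qed
  have B_meas: "(\<lambda>\<xi>. ennreal (B J \<xi>)) \<in> borel_measurable P" for J
    unfolding X_swap[symmetric] by (rule measurable_compose[OF exchangeable(2)[OF \<pi>] X])
  let ?K = "real CARD('d) * (real p * (L\<^sup>2 / real n)) ^ p"
  have "2 ^ n * (\<integral>\<^sup>+\<xi>. X (Z \<xi>) \<partial>P) = (\<Sum>J\<in>Pow {1..n}. \<integral>\<^sup>+\<xi>. ennreal (B J \<xi>) \<partial>P)"
    using eq by (simp add: card_Pow)
  also have "\<dots> = (\<integral>\<^sup>+\<xi>. (\<Sum>J\<in>Pow {1..n}. ennreal (B J \<xi>)) \<partial>P)"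
    by (rule nn_integral_sum[symmetric]) (rule B_meas)
  also have "\<dots> \<le> (\<integral>\<^sup>+\<xi>. ennreal (2 ^ n * ?K) \<partial>P)"
  proof (rule nn_integral_mono)
    fix \<xi> assume \<xi>: "\<xi> \<in> space P"
    have "(\<Sum>J\<in>Pow {1..n}. ennreal (B J \<xi>)) = ennreal (\<Sum>J\<in>Pow {1..n}. B J \<xi>)"
      by (rule sum_ennreal) (simp add: B_def)
    also have "\<dots> \<le> ennreal (2 ^ n * ?K)"
    proof (rule ennreal_leI)
      have "(\<Sum>J\<in>Pow {1..n}. B J \<xi>) = (1 / real n ^ p)\<^sup>2 *
          (\<Sum>J\<in>Pow {1..n}. (norm (mpow (signed_sum (hess_diff (sample \<xi>) i w) {1..n} J) p))\<^sup>2)"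
        by (simp add: B_def sum_distrib_left)
      also have "\<dots> \<le> (1 / real n ^ p)\<^sup>2 * (2 ^ card {1..n} * real CARD('d) * (real p * (real (card {1..n}) * L\<^sup>2)) ^ p)"
        using L_pos by (intro mult_left_mono signed_moment_le hess_diff sample_valid \<xi> i) auto
      also have "\<dots> = 2 ^ n * ?K"
      proof -
        have "(1 / real n ^ p)\<^sup>2 * (real n) ^ p = (1 / real n) ^ p"
          using n by (simp add: power2_eq_square power_divide)
        then have "(1 / real n ^ p)\<^sup>2 * (real p * (real n * L\<^sup>2)) ^ p = (1 / real n) ^ p * (real p * L\<^sup>2) ^ p"
          by (simp add: power_mult_distrib mult_ac)
        also have "\<dots> = (real p * (L\<^sup>2 / real n)) ^ p" by (simp add: power_mult_distrib[symmetric])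
        finally show ?thesis by simp
      qed
      finally show "(\<Sum>J\<in>Pow {1..n}. B J \<xi>) \<le> 2 ^ n * ?K" .
    qed
    finally show "(\<Sum>J\<in>Pow {1..n}. ennreal (B J \<xi>)) \<le> ennreal (2 ^ n * ?K)" .
  qed
  also have "\<dots> = ennreal (2 ^ n * ?K)" by (simp add: emeasure_space_1)
  also have "\<dots> = 2 ^ n * ennreal ?K"
    by (subst ennreal_mult) (auto simp: ennreal_power[symmetric] L_pos)
  finally have "2 ^ n * (\<integral>\<^sup>+\<xi>. X (Z \<xi>) \<partial>P) \<le> 2 ^ n * ennreal ?K" .
  then have "(\<integral>\<^sup>+\<xi>. X (Z \<xi>) \<partial>P) \<le> ennreal ?K"
    by (subst (asm) ennreal_mult_le_mult_iff) (auto simp: ennreal_top_eq_mult_iff power_eq_top_ennreal)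
  then show ?thesis by (simp only: X_sample)
qed

end

text \<open>The moment order p is about 4 (a + b), which makes the base at most 1/2. In the
  application exp (2 a) bounds the size of the net and exp b * \<delta> is m d. Since 4 ln 2 >= 8/3
  exceeds the coefficients 2 of a and 1 of b, the power 2^(-p) absorbs both, and b >= ln 2 pays for
  rounding p down.\<close>

lemma net_moment_bound:
  fixes a b \<delta> K :: real
  assumes a: "0 \<le> a" and b: "ln 2 \<le> b" and \<delta>: "0 < \<delta>" and K: "0 \<le> K" "K \<le> exp b * \<delta> * exp (2 * a)"
  defines "p \<equiv> nat \<lfloor>4 * (a + b)\<rfloor>"
  shows "p \<ge> 1" "K * (real p / (8 * (a + b))) ^ p \<le> \<delta>"
proof -
  have ln2: "2 / 3 \<le> ln (2 :: real)" by (rule ln2_ge_two_thirds)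
  have ab: "2 / 3 \<le> a + b" using a b ln2 by linarith
  then show "p \<ge> 1" unfolding p_def by (intro le_nat_floor) simp
  have "real p = of_int \<lfloor>4 * (a + b)\<rfloor>" using ab by (simp add: p_def)
  then have p: "real p \<le> 4 * (a + b)" "4 * (a + b) - 1 \<le> real p" by linarith+
  have "real p / (8 * (a + b)) \<le> 1 / 2" using p(1) ab by (simp add: field_simps)
  then have "(real p / (8 * (a + b))) ^ p \<le> (1 / 2) ^ p" using ab by (intro power_mono) auto
  also have "\<dots> = exp (- ln 2 * real p)" by (simp add: exp_minus exp_of_nat_mult power_one_over inverse_eq_divide mult.commute[of _ "real p"])
  also have "\<dots> \<le> exp (ln 2 - 8 / 3 * (a + b))"
  proof -
    have "ln 2 * (4 * (a + b) - 1) \<le> ln 2 * real p" using p(2) by (intro mult_left_mono) auto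
    moreover have "2 / 3 * (4 * (a + b)) \<le> ln 2 * (4 * (a + b))" using ln2 ab by (intro mult_right_mono) auto
    ultimately show ?thesis by (simp add: algebra_simps)
  qed
  finally have "K * (real p / (8 * (a + b))) ^ p \<le> (exp b * \<delta> * exp (2 * a)) * exp (ln 2 - 8 / 3 * (a + b))"
    using K ab \<delta> by (intro mult_mono) auto
  also have "\<dots> = \<delta> * exp (b + 2 * a + (ln 2 - 8 / 3 * (a + b)))" by (simp add: exp_add)
  also have "\<dots> \<le> \<delta> * 1"
  proof (intro mult_left_mono)
    have "b + 2 * a + (ln 2 - 8 / 3 * (a + b)) \<le> 0" unfolding distrib_left using a b ln2 by linarith
    then show "exp (b + 2 * a + (ln 2 - 8 / 3 * (a + b))) \<le> 1" by simp
  qed (use \<delta> in simp)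
  finally show "K * (real p / (8 * (a + b))) ^ p \<le> \<delta>" by simp
qed

context erm_sample
begin

text \<open>\<open>Y\<close> collects, over machines and net points, the trace moments of the
  Hessian differences in units of \<mu>/2. One half of \<mu> is reserved for the deviation at net
  points, the other for the passage from the net to the ball by Lipschitz continuity. If m = 1 or
  \<mu> = L, the deviation is at most \<mu> deterministically and \<open>Y\<close> may be 0.\<close>

lemma hess_deviation:
  fixes r \<delta> \<mu> :: real
  assumes r: "0 \<le> r" and \<delta>: "0 < \<delta>" "\<delta> < 1" and d: "d = CARD('d)"
    and \<mu>: "\<mu> = min L (sqrt (32 * L\<^sup>2 * real d / real n)
                   * sqrt (ln (1 + r * M * sqrt (2 * real n) / L) + ln (real (m * d) / \<delta>) / real d))"
  obtains Y where "Y \<in> borel_measurable P" "\<And>\<xi>. 0 \<le> Y \<xi>" "(\<integral>\<^sup>+\<xi>. ennreal (Y \<xi>) \<partial>P) \<le> ennreal \<delta>"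
    "\<And>\<xi> w u. \<xi> \<in> space P \<Longrightarrow> norm w \<le> r \<Longrightarrow>
      \<bar>u \<bullet> (hess (F (sample \<xi>) 1) w *v u) - u \<bullet> (hess (f (sample \<xi>)) w *v u)\<bar> \<le> \<mu> * max 1 (Y \<xi>) * (norm u)\<^sup>2"
proof (cases "m = 1 \<or> \<mu> = L")
  case True
  have d0: "0 < d" using d by simp
  have \<mu>0: "0 \<le> \<mu>"
  proof -
    have "1 \<le> m * d" using m d0 by (simp add: Suc_le_eq)
    then have "1 \<le> real (m * d)" by (metis of_nat_1 of_nat_mono)
    then have "1 \<le> real (m * d) / \<delta>" using \<delta> by (simp add: field_simps)
    then show ?thesis unfolding \<mu> using L_pos r M_nonneg by (auto intro!: mult_nonneg_nonneg add_nonneg_nonneg)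
  qed
  have "\<bar>u \<bullet> (hess (F (sample \<xi>) 1) w *v u) - u \<bullet> (hess (f (sample \<xi>)) w *v u)\<bar> \<le> \<mu> * max 1 0 * (norm u)\<^sup>2"
    if \<xi>: "\<xi> \<in> space P" for \<xi> w u
  proof (cases "m = 1")
    case True
    then have "u \<bullet> (hess (f (sample \<xi>)) w *v u) = u \<bullet> (hess (F (sample \<xi>) 1) w *v u)"
      unfolding f_hess_form[OF sample_valid[OF \<xi>]] by simp
    then show ?thesis using \<mu>0 by simp
  next
    case False
    then have "\<mu> = L" using True by simp
    moreover have "\<bar>u \<bullet> (hess (F (sample \<xi>) 1) w *v u) - u \<bullet> (hess (f (sample \<xi>)) w *v u)\<bar> \<le> L * (norm u)\<^sup>2"
    proof -
      have "0 \<le> lam * (norm u)\<^sup>2" using lam by simp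
      then show ?thesis
        using F_hess(2,3)[OF sample_valid[OF \<xi>] one_in, of u w] f_hess(2,3)[OF sample_valid[OF \<xi>], of u w] by linarith
    qed
    ultimately show ?thesis by simp
  qed
  then show ?thesis using that[of "\<lambda>_. 0"] \<delta> by simp
next
  case False
  define q where "q = r * M * sqrt (2 * real n) / L"
  define a where "a = real d * ln (1 + q)"
  define b where "b = ln (real (m * d) / \<delta>)"
  define p where "p = nat \<lfloor>4 * (a + b)\<rfloor>"
  have d0: "0 < d" using d by simp
  have q0: "0 \<le> q" using r M_nonneg L_pos by (simp add: q_def)
  have a0: "0 \<le> a" using q0 by (simp add: a_def)
  \<comment> \<open>In this case m is at least 2, which is what provides b >= ln 2.\<close>
  have "2 \<le> m * d" using False m d0 by (metis Suc_1 Suc_leI le_neq_implies_less mult_le_mono mult.right_neutral One_nat_def)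
  then have "2 \<le> real (m * d)" by (metis of_nat_le_iff of_nat_numeral)
  also have "real (m * d) \<le> real (m * d) / \<delta>"
    using \<delta> mult_left_mono[of \<delta> 1 "real (m * d)"] by (simp only: pos_le_divide_eq) simp
  finally have md: "2 \<le> real (m * d) / \<delta>" .
  then have b2: "ln 2 \<le> b" unfolding b_def by simp
  have ab: "2 / 3 \<le> a + b" using a0 b2 ln2_ge_two_thirds by linarith
  have \<mu>': "\<mu> = sqrt (32 * L\<^sup>2 * real d / real n) * sqrt (ln (1 + q) + b / real d)"
    using False \<mu> unfolding q_def b_def by linarith
  have "ln (1 + q) + b / real d = (a + b) / real d" using d0 by (simp add: a_def field_simps)
  then have \<mu>2: "\<mu>\<^sup>2 = 32 * L\<^sup>2 * (a + b) / real n"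
    unfolding \<mu>' using ab d0 by (simp add: power_mult_distrib)
  have \<mu>0: "0 < \<mu>"
    unfolding \<mu>' \<open>ln (1 + q) + b / real d = (a + b) / real d\<close> using ab d0 L_pos n by simp
  \<comment> \<open>As \<mu> sqrt (2 n) is at least 4 L, a mesh of \<mu> / (4 M) costs a factor of
    at most (1 + q)^2 per dimension; the square becomes exp (2 a).\<close>
  have card_le: "1 + 8 * r * M / \<mu> \<le> (1 + q)\<^sup>2"
  proof -
    have "(4 * L)\<^sup>2 = L\<^sup>2 * 16" by (simp add: power_mult_distrib)
    also have "\<dots> \<le> L\<^sup>2 * (64 * (a + b))" using ab by (intro mult_left_mono) auto
    also have "\<dots> = (\<mu> * sqrt (2 * real n))\<^sup>2" unfolding power_mult_distrib \<mu>2 using n by simp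
    finally have "(4 * L)\<^sup>2 \<le> (\<mu> * sqrt (2 * real n))\<^sup>2" .
    then have "4 * L \<le> \<mu> * sqrt (2 * real n)" by (rule power2_le_imp_le) (use \<mu>0 in simp)
    then have "r * M * (4 * L) \<le> r * M * (\<mu> * sqrt (2 * real n))" using r M_nonneg by (intro mult_left_mono) auto
    then have "8 * r * M / \<mu> \<le> 2 * q" using \<mu>0 L_pos by (simp add: q_def field_simps)
    moreover have "(1 + q)\<^sup>2 = 1 + 2 * q + q\<^sup>2" by (simp add: power2_eq_square algebra_simps)
    ultimately show ?thesis using zero_le_power2[of q] by linarith
  qed
  obtain N :: "(real ^ 'd) set" where N: "finite N" "N \<subseteq> cball 0 r" "real (card N) \<le> (1 + 8 * r * M / \<mu>) ^ d"
    "\<And>w. w \<in> cball 0 r \<Longrightarrow> \<exists>v\<in>N. M * norm (w - v) \<le> \<mu> / 4"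
  proof (cases "M = 0")
    case True
    then show ?thesis using that[of "{0}"] r \<mu>0 by simp
  next
    case False
    then have M: "0 < M" using M_nonneg by simp
    have \<eta>: "0 < \<mu> / (4 * M)" using M \<mu>0 by simp
    obtain N :: "(real ^ 'd) set" where N: "finite N" "N \<subseteq> cball 0 r"
      "real (card N) \<le> (1 + 2 * r / (\<mu> / (4 * M))) ^ CARD('d)" "\<And>w. w \<in> cball 0 r \<Longrightarrow> \<exists>v\<in>N. dist v w < \<mu> / (4 * M)"
      using net_exists[OF r \<eta>] by blast
    show ?thesis
    proof (rule that[OF N(1,2)])
      show "real (card N) \<le> (1 + 8 * r * M / \<mu>) ^ d" using N(3) by (simp add: d mult_ac)
      fix w :: "real ^ 'd" assume "w \<in> cball 0 r"
      then obtain v where v: "v \<in> N" "dist v w < \<mu> / (4 * M)" using N(4) by blast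
      then have "norm (w - v) * (4 * M) < \<mu>"
        using M by (simp only: pos_less_divide_eq[symmetric]) (simp add: dist_norm norm_minus_commute)
      then show "\<exists>v\<in>N. M * norm (w - v) \<le> \<mu> / 4" using v(1) by (intro bexI[of _ v]) (simp add: mult_ac)
    qed
  qed
  define x where "x i v \<xi> = (norm (mpow (mean_diff (sample \<xi>) i v) p))\<^sup>2" for i v \<xi>
  define Y where "Y \<xi> = (2 / \<mu>) ^ (2 * p) * (\<Sum>i=2..m. \<Sum>v\<in>N. x i v \<xi>)" for \<xi>
  have K: "real (card N) * real (m * d) \<le> exp b * \<delta> * exp (2 * a)"
  proof -
    have "real (card N) \<le> ((1 + q)\<^sup>2) ^ d"
      using N(3) card_le power_mono[OF card_le, of d] r M_nonneg \<mu>0 by (smt (verit) divide_nonneg_pos mult_nonneg_nonneg)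
    also have "((1 + q)\<^sup>2) ^ d = (1 + q) ^ (2 * d)" by (rule power_mult[symmetric])
    also have "\<dots> = exp (ln (1 + q)) ^ (2 * d)" using q0 by simp
    also have "\<dots> = exp (real (2 * d) * ln (1 + q))" by (rule exp_of_nat_mult[symmetric])
    also have "real (2 * d) * ln (1 + q) = 2 * a" by (simp add: a_def)
    finally have "real (card N) * real (m * d) \<le> exp (2 * a) * real (m * d)" by (intro mult_right_mono) auto
    also have "exp (2 * a) * real (m * d) = exp (2 * a) * (exp b * \<delta>)"
    proof -
      have "real (m * d) = exp b * \<delta>" using md \<delta> by (simp add: b_def)
      then show ?thesis by (rule arg_cong)
    qed
    also have "\<dots> = exp b * \<delta> * exp (2 * a)" by (simp only: mult_ac)
    finally show ?thesis .
  qed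
  note bound = net_moment_bound[OF a0 b2 \<delta>(1) _ K, folded p_def]
  have p1: "1 \<le> p" using bound(1) by simp
  have x_meas[measurable]: "x i v \<in> borel_measurable P" if "i \<in> {2..m}" for i v
  proof -
    have i: "i \<in> {1..m}" using that by auto
    have "(\<lambda>\<xi>. mean_diff (sample \<xi>) i v) \<in> borel_measurable P"
      unfolding mean_diff_def hess_diff_def
      by (intro borel_measurable_scaleR borel_measurable_const borel_measurable_sum borel_measurable_diff
          h_measurable z_measurable one_in i)
    then show ?thesis unfolding x_def[abs_def] by measurable
  qed
  show ?thesis
  proof (rule that)
    show "Y \<in> borel_measurable P"
      unfolding Y_def[abs_def] by (intro borel_measurable_times borel_measurable_const borel_measurable_sum x_meas)
    show Y0: "0 \<le> Y \<xi>" for \<xi>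
      unfolding Y_def x_def using \<mu>0 by (intro mult_nonneg_nonneg sum_nonneg) auto
    \<comment> \<open>The constant 32 in \<mu> makes the base equal to p / (8 (a + b)), the quantity
      that the choice of p keeps below 1/2.\<close>
    have ineq: "(2 / \<mu>) ^ (2 * p) * (real p * (L\<^sup>2 / real n)) ^ p = (real p / (8 * (a + b))) ^ p"
    proof -
      have "(2 / \<mu>) ^ (2 * p) = (4 / \<mu>\<^sup>2) ^ p" by (simp add: power_mult power_divide)
      moreover have "4 / \<mu>\<^sup>2 * (real p * (L\<^sup>2 / real n)) = real p / (8 * (a + b))"
      proof -
        have "4 / (32 * l * s / k) * (t * (l / k)) = t / (8 * s)" if "0 < l" "0 < s" "0 < k" for l s k t :: real
          using that by (simp add: field_simps)
        then show ?thesis unfolding \<mu>2 using L_pos n ab by simp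
      qed
      ultimately show ?thesis by (simp add: power_mult_distrib[symmetric])
    qed
    have "(\<integral>\<^sup>+\<xi>. ennreal (Y \<xi>) \<partial>P) = ennreal ((2 / \<mu>) ^ (2 * p)) * (\<Sum>i=2..m. \<Sum>v\<in>N. \<integral>\<^sup>+\<xi>. ennreal (x i v \<xi>) \<partial>P)"
    proof -
      have "ennreal (Y \<xi>) = ennreal ((2 / \<mu>) ^ (2 * p)) * (\<Sum>i=2..m. \<Sum>v\<in>N. ennreal (x i v \<xi>))" for \<xi>
        unfolding Y_def using \<mu>0 by (subst ennreal_mult) (auto simp: sum_nonneg x_def)
      then have "(\<integral>\<^sup>+\<xi>. ennreal (Y \<xi>) \<partial>P)
          = (\<integral>\<^sup>+\<xi>. ennreal ((2 / \<mu>) ^ (2 * p)) * (\<Sum>i=2..m. \<Sum>v\<in>N. ennreal (x i v \<xi>)) \<partial>P)" by simp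
      also have "\<dots> = ennreal ((2 / \<mu>) ^ (2 * p)) * (\<integral>\<^sup>+\<xi>. (\<Sum>i=2..m. \<Sum>v\<in>N. ennreal (x i v \<xi>)) \<partial>P)"
        by (intro nn_integral_cmult borel_measurable_sum measurable_compose[OF x_meas measurable_ennreal])
      also have "(\<integral>\<^sup>+\<xi>. (\<Sum>i=2..m. \<Sum>v\<in>N. ennreal (x i v \<xi>)) \<partial>P)
          = (\<Sum>i=2..m. \<integral>\<^sup>+\<xi>. (\<Sum>v\<in>N. ennreal (x i v \<xi>)) \<partial>P)"
        by (intro nn_integral_sum borel_measurable_sum measurable_compose[OF x_meas measurable_ennreal])
      also have "\<dots> = (\<Sum>i=2..m. \<Sum>v\<in>N. \<integral>\<^sup>+\<xi>. ennreal (x i v \<xi>) \<partial>P)"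
        by (intro sum.cong refl nn_integral_sum measurable_compose[OF x_meas measurable_ennreal])
      finally show ?thesis .
    qed
    also have "\<dots> \<le> ennreal ((2 / \<mu>) ^ (2 * p)) * (\<Sum>i=2..m. \<Sum>v\<in>N. ennreal (real CARD('d) * (real p * (L\<^sup>2 / real n)) ^ p))"
      unfolding x_def by (intro mult_left_mono sum_mono mean_diff_moment) auto
    also have "\<dots> = ennreal ((2 / \<mu>) ^ (2 * p) * (real (m - 1) * (real (card N) * (real d * (real p * (L\<^sup>2 / real n)) ^ p))))"
    proof -
      have "card {2..m} = m - 1" by simp
      then show ?thesis
        using \<mu>0 by (simp add: d ennreal_mult[symmetric] ennreal_of_nat_eq_real_of_nat)
    qed
    also have "\<dots> \<le> ennreal \<delta>"
    proof (rule ennreal_leI)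
      have "(2 / \<mu>) ^ (2 * p) * (real (m - 1) * (real (card N) * (real d * (real p * (L\<^sup>2 / real n)) ^ p)))
          = (real (card N) * (real (m - 1) * real d)) * ((2 / \<mu>) ^ (2 * p) * (real p * (L\<^sup>2 / real n)) ^ p)"
        by (simp add: mult_ac)
      also have "\<dots> \<le> (real (card N) * real (m * d)) * (real p / (8 * (a + b))) ^ p"
        unfolding ineq using ab by (intro mult_right_mono mult_left_mono) (auto intro!: mult_right_mono)
      also have "\<dots> \<le> \<delta>" using bound(2) by simp
      finally show "(2 / \<mu>) ^ (2 * p) * (real (m - 1) * (real (card N) * (real d * (real p * (L\<^sup>2 / real n)) ^ p))) \<le> \<delta>" .
    qed
    finally show "(\<integral>\<^sup>+\<xi>. ennreal (Y \<xi>) \<partial>P) \<le> ennreal \<delta>" .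
    fix \<xi> and w u :: "real ^ 'd" assume \<xi>: "\<xi> \<in> space P" and w: "norm w \<le> r"
    have c: "valid (sample \<xi>)" by (rule sample_valid[OF \<xi>])
    obtain v where v: "v \<in> N" "M * norm (w - v) \<le> \<mu> / 4" using N(4)[of w] w by auto
    let ?b = "\<mu> * max 1 (Y \<xi>)"
    have b0: "\<mu> \<le> ?b" "\<mu> * Y \<xi> \<le> ?b" using \<mu>0 by (auto intro!: mult_left_mono)
    have "\<bar>e \<bullet> (mean_diff (sample \<xi>) i w *v e)\<bar> \<le> ?b" if e: "norm e = 1" and i: "i \<in> {2..m}" for e i
    proof -
      have i1: "i \<in> {1..m}" using i by auto
      define y where "y = \<bar>e \<bullet> (mean_diff (sample \<xi>) i v *v e)\<bar>"
      have y0: "0 \<le> y" by (simp add: y_def)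
      have "y ^ (2 * p) \<le> x i v \<xi>"
        unfolding y_def x_def by (rule quadratic_form_power_le[OF mean_diff_symmetric[OF c i1] e])
      also have "x i v \<xi> \<le> (\<Sum>v\<in>N. x i v \<xi>)" using v(1) N(1) by (intro member_le_sum) (auto simp: x_def)
      also have "\<dots> \<le> (\<Sum>i=2..m. \<Sum>v\<in>N. x i v \<xi>)"
        using i by (intro member_le_sum[of i "{2..m}" "\<lambda>i. \<Sum>v\<in>N. x i v \<xi>"]) (auto simp: x_def sum_nonneg)
      finally have "(2 / \<mu>) ^ (2 * p) * y ^ (2 * p) \<le> Y \<xi>"
        unfolding Y_def using \<mu>0 by (intro mult_left_mono) auto
      then have yY: "(2 / \<mu> * y) ^ (2 * p) \<le> Y \<xi>" by (simp only: power_mult_distrib)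
      \<comment> \<open>Either y is at most \<mu>/2, or its ratio to \<mu>/2 exceeds 1 and is
        bounded by its own power of order 2 p, hence by Y.\<close>
      have "y + \<mu> / 2 \<le> ?b"
      proof (cases "2 / \<mu> * y \<le> 1")
        case True
        then have "y \<le> \<mu> / 2" using \<mu>0 by (simp add: field_simps)
        then show ?thesis using b0 by linarith
      next
        case False
        then have "2 / \<mu> * y \<le> (2 / \<mu> * y) ^ (2 * p)"
          using p1 power_increasing[of 1 "2 * p" "2 / \<mu> * y"] by simp
        then have "2 / \<mu> * y \<le> Y \<xi>" using yY by linarith
        then have "2 * y \<le> \<mu> * Y \<xi>" using \<mu>0 by (simp add: field_simps)
        then show ?thesis using b0 by linarith
      qed
      moreover have "\<bar>e \<bullet> (mean_diff (sample \<xi>) i w *v e) - e \<bullet> (mean_diff (sample \<xi>) i v *v e)\<bar> \<le> \<mu> / 2"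
        using mean_diff_lipschitz[OF c i1, of e w v] v(2) e by simp
      ultimately show ?thesis unfolding y_def by linarith
    qed
    then have form: "\<bar>u \<bullet> (mean_diff (sample \<xi>) i w *v u)\<bar> \<le> ?b * (norm u)\<^sup>2" if i: "i \<in> {1..m}" for i
    proof (cases "i = 1")
      case True
      then have "u \<bullet> (mean_diff (sample \<xi>) i w *v u) = 0" using mean_diff_form[OF c i, of u w u] by simp
      then show ?thesis using b0 \<mu>0 by simp
    next
      case False
      then have "i \<in> {2..m}" using i by auto
      then show ?thesis
        using \<open>\<And>i e. norm e = 1 \<Longrightarrow> i \<in> {2..m} \<Longrightarrow> \<bar>e \<bullet> (mean_diff (sample \<xi>) i w *v e)\<bar> \<le> ?b\<close>
        by (intro quadratic_form_scale) blast
    qed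
    have "u \<bullet> (hess (F (sample \<xi>) 1) w *v u) - u \<bullet> (hess (f (sample \<xi>)) w *v u)
        = (1 / real m) * (\<Sum>i=1..m. u \<bullet> (mean_diff (sample \<xi>) i w *v u))"
    proof -
      have "(\<Sum>i=1..m. u \<bullet> (mean_diff (sample \<xi>) i w *v u))
          = (\<Sum>i=1..m. u \<bullet> (hess (F (sample \<xi>) 1) w *v u) - u \<bullet> (hess (F (sample \<xi>) i) w *v u))"
        by (intro sum.cong mean_diff_form c) auto
      then show ?thesis unfolding f_hess_form[OF c] using m by (simp add: sum_subtractf diff_divide_distrib)
    qed
    also have "\<bar>\<dots>\<bar> \<le> (1 / real m) * (\<Sum>i=1..m. \<bar>u \<bullet> (mean_diff (sample \<xi>) i w *v u)\<bar>)"
      by (simp add: abs_mult divide_right_mono)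
    also have "\<dots> \<le> ?b * (norm u)\<^sup>2" by (rule average_le[OF m form])
    finally show "\<bar>u \<bullet> (hess (F (sample \<xi>) 1) w *v u) - u \<bullet> (hess (f (sample \<xi>)) w *v u)\<bar>
        \<le> \<mu> * max 1 (Y \<xi>) * (norm u)\<^sup>2" .
  qed
qed

end


section \<open>The expected number of rounds\<close>

lemma omega_sixth_bounds: "1 / 84 \<le> omega (1 / 6)" "omega (1 / 6) \<le> 1 / 36"
proof -
  show "1 / 84 \<le> omega (1 / 6)" using omega_ge[of "1 / 6"] by (simp add: power2_eq_square)
  have "1 / 6 - (1 / 6)\<^sup>2 \<le> ln (1 + 1 / 6 :: real)" by (rule ln_one_plus_pos_lower_bound) auto
  then show "omega (1 / 6) \<le> 1 / 36" by (simp add: omega_def power2_eq_square)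
qed

text \<open>Bookkeeping of the coefficients: of X / \<omega> the expected gap takes 41/10 and the
  slow regime takes 1, by 2 B <= W, so that 6 suffices; the remaining K X / W of the slow regime is
  covered by the factor 1 + X / W.\<close>

lemma rounds_bound_combine:
  fixes K \<omega> X W lam L \<delta> C \<kappa> \<kappa>' B g :: real
  assumes K: "0 \<le> K" and \<omega>: "0 < \<omega>" and X: "0 \<le> X" and W: "0 < W" and lam: "0 < lam" "lam \<le> L"
    and \<delta>: "\<delta> = X * (sqrt (lam / (4 * L)) / W)" and C: "0 \<le> C" and \<kappa>: "0 \<le> \<kappa>" "\<kappa> \<le> \<kappa>'" "1 \<le> \<kappa>'"
    and B: "B \<le> W / 2" and g: "g \<le> 41 / 20 * X"
  shows "1 + K * (2 + C * \<kappa>) + 2 * (2 + C * \<kappa>) / \<omega> * g + (K + 2 * B / \<omega>) * (sqrt (2 * L / lam) * C) * \<delta>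
    \<le> 1 + ((1 + K) * (1 + X / W) + 6 / \<omega> * X) * (2 + C * \<kappa>')"
proof -
  let ?c = "2 + C * \<kappa>'"
  have c: "2 + C * \<kappa> \<le> ?c" using C \<kappa> by (simp add: mult_left_mono)
  have Cc: "C \<le> ?c" using mult_left_mono[OF \<kappa>(3) C] by simp
  have c0: "0 \<le> ?c" using C Cc by linarith
  have 1: "K * (2 + C * \<kappa>) \<le> K * ?c" using c K by (rule mult_left_mono)
  have 2: "2 * (2 + C * \<kappa>) / \<omega> * g \<le> 41 / 10 * (X / \<omega> * ?c)"
  proof -
    have "2 * (2 + C * \<kappa>) / \<omega> * g \<le> 2 * (2 + C * \<kappa>) / \<omega> * (41 / 20 * X)"
      using g C \<kappa> \<omega> by (intro mult_left_mono) auto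
    also have "\<dots> = 41 / 10 * (X / \<omega> * (2 + C * \<kappa>))"
    proof -
      have "2 * c / w * (41 / 20 * x) = 41 / 10 * (x / w * c)" for c w x :: real by (simp add: field_simps)
      then show ?thesis .
    qed
    also have "\<dots> \<le> 41 / 10 * (X / \<omega> * ?c)" using c X \<omega> by (intro mult_left_mono) auto
    finally show ?thesis .
  qed
  have \<delta>0: "0 \<le> \<delta>" unfolding \<delta> using X W lam by simp
  \<comment> \<open>The factor sqrt (lam / (4 L)) in \<delta> is there to cancel the condition
    number of the slow regime.\<close>
  have \<theta>: "sqrt (2 * L / lam) * \<delta> \<le> X / W"
  proof -
    have "sqrt (2 * L / lam) * sqrt (lam / (4 * L)) = sqrt (1 / 2)"
      unfolding real_sqrt_mult[symmetric] using lam by simp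
    also have "\<dots> \<le> 1" by simp
    finally have "sqrt (2 * L / lam) * sqrt (lam / (4 * L)) * (X / W) \<le> 1 * (X / W)"
      using X W by (intro mult_right_mono) auto
    then show ?thesis unfolding \<delta> by (simp add: mult_ac)
  qed
  have 3: "(K + 2 * B / \<omega>) * (sqrt (2 * L / lam) * C) * \<delta> \<le> K * (X / W) * ?c + X / \<omega> * ?c"
  proof -
    have "(K + 2 * B / \<omega>) * (sqrt (2 * L / lam) * C) * \<delta> = (K + 2 * B / \<omega>) * (C * (sqrt (2 * L / lam) * \<delta>))"
      by (simp add: mult_ac)
    also have "\<dots> \<le> (K + W / \<omega>) * (C * (sqrt (2 * L / lam) * \<delta>))"
    proof (intro mult_right_mono add_left_mono divide_right_mono)
      show "2 * B \<le> W" using B by simp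
    qed (use \<omega> C \<delta>0 lam in auto)
    also have "\<dots> \<le> (K + W / \<omega>) * (?c * (X / W))"
      using \<theta> Cc c0 K W \<omega> \<delta>0 lam by (intro mult_left_mono mult_mono) auto
    also have "\<dots> = K * (X / W) * ?c + X / \<omega> * ?c"
    proof -
      have "(K + W / \<omega>) * (c * (X / W)) = K * (X / W) * c + X / \<omega> * c" for c
        using W \<omega> by (simp add: field_simps)
      then show ?thesis .
    qed
    finally show ?thesis .
  qed
  have "((1 + K) * (1 + X / W) + 6 / \<omega> * X) * ?c
      = K * ?c + K * (X / W) * ?c + 6 * (X / \<omega> * ?c) + (1 + X / W) * ?c"
  proof -
    have "((1 + K) * (1 + a) + 6 * e) * c = K * c + K * a * c + 6 * (e * c) + (1 + a) * c" for a e c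
      by (simp add: algebra_simps)
    moreover have "6 / \<omega> * X = 6 * (X / \<omega>)" by simp
    ultimately show ?thesis by metis
  qed
  moreover have "0 \<le> X / \<omega> * ?c" "0 \<le> (1 + X / W) * ?c" using X W \<omega> c0 by auto
  moreover have "1 + x + y + z \<le> 1 + t"
    if "t = a + b + 6 * c + e" "0 \<le> c" "0 \<le> e" "x \<le> a" "y \<le> 41 / 10 * c" "z \<le> b + c" for x y z t a b c e :: real
    using that by linarith
  ultimately show ?thesis using 1 2 3 by blast
qed

text \<open>As 2 omega(1/6) is at most 1/18, hence below 1/4, the binary logarithm lies at least 2
  below that of 1/\<epsilon>; this absorbs the leading 1 and the rounding. If the ceiling vanishes,
  \<epsilon> <= 1/2 keeps ln (1/\<epsilon>) above 2/3.\<close>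

lemma iteration_count_le:
  assumes \<epsilon>: "0 < \<epsilon>" "\<epsilon> \<le> 1 / 2"
  shows "1 + real (nat \<lceil>log 2 (2 * omega (1 / 6) / \<epsilon>)\<rceil>) \<le> 2 * ln (1 / \<epsilon>)"
proof -
  have "ln 2 \<le> ln (1 / \<epsilon>)" using \<epsilon> by (simp add: field_simps)
  then have l: "2 / 3 \<le> ln (1 / \<epsilon>)" using ln2_ge_two_thirds by linarith
  let ?l = "log 2 (2 * omega (1 / 6) / \<epsilon>)"
  show ?thesis
  proof (cases "?l \<le> 0")
    case True
    then have "nat \<lceil>?l\<rceil> = 0" by (simp add: ceiling_le_iff)
    then show ?thesis using l by simp
  next
    case False
    have "real (nat \<lceil>?l\<rceil>) \<le> ?l + 1" using False by linarith
    also have "?l \<le> log 2 ((1 / \<epsilon>) / 2 ^ 2)"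
      using omega_sixth_bounds omega_sixth_pos \<epsilon> by (subst log_le_cancel_iff) (auto simp: field_simps)
    also have "\<dots> = (ln (1 / \<epsilon>) - 2 * ln 2) / ln 2"
    proof -
      have "ln ((1 / \<epsilon>) / 2 ^ 2) = ln (1 / \<epsilon>) - ln (2 ^ 2)" using \<epsilon> by (subst ln_div) auto
      also have "ln (2 ^ 2 :: real) = 2 * ln 2" using ln_realpow[of 2 2] by simp
      finally show ?thesis unfolding log_def by (rule arg_cong)
    qed
    also have "\<dots> = ln (1 / \<epsilon>) / ln 2 - 2" by (simp add: diff_divide_distrib)
    also have "ln (1 / \<epsilon>) / ln 2 \<le> ln (1 / \<epsilon>) / (2 / 3)"
      using l ln2_ge_two_thirds by (intro divide_left_mono) auto
    finally show ?thesis using l by simp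
  qed
qed

text \<open>The hidden constant: 6 / omega(1/6) <= 504 bounds the first factor, the second costs
  7/2, their product is 1764, and the margin up to 2000 absorbs the leading 1. The nested roots turn
  d, n and \<open>C\<^sub>3\<close> into fourth roots.\<close>

lemma rounds_bound_simplified:
  fixes X \<theta> lam L C\<^sub>2 C\<^sub>3 \<epsilon> A :: real and d n :: nat
  assumes \<epsilon>: "0 < \<epsilon>" "\<epsilon> \<le> 1 / 2" and X: "0 \<le> X" and \<theta>: "0 \<le> \<theta>" and lam: "0 < lam" "lam \<le> L"
    and C2: "2 \<le> C\<^sub>2" and C3: "0 \<le> C\<^sub>3" and n: "1 \<le> n" and A: "0 \<le> A" "A \<le> 2 * ln (1 / \<epsilon>)"
  shows "1 + (A * (1 + \<theta>) + 6 / omega (1 / 6) * X) * (2 + C\<^sub>2 * sqrt (1 + 2 * sqrt (32 * L\<^sup>2 * real d * C\<^sub>3 / (lam\<^sup>2 * real n))))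
    \<le> 2000 * (C\<^sub>2 * (1 + C\<^sub>3) powr (1 / 4) * (1 + \<theta>))
        * ((ln (1 / \<epsilon>) + X) * (1 + sqrt L * real d powr (1 / 4) / (sqrt lam * real n powr (1 / 4))))"
proof -
  define s where "s = (1 + C\<^sub>3) powr (1 / 4)"
  define t where "t = sqrt L * real d powr (1 / 4) / (sqrt lam * real n powr (1 / 4))"
  define l where "l = ln (1 / \<epsilon>)"
  have quarter: "(x powr (1 / 4)) ^ 4 = x" if "0 \<le> x" for x :: real
    using that by (cases "x = 0") (simp_all add: powr_power)
  have fourth: "(sqrt x) ^ 4 = x\<^sup>2" if "0 \<le> x" for x :: real
    using that power_mult[of "sqrt x" 2 2] by simp
  have s4: "s ^ 4 = 1 + C\<^sub>3" using C3 by (simp add: s_def quarter)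
  have s1: "1 \<le> s" unfolding s_def using C3 by (intro ge_one_powr_ge_zero) auto
  have t0: "0 \<le> t" using lam by (simp add: t_def)
  have t4: "t ^ 4 = L\<^sup>2 * real d / (lam\<^sup>2 * real n)"
    using lam by (simp add: t_def power_divide power_mult_distrib quarter fourth)
  have l: "2 / 3 \<le> l"
  proof -
    have "ln 2 \<le> ln (1 / \<epsilon>)" using \<epsilon> by (simp add: field_simps)
    then show ?thesis using ln2_ge_two_thirds unfolding l_def by linarith
  qed
  have "32 * L\<^sup>2 * real d * C\<^sub>3 / (lam\<^sup>2 * real n) = 32 * (t ^ 4 * C\<^sub>3)" by (simp add: t4)
  \<comment> \<open>32 is raised to the square 36, so that the inner root becomes 6 (t s)^2.\<close>
  also have "\<dots> \<le> 36 * (t ^ 4 * s ^ 4)" using C3 t0 by (intro mult_mono mult_left_mono) (auto simp: s4)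
  also have "\<dots> = (6 * (t * s)\<^sup>2)\<^sup>2" by (simp add: power_mult_distrib power_mult[symmetric])
  finally have "sqrt (32 * L\<^sup>2 * real d * C\<^sub>3 / (lam\<^sup>2 * real n)) \<le> 6 * (t * s)\<^sup>2"
    by (intro real_le_lsqrt) auto
  then have "1 + 2 * sqrt (32 * L\<^sup>2 * real d * C\<^sub>3 / (lam\<^sup>2 * real n)) \<le> 1 + 12 * (t * s)\<^sup>2" by simp
  \<comment> \<open>The factor 7/2 is chosen because its square 49/4 exceeds 12.\<close>
  also have "\<dots> \<le> (s * (1 + 7 / 2 * t))\<^sup>2"
  proof -
    have "(s * (1 + 7 / 2 * t))\<^sup>2 = s\<^sup>2 + 7 * (t * s\<^sup>2) + 49 / 4 * (t * s)\<^sup>2"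
      by (simp add: power2_eq_square algebra_simps)
    moreover have "1 \<le> s\<^sup>2" using s1 by simp
    moreover have "0 \<le> t * s\<^sup>2" "0 \<le> (t * s)\<^sup>2" using t0 by auto
    ultimately show ?thesis by linarith
  qed
  finally have root: "sqrt (1 + 2 * sqrt (32 * L\<^sup>2 * real d * C\<^sub>3 / (lam\<^sup>2 * real n))) \<le> s * (1 + 7 / 2 * t)"
    using s1 t0 by (intro real_le_lsqrt) auto
  have C2s: "2 \<le> C\<^sub>2 * s" using mult_mono[of 2 C\<^sub>2 1 s] C2 s1 by simp
  have "2 + C\<^sub>2 * sqrt (1 + 2 * sqrt (32 * L\<^sup>2 * real d * C\<^sub>3 / (lam\<^sup>2 * real n))) \<le> 2 + C\<^sub>2 * (s * (1 + 7 / 2 * t))"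
    using root C2 by (intro add_left_mono mult_left_mono) auto
  also have "\<dots> = 2 + C\<^sub>2 * s + 7 / 2 * (C\<^sub>2 * s * t)" by (simp add: algebra_simps)
  also have "\<dots> \<le> 7 / 2 * (C\<^sub>2 * s) + 7 / 2 * (C\<^sub>2 * s * t)" using C2s by simp
  also have "\<dots> = 7 / 2 * (C\<^sub>2 * s * (1 + t))" by (simp add: algebra_simps)
  finally have f2: "2 + C\<^sub>2 * sqrt (1 + 2 * sqrt (32 * L\<^sup>2 * real d * C\<^sub>3 / (lam\<^sup>2 * real n))) \<le> 7 / 2 * (C\<^sub>2 * s * (1 + t))" .
  have f1: "A * (1 + \<theta>) + 6 / omega (1 / 6) * X \<le> 504 * ((1 + \<theta>) * (l + X))"
  proof -
    have "6 / omega (1 / 6) \<le> 504" using omega_sixth_bounds omega_sixth_pos by (simp add: field_simps)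
    then have "6 / omega (1 / 6) * X \<le> 504 * X" using X by (rule mult_right_mono)
    also have "\<dots> \<le> 504 * ((1 + \<theta>) * X)" using X \<theta> by (simp add: algebra_simps)
    finally have "6 / omega (1 / 6) * X \<le> 504 * ((1 + \<theta>) * X)" .
    moreover have "A * (1 + \<theta>) \<le> (504 * l) * (1 + \<theta>)"
      using A l \<theta> unfolding l_def by (intro mult_right_mono) auto
    ultimately show ?thesis by (simp add: algebra_simps)
  qed
  have "(A * (1 + \<theta>) + 6 / omega (1 / 6) * X) * (2 + C\<^sub>2 * sqrt (1 + 2 * sqrt (32 * L\<^sup>2 * real d * C\<^sub>3 / (lam\<^sup>2 * real n))))
      \<le> (504 * ((1 + \<theta>) * (l + X))) * (7 / 2 * (C\<^sub>2 * s * (1 + t)))"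
  proof (rule mult_mono[OF f1 f2])
    show "0 \<le> 504 * ((1 + \<theta>) * (l + X))" using \<theta> l X by simp
    have "0 \<le> sqrt (1 + 2 * sqrt (32 * L\<^sup>2 * real d * C\<^sub>3 / (lam\<^sup>2 * real n)))" using C3 by simp
    then show "0 \<le> 2 + C\<^sub>2 * sqrt (1 + 2 * sqrt (32 * L\<^sup>2 * real d * C\<^sub>3 / (lam\<^sup>2 * real n)))"
      using C2 by simp
  qed
  also have "\<dots> = 1764 * (C\<^sub>2 * s * (1 + \<theta>) * ((l + X) * (1 + t)))"
  proof -
    have "(504 * (u * v)) * (7 / 2 * (w * x)) = 1764 * (w * u * (v * x))" for u v w x :: real by simp
    then show ?thesis .
  qed
  also have "1 + \<dots> \<le> 2000 * (C\<^sub>2 * s * (1 + \<theta>) * ((l + X) * (1 + t)))"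
  proof -
    have "2 * (2 / 3) \<le> (C\<^sub>2 * s * (1 + \<theta>)) * ((l + X) * (1 + t))"
    proof (rule mult_mono)
      have "2 * 1 \<le> C\<^sub>2 * s * (1 + \<theta>)" using C2s \<theta> by (intro mult_mono) auto
      then show "2 \<le> C\<^sub>2 * s * (1 + \<theta>)" by simp
      have "(2 / 3) * 1 \<le> (l + X) * (1 + t)" using l X t0 by (intro mult_mono) auto
      then show "2 / 3 \<le> (l + X) * (1 + t)" by simp
    qed (use C2s \<theta> in auto)
    then show ?thesis by linarith
  qed
  finally show ?thesis unfolding s_def t_def l_def by (simp only: mult.assoc add_left_mono)
qed

context erm_sample
begin

text \<open>For y <= 1 the preconditioner dominates the Hessian and is dominated by 1 + 2 \<mu> /
  lam times it. For y > 1 the preconditioner is at most 2 L and the Hessian at most y times the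
  preconditioner. The sum of the two roots covers both regimes, and sqrt y <= y makes it linear in
  y, so that the first moment of \<open>Y\<close> suffices later.\<close>

lemma rounds_le:
  assumes \<xi>: "\<xi> \<in> space P" and sc: "standard_self_concordant (f (sample \<xi>))"
    and \<rho>: "0 \<le> \<rho>" and \<mu>: "0 < \<mu>" "\<mu> \<le> L" and \<epsilon>: "0 < \<epsilon>" and y: "0 \<le> y"
    and dev: "\<And>w u. norm w \<le> sqrt (2 * V\<^sub>0 / lam + 2 * G / lam * R) \<Longrightarrow>
      \<bar>u \<bullet> (hess (F (sample \<xi>) 1) w *v u) - u \<bullet> (hess (f (sample \<xi>)) w *v u)\<bar> \<le> \<mu> * max 1 y * (norm u)\<^sup>2"
  defines "g \<equiv> f (sample \<xi>) (disco_init \<rho> m (F (sample \<xi>))) - f (sample \<xi>) (minimizer (f (sample \<xi>)))"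
    and "K \<equiv> real (nat \<lceil>log 2 (2 * omega (1 / 6) / \<epsilon>)\<rceil>)"
  shows "ennreal_of_enat (disco_rounds lam L \<rho> \<mu> m (F (sample \<xi>)) \<epsilon>)
    \<le> ennreal (1 + (K + 2 * g / omega (1 / 6))
        * (2 + (sqrt (1 + 2 * \<mu> / lam) + sqrt (2 * L / lam) * y) * ln (2 * L / (pcg_beta * lam))))"
proof -
  let ?c = "sample \<xi>"
  let ?P = "disco_preconditioner \<mu> (F ?c)"
  have c: "valid ?c" by (rule sample_valid[OF \<xi>])
  interpret self_concordant_problem "f ?c" lam L
    by unfold_locales (use sc f_hess[OF c] lam in auto)
  have P_form: "x \<bullet> (?P w *v y) = x \<bullet> (hess (F ?c 1) w *v y) + \<mu> * (x \<bullet> y)" for x y w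
    by (simp add: disco_preconditioner_def matrix_vector_mult_add_rdistrib inner_add_right
        scaleR_matrix_vector_assoc[symmetric])
  have P_sym: "(?P w *v x) \<bullet> y = x \<bullet> (?P w *v y)" for w x y
    using P_form[of y w x] P_form[of x w y] F_hess(1)[OF c one_in, of x w y] by (simp add: inner_commute)
  have P_sq: "x \<bullet> (?P w *v x) = x \<bullet> (hess (F ?c 1) w *v x) + \<mu> * (norm x)\<^sup>2" for x w
    by (simp add: P_form power2_norm_eq_inner)
  have P_pos: "0 < x \<bullet> (?P w *v x)" if "x \<noteq> 0" for x w
  proof -
    have "0 < \<mu> * (norm x)\<^sup>2" "0 \<le> lam * (norm x)\<^sup>2" using \<mu> lam that by auto
    then show ?thesis unfolding P_sq using F_hess(2)[OF c one_in, of x w] by linarith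
  qed
  have sub: "norm w \<le> sqrt (2 * V\<^sub>0 / lam + 2 * G / lam * R)"
    if "f ?c w \<le> f ?c (disco_init \<rho> m (F ?c))" for w
    by (rule sublevel_norm_le[OF c \<rho> that])
  have scale: "x \<le> k / lam * z" if "x \<le> k * u" "lam * u \<le> z" "0 \<le> k" for x k u z
  proof -
    have "k * (lam * u) \<le> k * z" using that by (intro mult_left_mono)
    moreover have "lam * x \<le> lam * (k * u)" using that(1) lam by (intro mult_left_mono) auto
    moreover have "lam * (k * u) = k * (lam * u)" by (simp only: mult_ac)
    ultimately have "lam * x \<le> k * z" by linarith
    then show ?thesis using lam by (simp add: field_simps)
  qed
  have g0: "0 \<le> g" unfolding g_def using f_min_le[OF c] by simp
  have lnC: "0 \<le> ln (2 * L / (pcg_beta * lam))"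
    using lam_le_L lam by (simp add: pcg_beta_def)
  obtain a b where ab: "0 < a" "a < b" "sqrt (b / a) \<le> sqrt (1 + 2 * \<mu> / lam) + sqrt (2 * L / lam) * y"
    and lower: "\<And>w x. f ?c w \<le> f ?c (disco_init \<rho> m (F ?c)) \<Longrightarrow> a * (x \<bullet> (?P w *v x)) \<le> x \<bullet> (hess (f ?c) w *v x)"
    and upper: "\<And>w x. f ?c w \<le> f ?c (disco_init \<rho> m (F ?c)) \<Longrightarrow> x \<bullet> (hess (f ?c) w *v x) \<le> b * (x \<bullet> (?P w *v x))"
  proof (cases "y \<le> 1")
    case True
    then have dev': "\<bar>u \<bullet> (hess (F ?c 1) w *v u) - u \<bullet> (hess (f ?c) w *v u)\<bar> \<le> \<mu> * (norm u)\<^sup>2"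
      if "f ?c w \<le> f ?c (disco_init \<rho> m (F ?c))" for u w
      using dev[OF sub[OF that], of u] by simp
    let ?q = "1 + 2 * \<mu> / lam"
    have q: "1 < ?q" using \<mu> lam by simp
    show ?thesis
    proof (rule that[of "1 / ?q" 1])
      show "0 < 1 / ?q" "1 / ?q < 1" using q by simp_all
      show "sqrt (1 / (1 / ?q)) \<le> sqrt ?q + sqrt (2 * L / lam) * y" using y lam lam_le_L by simp
    next
      fix w and x :: "real ^ 'd" assume w: "f ?c w \<le> f ?c (disco_init \<rho> m (F ?c))"
      have "x \<bullet> (?P w *v x) - x \<bullet> (hess (f ?c) w *v x) \<le> 2 * \<mu> * (norm x)\<^sup>2"
        unfolding P_sq using dev'[OF w, of x] by linarith
      from scale[OF this f_hess(2)[OF c, of x w]] \<mu>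
      have "x \<bullet> (?P w *v x) \<le> ?q * (x \<bullet> (hess (f ?c) w *v x))" by (simp add: algebra_simps)
      then show "1 / ?q * (x \<bullet> (?P w *v x)) \<le> x \<bullet> (hess (f ?c) w *v x)"
        using q by (simp only: pos_divide_le_eq times_divide_eq_left mult_1) (simp add: mult.commute)
      show "x \<bullet> (hess (f ?c) w *v x) \<le> 1 * (x \<bullet> (?P w *v x))"
        unfolding P_sq mult_1 using dev'[OF w, of x] by linarith
    qed
  next
    case False
    then have y1: "1 < y" by simp
    show ?thesis
    proof (rule that[of "lam / (2 * L)" y])
      show "0 < lam / (2 * L)" using lam L_pos by simp
      show "lam / (2 * L) < y" using y1 lam_le_L L_pos by (smt (verit) divide_le_eq_1_pos)
      have "sqrt (y / (lam / (2 * L))) = sqrt (2 * L / lam) * sqrt y"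
        using lam L_pos by (simp add: real_sqrt_mult[symmetric] field_simps)
      also have "\<dots> \<le> sqrt (2 * L / lam) * y"
      proof (intro mult_left_mono)
        have "y \<le> y\<^sup>2" using y1 by (simp add: power2_eq_square)
        then show "sqrt y \<le> y" using y by (intro real_le_lsqrt) auto
      qed (use lam L_pos in simp)
      also have "\<dots> \<le> sqrt (1 + 2 * \<mu> / lam) + sqrt (2 * L / lam) * y" using \<mu> lam by simp
      finally show "sqrt (y / (lam / (2 * L))) \<le> sqrt (1 + 2 * \<mu> / lam) + sqrt (2 * L / lam) * y" .
    next
      fix w and x :: "real ^ 'd" assume w: "f ?c w \<le> f ?c (disco_init \<rho> m (F ?c))"
      have "\<mu> * (norm x)\<^sup>2 \<le> L * (norm x)\<^sup>2" using \<mu> by (intro mult_right_mono) auto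
      then have "x \<bullet> (?P w *v x) \<le> 2 * L * (norm x)\<^sup>2"
        unfolding P_sq using F_hess(3)[OF c one_in, of x w] by linarith
      from scale[OF this f_hess(2)[OF c, of x w]] L_pos
      have "x \<bullet> (?P w *v x) \<le> 2 * L / lam * (x \<bullet> (hess (f ?c) w *v x))" by simp
      then show "lam / (2 * L) * (x \<bullet> (?P w *v x)) \<le> x \<bullet> (hess (f ?c) w *v x)"
        using lam L_pos by (simp add: field_simps)
      have "\<mu> * max 1 y * (norm x)\<^sup>2 = y * (\<mu> * (norm x)\<^sup>2)" using y1 by (simp add: max_def)
      then have "x \<bullet> (hess (f ?c) w *v x) \<le> x \<bullet> (hess (F ?c 1) w *v x) + y * (\<mu> * (norm x)\<^sup>2)"
        using dev[OF sub[OF w], of x] by linarith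
      also have "\<dots> \<le> y * (x \<bullet> (hess (F ?c 1) w *v x)) + y * (\<mu> * (norm x)\<^sup>2)"
      proof -
        have "0 \<le> lam * (norm x)\<^sup>2" using lam by simp
        then have "0 \<le> x \<bullet> (hess (F ?c 1) w *v x)" using F_hess(2)[OF c one_in, of x w] by linarith
        then show ?thesis using y1 mult_right_mono[of 1 y] by simp
      qed
      finally show "x \<bullet> (hess (f ?c) w *v x) \<le> y * (x \<bullet> (?P w *v x))" unfolding P_sq by (simp add: distrib_left)
    qed
  qed
  have "ennreal_of_enat (disco_rounds lam L \<rho> \<mu> m (F ?c) \<epsilon>)
      \<le> ennreal (1 + (K + 2 * g / omega (1 / 6)) * (2 + sqrt (b / a) * ln (2 * L / (pcg_beta * lam))))"
    unfolding K_def g_def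
    by (rule disco_rounds_le[OF self_concordant_problem_axioms f_min_le[OF c] P_sym P_pos ab(1,2) lower upper \<epsilon>])
  also have "\<dots> \<le> ennreal (1 + (K + 2 * g / omega (1 / 6))
        * (2 + (sqrt (1 + 2 * \<mu> / lam) + sqrt (2 * L / lam) * y) * ln (2 * L / (pcg_beta * lam))))"
    using ab(3) lnC g0 omega_sixth_pos
    by (intro ennreal_leI add_left_mono mult_left_mono mult_right_mono) (auto simp: K_def)
  finally show ?thesis .
qed


text \<open>The pointwise bound is made linear in the gap and in \<open>Y\<close>, so that the two
  expectations can be inserted separately.\<close>

lemma expected_rounds:
  fixes D \<epsilon> \<rho> \<mu> r \<delta> C\<^sub>1 C\<^sub>2 C\<^sub>3 X W :: real and d :: nat
  assumes d: "d = CARD('d)"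
    and sc: "\<And>\<xi>. \<xi> \<in> space P \<Longrightarrow> standard_self_concordant (f (sample \<xi>))"
    and D: "D > 0"
    and minimizer_bound: "(\<integral>\<^sup>+\<xi>. ennreal ((norm (minimizer (f (sample \<xi>))))\<^sup>2) \<partial>P) \<le> ennreal (D\<^sup>2)"
    and X_eq: "X = G * D / sqrt (real n)" and W_eq: "W = 4 * V\<^sub>0 + 2 * G\<^sup>2 / lam"
    and rho_eq: "\<rho> = sqrt 6 * G / (sqrt (real n) * D)"
    and r_eq: "r = sqrt (2 * V\<^sub>0 / lam + 2 * G / lam * sqrt (2 * V\<^sub>0 / lam))"
    and delta_eq: "\<delta> = X * (sqrt (lam / (4 * L)) / W)"
    and delta: "0 < \<delta>" "\<delta> < 1"
    and C3_eq: "C\<^sub>3 = ln (1 + r * M * sqrt (2 * real n) / L) + ln (real (m * d) / \<delta>) / real d"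
    and mu_eq: "\<mu> = min L (sqrt (32 * L\<^sup>2 * real d / real n) * sqrt C\<^sub>3)"
    and eps: "\<epsilon> > 0"
    and C2_eq: "C\<^sub>2 = ln (2 * L / (pcg_beta * lam))"
  shows "(\<lambda>\<xi>. ennreal_of_enat (disco_rounds lam L \<rho> \<mu> m (F (sample \<xi>)) \<epsilon>)) \<in> borel_measurable P"
    and "(\<integral>\<^sup>+\<xi>. ennreal_of_enat (disco_rounds lam L \<rho> \<mu> m (F (sample \<xi>)) \<epsilon>) \<partial>P)
      \<le> ennreal (1 + ((1 + real (nat \<lceil>log 2 (2 * omega (1 / 6) / \<epsilon>)\<rceil>)) * (1 + X / W) + 6 / omega (1 / 6) * X)
            * (2 + C\<^sub>2 * sqrt (1 + 2 * sqrt (32 * L\<^sup>2 * real d * C\<^sub>3 / (lam\<^sup>2 * real n)))))"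
    and "0 \<le> X" "0 < W" "0 \<le> C\<^sub>3" "2 \<le> C\<^sub>2"
proof -
  \<comment> \<open>Positivity of \<delta> rules out G = 0, and thereby makes \<rho> and W
    positive.\<close>
  have G: "0 < G"
  proof -
    have "G \<noteq> 0" using delta(1) unfolding delta_eq X_eq by auto
    then show ?thesis using G_nonneg by simp
  qed
  have n0: "0 < real n" using n by simp
  show X0: "0 \<le> X" using G D by (simp add: X_eq)
  show W0: "0 < W" using V0_nonneg G lam unfolding W_eq by (intro add_nonneg_pos) auto
  have \<rho>: "0 < \<rho>" using G D n0 by (simp add: rho_eq)
  have r: "0 \<le> r" unfolding r_eq using V0_nonneg G lam by simp
  have rR: "r = sqrt (2 * V\<^sub>0 / lam + 2 * G / lam * R)" by (simp add: r_eq R_def)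
  have d0: "0 < d" using d by simp
  have C3: "0 < C\<^sub>3"
  proof -
    have "1 \<le> m * d" using m d0 by (simp add: Suc_le_eq)
    then have md: "1 \<le> real (m * d)" by (metis of_nat_1 of_nat_mono)
    then have "1 < real (m * d) / \<delta>" using delta by (simp only: pos_less_divide_eq)
    then have "0 < ln (real (m * d) / \<delta>) / real d" using d0 by simp
    moreover have "0 \<le> ln (1 + r * M * sqrt (2 * real n) / L)" using r M_nonneg L_pos by simp
    ultimately show ?thesis unfolding C3_eq by linarith
  qed
  then show "0 \<le> C\<^sub>3" by simp
  have \<mu>: "0 < \<mu>" "\<mu> \<le> L" unfolding mu_eq using L_pos C3 d0 n0 by auto
  have C2: "2 \<le> C\<^sub>2"
  proof -
    have "ln (2 ^ 5 :: real) \<le> ln (2 * L / (pcg_beta * lam))"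
      using lam lam_le_L by (subst ln_le_cancel_iff) (auto simp: pcg_beta_def field_simps)
    moreover have "ln (2 ^ 5 :: real) = 5 * ln 2" using ln_realpow[of 2 5] by simp
    ultimately show ?thesis using ln2_ge_two_thirds unfolding C2_eq by linarith
  qed
  then show "2 \<le> C\<^sub>2" .
  obtain Y where Y: "Y \<in> borel_measurable P" "\<And>\<xi>. 0 \<le> Y \<xi>" "(\<integral>\<^sup>+\<xi>. ennreal (Y \<xi>) \<partial>P) \<le> ennreal \<delta>"
    "\<And>\<xi> w u. \<xi> \<in> space P \<Longrightarrow> norm w \<le> r \<Longrightarrow>
      \<bar>u \<bullet> (hess (F (sample \<xi>) 1) w *v u) - u \<bullet> (hess (f (sample \<xi>)) w *v u)\<bar> \<le> \<mu> * max 1 (Y \<xi>) * (norm u)\<^sup>2"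
    using hess_deviation[OF r delta d mu_eq[unfolded C3_eq]] by blast
  have P_pos: "0 < x \<bullet> (disco_preconditioner \<mu> (F (sample \<xi>)) w *v x)" if "\<xi> \<in> space P" "x \<noteq> 0" for \<xi> w x
  proof -
    have "x \<bullet> (disco_preconditioner \<mu> (F (sample \<xi>)) w *v x)
        = x \<bullet> (hess (F (sample \<xi>) 1) w *v x) + \<mu> * (norm x)\<^sup>2"
      by (simp add: disco_preconditioner_def matrix_vector_mult_add_rdistrib inner_add_right
          scaleR_matrix_vector_assoc[symmetric] power2_norm_eq_inner)
    moreover have "0 < \<mu> * (norm x)\<^sup>2" "0 \<le> lam * (norm x)\<^sup>2" using \<mu> lam that by auto
    ultimately show ?thesis using F_hess(2)[OF sample_valid[OF that(1)] one_in, of x w] by linarith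
  qed
  let ?T = "\<lambda>\<xi>. ennreal_of_enat (disco_rounds lam L \<rho> \<mu> m (F (sample \<xi>)) \<epsilon>)"
  show "?T \<in> borel_measurable P"
  proof (rule disco_rounds_measurable[OF m])
    show "(\<lambda>\<xi>. F (sample \<xi>) i w) \<in> borel_measurable P" if "i \<in> {1..m}" for i w
      by (intro F_measurable z_measurable that)
    show "(\<lambda>\<xi>. disco_init \<rho> m (F (sample \<xi>))) \<in> borel_measurable P"
      using \<rho> by (intro disco_init_measurable z_measurable) auto
    show "(\<lambda>\<xi>. minimizer (f (sample \<xi>))) \<in> borel_measurable P"
      by (intro minimizer_measurable z_measurable)
    show "invertible (disco_preconditioner \<mu> (F (sample \<xi>)) w)" if "\<xi> \<in> space P" for \<xi> w
      by (rule posdef_invertible) (rule P_pos[OF that])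
  qed (use F_smooth(2) f_smooth(2) hess_continuous sample_valid one_in in auto)
  define g where "g \<xi> = f (sample \<xi>) (disco_init \<rho> m (F (sample \<xi>))) - f (sample \<xi>) (minimizer (f (sample \<xi>)))" for \<xi>
  define K where "K = real (nat \<lceil>log 2 (2 * omega (1 / 6) / \<epsilon>)\<rceil>)"
  define B where "B = V\<^sub>0 + G * R"
  define \<kappa> where "\<kappa> = sqrt (1 + 2 * \<mu> / lam)"
  have \<kappa>0: "0 \<le> \<kappa>" using \<mu> lam by (simp add: \<kappa>_def)
  let ?\<omega> = "omega (1 / 6)"
  have K0: "0 \<le> K" by (simp add: K_def)
  have g: "0 \<le> g \<xi>" "g \<xi> \<le> B" if "\<xi> \<in> space P" for \<xi>
  proof -
    show "0 \<le> g \<xi>" unfolding g_def using f_min_le[OF sample_valid[OF that]] by simp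
    have "0 \<le> lam / 2 * (norm (minimizer (f (sample \<xi>))))\<^sup>2" using lam by simp
    then have "0 \<le> f (sample \<xi>) (minimizer (f (sample \<xi>)))"
      using f_nonneg[OF sample_valid[OF that]] by (rule order_trans)
    then show "g \<xi> \<le> B" unfolding g_def B_def using f_init_le[OF sample_valid[OF that], of \<rho>] \<rho> by simp
  qed
  have g_meas[measurable]: "g \<in> borel_measurable P"
    unfolding g_def[abs_def] using \<rho>
    by (intro borel_measurable_diff f_at_measurable disco_init_measurable minimizer_measurable z_measurable) auto
  have g_int: "integrable P g"
    by (rule integrable_const_bound[where B = B]) (use g in \<open>auto intro!: AE_I2\<close>)
  have E_g: "expectation g \<le> 41 / 20 * X"
  proof -
    let ?x = "\<lambda>\<xi>. minimizer (f (sample \<xi>))"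
    have x_meas[measurable]: "?x \<in> borel_measurable P" by (intro minimizer_measurable z_measurable)
    have "integrable P (\<lambda>\<xi>. (norm (?x \<xi>))\<^sup>2)"
      by (rule integrable_const_bound[where B = "R\<^sup>2"]) (auto intro!: AE_I2 power_mono minimizer_norm sample_valid)
    then have "ennreal (expectation (\<lambda>\<xi>. (norm (?x \<xi>))\<^sup>2)) \<le> ennreal (D\<^sup>2)"
      using minimizer_bound by (subst nn_integral_eq_integral[symmetric]) auto
    then have ED: "expectation (\<lambda>\<xi>. (norm (?x \<xi>))\<^sup>2) \<le> D\<^sup>2" by (subst (asm) ennreal_le_iff) auto
    have "expectation g \<le> \<rho> / 2 * expectation (\<lambda>\<xi>. (norm (?x \<xi>))\<^sup>2) + 2 * G\<^sup>2 / ((lam + \<rho>) * real n)"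
      unfolding g_def[abs_def] by (rule expected_initial_gap) (use \<rho> in simp)
    \<comment> \<open>lam is dropped from the denominator. For the prescribed \<rho> the two terms
      are sqrt 6 / 2 and sqrt 6 / 3 times X, in total 5/6 sqrt 6 X, just below 41/20 X.\<close>
    also have "\<dots> \<le> \<rho> / 2 * D\<^sup>2 + 2 * G\<^sup>2 / (\<rho> * real n)"
      using ED \<rho> lam n0 by (intro add_mono mult_left_mono divide_left_mono mult_right_mono) auto
    also have "\<dots> = 5 / 6 * sqrt 6 * X"
    proof -
      define s where "s = sqrt (real n)"
      have s: "0 < s" "real n = s * s" using n0 by (simp_all add: s_def)
      define q where "q = sqrt (6 :: real)"
      have q: "0 < q" "q * q = 6" by (simp_all add: q_def)
      have "\<rho> / 2 * D\<^sup>2 = q / 2 * (G * D / s)"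
        unfolding rho_eq s_def[symmetric] q_def[symmetric] using D s by (simp add: power2_eq_square)
      moreover have "2 * G\<^sup>2 / (\<rho> * real n) = q / 3 * (G * D / s)"
      proof -
        have "2 * G\<^sup>2 / (\<rho> * real n) = 2 / q * (G * D / s)"
          unfolding rho_eq s_def[symmetric] q_def[symmetric] s(2) using D s q G
          by (simp add: power2_eq_square field_simps)
        also have "2 / q = q / 3" using q by (simp add: field_simps)
        finally show ?thesis .
      qed
      ultimately show ?thesis unfolding X_eq s_def[symmetric] q_def[symmetric] by (simp add: algebra_simps)
    qed
    also have "\<dots> \<le> 41 / 20 * X"
    proof -
      have "sqrt 6 \<le> 246 / 100" by (rule real_le_lsqrt) (auto simp: power2_eq_square)
      then show ?thesis using X0 by (intro mult_right_mono) auto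
    qed
    finally show ?thesis .
  qed
  \<comment> \<open>Arithmetic-geometric mean: 2 G R <= 2 \<open>V\<^sub>0\<close> + G^2 /
    lam.\<close>
  have B_le: "B \<le> W / 2"
  proof -
    have "0 \<le> (sqrt (2 * V\<^sub>0) - sqrt (G\<^sup>2 / lam))\<^sup>2" by simp
    also have "\<dots> = 2 * V\<^sub>0 + G\<^sup>2 / lam - 2 * (sqrt (2 * V\<^sub>0) * sqrt (G\<^sup>2 / lam))"
      using V0_nonneg lam by (simp add: power2_diff)
    also have "sqrt (2 * V\<^sub>0) * sqrt (G\<^sup>2 / lam) = G * R"
      using V0_nonneg lam G by (simp add: R_def real_sqrt_divide real_sqrt_mult)
    finally have "0 \<le> 2 * V\<^sub>0 + G\<^sup>2 / lam - 2 * (G * R)" .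
    moreover have "2 * G\<^sup>2 / lam = 2 * (G\<^sup>2 / lam)" "0 \<le> G\<^sup>2 / lam" using lam by simp_all
    moreover have "v + x \<le> (4 * v + y) / 2" if "0 \<le> 2 * v + q - 2 * x" "y = 2 * q" "0 \<le> q" "0 \<le> v" for v x y q :: real
      using that by simp
    ultimately show ?thesis unfolding B_def W_eq using V0_nonneg by blast
  qed
  let ?b1 = "1 + K * (2 + C\<^sub>2 * \<kappa>)" and ?b2 = "2 * (2 + C\<^sub>2 * \<kappa>) / ?\<omega>"
    and ?b3 = "(K + 2 * B / ?\<omega>) * (sqrt (2 * L / lam) * C\<^sub>2)"
  have B0: "0 \<le> B" using V0_nonneg G R_nonneg by (simp add: B_def)
  have b0: "0 \<le> ?b1" "0 \<le> ?b2" "0 \<le> ?b3"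
    using K0 C2 \<kappa>0 omega_sixth_pos B0 lam L_pos by auto
  have "(\<integral>\<^sup>+\<xi>. ?T \<xi> \<partial>P) \<le> (\<integral>\<^sup>+\<xi>. ennreal ?b1 + ennreal ?b2 * ennreal (g \<xi>) + ennreal ?b3 * ennreal (Y \<xi>) \<partial>P)"
  proof (rule nn_integral_mono)
    fix \<xi> assume \<xi>: "\<xi> \<in> space P"
    have "?T \<xi> \<le> ennreal (1 + (K + 2 * g \<xi> / ?\<omega>) * (2 + (\<kappa> + sqrt (2 * L / lam) * Y \<xi>) * C\<^sub>2))"
      unfolding K_def g_def C2_eq \<kappa>_def
      by (rule rounds_le[OF \<xi> sc[OF \<xi>] less_imp_le[OF \<rho>] \<mu> eps Y(2) Y(4)[OF \<xi>, unfolded rR]])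
    also have "\<dots> \<le> ennreal (?b1 + ?b2 * g \<xi> + ?b3 * Y \<xi>)"
    proof (rule ennreal_leI)
      let ?e = "sqrt (2 * L / lam) * C\<^sub>2 * Y \<xi>"
      have e0: "0 \<le> ?e" using lam L_pos C2 Y(2) by simp
      have "(K + 2 * g \<xi> / ?\<omega>) * (2 + (\<kappa> + sqrt (2 * L / lam) * Y \<xi>) * C\<^sub>2)
          = K * (2 + C\<^sub>2 * \<kappa>) + ?b2 * g \<xi> + (K + 2 * g \<xi> / ?\<omega>) * ?e"
        by (simp add: algebra_simps add_divide_distrib)
      \<comment> \<open>Only in the product with \<open>Y\<close> is the gap replaced by its
        deterministic bound; elsewhere the gap is kept, so that its small expectation can be
        used.\<close>
      also have "(K + 2 * g \<xi> / ?\<omega>) * ?e \<le> (K + 2 * B / ?\<omega>) * ?e"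
        using g[OF \<xi>] omega_sixth_pos e0 by (intro mult_right_mono add_left_mono divide_right_mono) auto
      finally show "1 + (K + 2 * g \<xi> / ?\<omega>) * (2 + (\<kappa> + sqrt (2 * L / lam) * Y \<xi>) * C\<^sub>2) \<le> ?b1 + ?b2 * g \<xi> + ?b3 * Y \<xi>"
        by (simp only: mult.assoc add.assoc) simp
    qed
    also have "\<dots> = ennreal ?b1 + ennreal ?b2 * ennreal (g \<xi>) + ennreal ?b3 * ennreal (Y \<xi>)"
      using b0 g[OF \<xi>] Y(2)[of \<xi>]
      by (simp only: ennreal_plus ennreal_mult mult_nonneg_nonneg add_nonneg_nonneg)
    finally show "?T \<xi> \<le> ennreal ?b1 + ennreal ?b2 * ennreal (g \<xi>) + ennreal ?b3 * ennreal (Y \<xi>)" .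
  qed
  also have "\<dots> = ennreal ?b1 + ennreal ?b2 * (\<integral>\<^sup>+\<xi>. ennreal (g \<xi>) \<partial>P) + ennreal ?b3 * (\<integral>\<^sup>+\<xi>. ennreal (Y \<xi>) \<partial>P)"
    using Y(1) by (simp add: nn_integral_add nn_integral_cmult emeasure_space_1)
  also have "(\<integral>\<^sup>+\<xi>. ennreal (g \<xi>) \<partial>P) = ennreal (expectation g)"
    by (rule nn_integral_eq_integral[OF g_int]) (use g in \<open>auto intro!: AE_I2\<close>)
  also have "ennreal ?b1 + ennreal ?b2 * ennreal (expectation g) + ennreal ?b3 * (\<integral>\<^sup>+\<xi>. ennreal (Y \<xi>) \<partial>P)
      \<le> ennreal ?b1 + ennreal ?b2 * ennreal (expectation g) + ennreal ?b3 * ennreal \<delta>"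
    by (intro add_left_mono mult_left_mono Y(3)) simp
  also have "\<dots> = ennreal (?b1 + ?b2 * expectation g + ?b3 * \<delta>)"
  proof -
    have "0 \<le> expectation g" using g by (intro integral_nonneg_AE AE_I2)
    then show ?thesis using b0 less_imp_le[OF delta(1)]
      by (simp only: ennreal_plus ennreal_mult mult_nonneg_nonneg add_nonneg_nonneg)
  qed
  also have "\<dots> \<le> ennreal (1 + ((1 + K) * (1 + X / W) + 6 / ?\<omega> * X)
      * (2 + C\<^sub>2 * sqrt (1 + 2 * sqrt (32 * L\<^sup>2 * real d * C\<^sub>3 / (lam\<^sup>2 * real n)))))"
  proof (rule ennreal_leI, rule rounds_bound_combine)
    have "sqrt (32 * L\<^sup>2 * real d * C\<^sub>3 / (lam\<^sup>2 * real n)) = sqrt (32 * L\<^sup>2 * real d / real n) * sqrt C\<^sub>3 / lam"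
    proof -
      have "32 * L\<^sup>2 * real d * C\<^sub>3 / (lam\<^sup>2 * real n) = (32 * L\<^sup>2 * real d / real n) * C\<^sub>3 / lam\<^sup>2"
        by (simp add: field_simps)
      then show ?thesis using lam by (simp only: real_sqrt_divide real_sqrt_mult[of _ C\<^sub>3]) simp
    qed
    then have "\<mu> / lam \<le> sqrt (32 * L\<^sup>2 * real d * C\<^sub>3 / (lam\<^sup>2 * real n))"
      using lam mu_eq by (simp add: divide_right_mono)
    then show "\<kappa> \<le> sqrt (1 + 2 * sqrt (32 * L\<^sup>2 * real d * C\<^sub>3 / (lam\<^sup>2 * real n)))"
      unfolding \<kappa>_def by (intro real_sqrt_le_mono) simp
    show "1 \<le> sqrt (1 + 2 * sqrt (32 * L\<^sup>2 * real d * C\<^sub>3 / (lam\<^sup>2 * real n)))"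
      using C3 by simp
  qed (use K0 omega_sixth_pos X0 W0 lam lam_le_L delta_eq C2 \<kappa>0 B_le E_g in auto)
  finally show "(\<integral>\<^sup>+\<xi>. ?T \<xi> \<partial>P) \<le> ennreal (1 + ((1 + real (nat \<lceil>log 2 (2 * ?\<omega> / \<epsilon>)\<rceil>)) * (1 + X / W) + 6 / ?\<omega> * X)
      * (2 + C\<^sub>2 * sqrt (1 + 2 * sqrt (32 * L\<^sup>2 * real d * C\<^sub>3 / (lam\<^sup>2 * real n)))))"
    unfolding K_def .
qed

end

text \<open>Expectations are nonnegative integrals of extended values, so finiteness of E[T] is part
  of the claim; measurability is stated because such an integral does not entail it. The asymptotic
  form is given with the explicit constant 2000 for \<epsilon> <= 1/2, where ln (1/\<epsilon>) is
  bounded away from 0.\<close>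

theorem theorem4:
  fixes \<phi> :: "real ^ 'd \<Rightarrow> 'z \<Rightarrow> real"
    and P :: "'a measure" and S Q :: "'z measure" and z :: "nat \<Rightarrow> nat \<Rightarrow> 'a \<Rightarrow> 'z"
    and m n d :: nat
    and lam V\<^sub>0 G L M D \<epsilon> \<rho> \<mu> r \<delta> C\<^sub>1 C\<^sub>2 C\<^sub>3 :: real
    and F :: "'a \<Rightarrow> nat \<Rightarrow> real ^ 'd \<Rightarrow> real" and f :: "'a \<Rightarrow> real ^ 'd \<Rightarrow> real"
    and T :: "'a \<Rightarrow> enat"
  assumes d: "d = CARD('d)" and m: "m \<ge> 1" and n: "n \<ge> 1"
    and prob: "prob_space P"
    and indep: "prob_space.indep_vars P (\<lambda>_. S) (\<lambda>(i, j). z i j) ({1..m} \<times> {1..n})"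
    and ident: "\<And>i j. i \<in> {1..m} \<Longrightarrow> j \<in> {1..n} \<Longrightarrow> distr P S (z i j) = Q"
    and lam: "lam > 0"
    and phi_meas: "\<And>w. \<phi> w \<in> borel_measurable S"
    and phi_convex: "\<And>x. x \<in> space S \<Longrightarrow> convex_on UNIV (\<lambda>w. \<phi> w x)"
    and phi_smooth: "\<And>x. x \<in> space S \<Longrightarrow> twice_differentiable (\<lambda>w. \<phi> w x)"
    and phi_nonneg: "\<And>x w. x \<in> space S \<Longrightarrow> \<phi> w x \<ge> 0"
    and phi_zero: "\<And>x. x \<in> space S \<Longrightarrow> \<phi> 0 x \<le> V\<^sub>0"
    and phi_grad: "\<And>x w. x \<in> space S \<Longrightarrow> norm w \<le> sqrt (2 * V\<^sub>0 / lam) \<Longrightarrow>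
                     norm (grad (\<lambda>w. \<phi> w x) w) \<le> G"
    and phi_hess: "\<And>x w. x \<in> space S \<Longrightarrow> spectral_norm (hess (\<lambda>w. \<phi> w x) w) \<le> L - lam"
    and phi_hess_lipschitz: "\<And>x u w. x \<in> space S \<Longrightarrow>
          spectral_norm (hess (\<lambda>w. \<phi> w x) u - hess (\<lambda>w. \<phi> w x) w) \<le> M * norm (u - w)"
    and F_eq: "F = (\<lambda>\<xi>. local_loss \<phi> lam n (\<lambda>i j. z i j \<xi>))"
    and f_eq: "f = (\<lambda>\<xi>. average_loss m (F \<xi>))"
    and self_concordant: "\<And>\<xi>. \<xi> \<in> space P \<Longrightarrow> standard_self_concordant (f \<xi>)"
    and D: "D > 0"
    and minimizer_bound: "(\<integral>\<^sup>+\<xi>. ennreal ((norm (minimizer (f \<xi>)))\<^sup>2) \<partial>P) \<le> ennreal (D\<^sup>2)"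
    and rho_eq: "\<rho> = sqrt 6 * G / (sqrt (real n) * D)"
    and r_eq: "r = sqrt (2 * V\<^sub>0 / lam + 2 * G / lam * sqrt (2 * V\<^sub>0 / lam))"
    and delta_eq: "\<delta> = G * D / sqrt (real n) * (sqrt (lam / (4 * L)) / (4 * V\<^sub>0 + 2 * G\<^sup>2 / lam))"
    and delta: "0 < \<delta>" "\<delta> < 1"
    and mu_eq: "\<mu> = min L (sqrt (32 * L\<^sup>2 * real d / real n)
                   * sqrt (ln (1 + r * M * sqrt (2 * real n) / L) + ln (real (m * d) / \<delta>) / real d))"
    and eps: "\<epsilon> > 0"
    and C1_eq: "C\<^sub>1 = (1 + real (nat \<lceil>log 2 (2 * omega (1 / 6) / \<epsilon>)\<rceil>))
                   * (1 + 1 / sqrt (real n) * (G * D / (4 * V\<^sub>0 + 2 * G\<^sup>2 / lam)))"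
    and C2_eq: "C\<^sub>2 = ln (2 * L / (pcg_beta * lam))"
    and C3_eq: "C\<^sub>3 = ln (1 + r * M * sqrt (2 * real n) / L) + ln (real (d * m) / \<delta>) / real d"
    and T_eq: "T = (\<lambda>\<xi>. disco_rounds lam L \<rho> \<mu> m (F \<xi>) \<epsilon>)"
  shows "(\<lambda>\<xi>. ennreal_of_enat (T \<xi>)) \<in> borel_measurable P \<and>
    (\<integral>\<^sup>+\<xi>. ennreal_of_enat (T \<xi>) \<partial>P)
      \<le> ennreal (1 + (C\<^sub>1 + 6 / omega (1 / 6) * (G * D / sqrt (real n)))
                   * (2 + C\<^sub>2 * sqrt (1 + 2 * sqrt (32 * L\<^sup>2 * real d * C\<^sub>3 / (lam\<^sup>2 * real n))))) \<and>
    (\<epsilon> \<le> 1 / 2 \<longrightarrow>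
      (\<integral>\<^sup>+\<xi>. ennreal_of_enat (T \<xi>) \<partial>P)
        \<le> ennreal (2000 * (C\<^sub>2 * (1 + C\<^sub>3) powr (1 / 4)
                       * (1 + 1 / sqrt (real n) * (G * D / (4 * V\<^sub>0 + 2 * G\<^sup>2 / lam))))
             * ((ln (1 / \<epsilon>) + G * D / sqrt (real n))
                 * (1 + sqrt L * real d powr (1 / 4) / (sqrt lam * real n powr (1 / 4))))))"
proof -
  interpret prob_space P by (rule prob)
  have one: "1 \<in> {1..m}" "1 \<in> {1..n}" using m n by auto
  have "z 1 1 \<in> measurable P S"
    using indep one unfolding indep_vars_def by fastforce
  \<comment> \<open>A probability space has a point, and the value of a sample there shows that the
    sample space is nonempty.\<close>
  moreover obtain \<xi>\<^sub>0 where "\<xi>\<^sub>0 \<in> space P" using not_empty by blast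
  ultimately have "z 1 1 \<xi>\<^sub>0 \<in> space S" by (rule measurable_space)
  then have space_S: "space S \<noteq> {}" by blast
  interpret erm_sample \<phi> S lam V\<^sub>0 G L M m n P z Q
    by unfold_locales (fact m n lam space_S phi_meas phi_convex phi_smooth phi_nonneg phi_zero phi_grad phi_hess
        phi_hess_lipschitz indep ident)+
  define X where "X = G * D / sqrt (real n)"
  define W where "W = 4 * V\<^sub>0 + 2 * G\<^sup>2 / lam"
  have \<delta>': "\<delta> = X * (sqrt (lam / (4 * L)) / W)" by (simp only: delta_eq X_def W_def)
  have C3': "C\<^sub>3 = ln (1 + r * M * sqrt (2 * real n) / L) + ln (real (m * d) / \<delta>) / real d"
    by (simp only: C3_eq mult.commute[of d m])
  have T': "T = (\<lambda>\<xi>. disco_rounds lam L \<rho> \<mu> m (local_loss \<phi> lam n (\<lambda>i j. z i j \<xi>)) \<epsilon>)"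
    by (simp only: T_eq F_eq)
  note main = expected_rounds[OF d self_concordant[unfolded f_eq F_eq] D minimizer_bound[unfolded f_eq F_eq]
      X_def W_def rho_eq r_eq \<delta>' delta C3' mu_eq[folded C3'] eps C2_eq]
  define A where "A = 1 + real (nat \<lceil>log 2 (2 * omega (1 / 6) / \<epsilon>)\<rceil>)"
  define \<theta> where "\<theta> = 1 / sqrt (real n) * (G * D / W)"
  have \<theta>: "X / W = \<theta>" by (simp add: X_def \<theta>_def)
  have C1: "C\<^sub>1 = A * (1 + \<theta>)" by (simp only: C1_eq A_def \<theta>_def W_def)
  let ?B = "1 + (C\<^sub>1 + 6 / omega (1 / 6) * X) * (2 + C\<^sub>2 * sqrt (1 + 2 * sqrt (32 * L\<^sup>2 * real d * C\<^sub>3 / (lam\<^sup>2 * real n))))"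
  have bound: "(\<integral>\<^sup>+\<xi>. ennreal_of_enat (T \<xi>) \<partial>P) \<le> ennreal ?B"
    using main(2) unfolding T' C1 A_def \<theta> .
  have "\<epsilon> \<le> 1 / 2 \<Longrightarrow> ?B \<le> 2000 * (C\<^sub>2 * (1 + C\<^sub>3) powr (1 / 4) * (1 + \<theta>))
      * ((ln (1 / \<epsilon>) + X) * (1 + sqrt L * real d powr (1 / 4) / (sqrt lam * real n powr (1 / 4))))"
    unfolding C1
    by (rule rounds_bound_simplified)
      (use eps main(3-6) lam lam_le_L n iteration_count_le[OF eps] \<theta> in \<open>auto simp: A_def \<theta>[symmetric]\<close>)
  then have "\<epsilon> \<le> 1 / 2 \<Longrightarrow> (\<integral>\<^sup>+\<xi>. ennreal_of_enat (T \<xi>) \<partial>P)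
      \<le> ennreal (2000 * (C\<^sub>2 * (1 + C\<^sub>3) powr (1 / 4) * (1 + \<theta>))
      * ((ln (1 / \<epsilon>) + X) * (1 + sqrt L * real d powr (1 / 4) / (sqrt lam * real n powr (1 / 4)))))"
    by (rule order_trans[OF bound ennreal_leI])
  with bound main(1) show ?thesis
    unfolding T' X_def \<theta>_def W_def by blast
qed

end
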